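(* Over $\mathsf{RCA}_0$, $\mathsf{PRT}^n_{2^{n-1}-1+k}$ implies $\mathsf{RT}^n_k$, for each $n\in\omega$ and $k\in\mathbb{N}$.
   Context: $\mathsf{RT}^n_k$ states: for every $f:[\mathbb{N}]^n\rightarrow\{1,\dots,k\}$ there is an infinite $H\subseteq\mathbb{N}$ homogeneous for $f$ (i.e. $f$ is constant on $[H]^n$, the set of $n$-element subsets of $H$). $\mathsf{PRT}^n_j$ states: for every $\phi:\mathbb{N}\rightarrow\mathbb{N}$ with $(\forall w)[w\rightarrow(\phi(w))^n_{j+1}]$ and every $f:[\mathbb{N}]^n\rightarrow\{1,\dots,j\}$, there is $H\subseteq\mathbb{N}$ that is packed for $\phi$ (i.e. $|H\cap\{1,\dots,w\}|\geq\phi(w)$ for infinitely many $w$) and semi-homogeneous for $f$ (i.e. $f$ takes at most $2^{n-1}$ values on $[H]^n$). Here $w\rightarrow(m)^n_j$ means: every coloring of the $n$-element subsets of a $w$-element set with $j$ colors has a homogeneous subset of size $m$. *)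

theory Defs
  imports Main
begin

section \<open>The language of second-order arithmetic and its structures\<close>

text \<open>
  Number variables and set variables are two separate families, each indexed by \<^typ>\<open>nat\<close>.
  As usual in second-order arithmetic, equality is primitive for numbers only.
\<close>

datatype l2_term = Var nat | Zero | One | Add l2_term l2_term | Mul l2_term l2_term

datatype l2_form =
    Eq l2_term l2_term
  | Less l2_term l2_term
  | Mem l2_term nat
  | Neg l2_form
  | And l2_form l2_form
  | Or l2_form l2_form
  | Imp l2_form l2_form
  | AllN nat l2_form
  | ExN nat l2_form
  | AllS nat l2_form
  | ExS nat l2_form

text \<open>
  A structure with number domain \<^typ>\<open>'a\<close>; the set quantifiers range over \<open>l2_sets\<close>
  (Henkin semantics), and membership is true membership.
\<close>

record 'a l2_struct =
  l2_zero :: 'a ("\<zero>\<index>")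
  l2_one :: 'a ("\<one>\<index>")
  l2_add :: "'a \<Rightarrow> 'a \<Rightarrow> 'a" (infixl "\<oplus>\<index>" 65)
  l2_mul :: "'a \<Rightarrow> 'a \<Rightarrow> 'a" (infixl "\<otimes>\<index>" 70)
  l2_less :: "'a \<Rightarrow> 'a \<Rightarrow> bool" (infix "\<prec>\<index>" 50)
  l2_sets :: "'a set set"

primrec eval_term :: "'a l2_struct \<Rightarrow> (nat \<Rightarrow> 'a) \<Rightarrow> l2_term \<Rightarrow> 'a" where
  "eval_term M e (Var i) = e i"
| "eval_term M e Zero = \<zero>\<^bsub>M\<^esub>"
| "eval_term M e One = \<one>\<^bsub>M\<^esub>"
| "eval_term M e (Add s t) = eval_term M e s \<oplus>\<^bsub>M\<^esub> eval_term M e t"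
| "eval_term M e (Mul s t) = eval_term M e s \<otimes>\<^bsub>M\<^esub> eval_term M e t"

primrec sat :: "'a l2_struct \<Rightarrow> (nat \<Rightarrow> 'a) \<Rightarrow> (nat \<Rightarrow> 'a set) \<Rightarrow> l2_form \<Rightarrow> bool" where
  "sat M e E (Eq s t) \<longleftrightarrow> eval_term M e s = eval_term M e t"
| "sat M e E (Less s t) \<longleftrightarrow> eval_term M e s \<prec>\<^bsub>M\<^esub> eval_term M e t"
| "sat M e E (Mem t i) \<longleftrightarrow> eval_term M e t \<in> E i"
| "sat M e E (Neg p) \<longleftrightarrow> \<not> sat M e E p"
| "sat M e E (And p q) \<longleftrightarrow> sat M e E p \<and> sat M e E q"
| "sat M e E (Or p q) \<longleftrightarrow> sat M e E p \<or> sat M e E q"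
| "sat M e E (Imp p q) \<longleftrightarrow> (sat M e E p \<longrightarrow> sat M e E q)"
| "sat M e E (AllN i p) \<longleftrightarrow> (\<forall>a. sat M (e(i := a)) E p)"
| "sat M e E (ExN i p) \<longleftrightarrow> (\<exists>a. sat M (e(i := a)) E p)"
| "sat M e E (AllS i p) \<longleftrightarrow> (\<forall>A \<in> l2_sets M. sat M e (E(i := A)) p)"
| "sat M e E (ExS i p) \<longleftrightarrow> (\<exists>A \<in> l2_sets M. sat M e (E(i := A)) p)"

primrec term_vars :: "l2_term \<Rightarrow> nat set" where
  "term_vars (Var i) = {i}"
| "term_vars Zero = {}"
| "term_vars One = {}"
| "term_vars (Add s t) = term_vars s \<union> term_vars t"
| "term_vars (Mul s t) = term_vars s \<union> term_vars t"


section \<open>Models of RCA0\<close>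

text \<open>
  \<open>Sigma00\<close>: every quantifier is a bounded number quantifier
  \<open>\<forall>i < t\<close> or \<open>\<exists>i < t\<close>; free set variables are allowed as parameters.
\<close>

inductive_set Sigma00 :: "l2_form set" where
  "Eq s t \<in> Sigma00"
| "Less s t \<in> Sigma00"
| "Mem t i \<in> Sigma00"
| "p \<in> Sigma00 \<Longrightarrow> Neg p \<in> Sigma00"
| "p \<in> Sigma00 \<Longrightarrow> q \<in> Sigma00 \<Longrightarrow> And p q \<in> Sigma00"
| "p \<in> Sigma00 \<Longrightarrow> q \<in> Sigma00 \<Longrightarrow> Or p q \<in> Sigma00"
| "p \<in> Sigma00 \<Longrightarrow> q \<in> Sigma00 \<Longrightarrow> Imp p q \<in> Sigma00"
| "p \<in> Sigma00 \<Longrightarrow> i \<notin> term_vars t \<Longrightarrow> AllN i (Imp (Less (Var i) t) p) \<in> Sigma00"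
| "p \<in> Sigma00 \<Longrightarrow> i \<notin> term_vars t \<Longrightarrow> ExN i (And (Less (Var i) t) p) \<in> Sigma00"

definition Sigma01 :: "l2_form set" where
  "Sigma01 = {ExN i p | i p. p \<in> Sigma00}"

definition Pi01 :: "l2_form set" where
  "Pi01 = {AllN i p | i p. p \<in> Sigma00}"

definition basic_axioms :: "'a l2_struct \<Rightarrow> bool" where
  "basic_axioms M \<longleftrightarrow>
     (\<forall>x. x \<oplus>\<^bsub>M\<^esub> \<one>\<^bsub>M\<^esub> \<noteq> \<zero>\<^bsub>M\<^esub>) \<and>
     (\<forall>x y. x \<oplus>\<^bsub>M\<^esub> \<one>\<^bsub>M\<^esub> = y \<oplus>\<^bsub>M\<^esub> \<one>\<^bsub>M\<^esub> \<longrightarrow> x = y) \<and>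
     (\<forall>x. x \<oplus>\<^bsub>M\<^esub> \<zero>\<^bsub>M\<^esub> = x) \<and>
     (\<forall>x y. x \<oplus>\<^bsub>M\<^esub> (y \<oplus>\<^bsub>M\<^esub> \<one>\<^bsub>M\<^esub>) = (x \<oplus>\<^bsub>M\<^esub> y) \<oplus>\<^bsub>M\<^esub> \<one>\<^bsub>M\<^esub>) \<and>
     (\<forall>x. x \<otimes>\<^bsub>M\<^esub> \<zero>\<^bsub>M\<^esub> = \<zero>\<^bsub>M\<^esub>) \<and>
     (\<forall>x y. x \<otimes>\<^bsub>M\<^esub> (y \<oplus>\<^bsub>M\<^esub> \<one>\<^bsub>M\<^esub>) = (x \<otimes>\<^bsub>M\<^esub> y) \<oplus>\<^bsub>M\<^esub> x) \<and>
     (\<forall>x. \<not> x \<prec>\<^bsub>M\<^esub> \<zero>\<^bsub>M\<^esub>) \<and>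
     (\<forall>x y. x \<prec>\<^bsub>M\<^esub> y \<oplus>\<^bsub>M\<^esub> \<one>\<^bsub>M\<^esub> \<longleftrightarrow> x \<prec>\<^bsub>M\<^esub> y \<or> x = y)"

text \<open>
  In the two schemas the parameters of the formulas are universally quantified through the
  assignments \<open>e\<close> and \<open>E\<close>.  The set produced by comprehension does not occur in the assignment
  \<open>E\<close>, which is the usual proviso that the comprehension variable is not free in the formula.
\<close>

definition Sigma01_induction :: "'a l2_struct \<Rightarrow> bool" where
  "Sigma01_induction M \<longleftrightarrow>
     (\<forall>p \<in> Sigma01. \<forall>i e E. (\<forall>v. E v \<in> l2_sets M) \<longrightarrow>
        sat M (e(i := \<zero>\<^bsub>M\<^esub>)) E p \<longrightarrow>
        (\<forall>a. sat M (e(i := a)) E p \<longrightarrow> sat M (e(i := a \<oplus>\<^bsub>M\<^esub> \<one>\<^bsub>M\<^esub>)) E p) \<longrightarrow>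
        (\<forall>a. sat M (e(i := a)) E p))"

definition Delta01_comprehension :: "'a l2_struct \<Rightarrow> bool" where
  "Delta01_comprehension M \<longleftrightarrow>
     (\<forall>p \<in> Sigma01. \<forall>q \<in> Pi01. \<forall>i e E. (\<forall>v. E v \<in> l2_sets M) \<longrightarrow>
        (\<forall>a. sat M (e(i := a)) E p \<longleftrightarrow> sat M (e(i := a)) E q) \<longrightarrow>
        {a. sat M (e(i := a)) E p} \<in> l2_sets M)"

text \<open>
  Nonemptiness of the set sort is the standing convention of many-sorted logic; without it the two
  schemas would be vacuous, there being no assignment \<open>E\<close>.
\<close>

definition RCA0 :: "'a l2_struct \<Rightarrow> bool" where
  "RCA0 M \<longleftrightarrow> l2_sets M \<noteq> {} \<and> basic_axioms M \<and> Sigma01_induction M \<and> Delta01_comprehension M"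


section \<open>Finite combinatorics inside a structure\<close>

definition l2_le :: "'a l2_struct \<Rightarrow> 'a \<Rightarrow> 'a \<Rightarrow> bool" where
  "l2_le M x y \<longleftrightarrow> x \<prec>\<^bsub>M\<^esub> y \<or> x = y"

definition below :: "'a l2_struct \<Rightarrow> 'a \<Rightarrow> 'a set" where
  "below M w = {x. x \<prec>\<^bsub>M\<^esub> w}"

definition one_to :: "'a l2_struct \<Rightarrow> 'a \<Rightarrow> 'a set" where
  "one_to M w = {x. l2_le M \<one>\<^bsub>M\<^esub> x \<and> l2_le M x w}"

primrec numeral_of :: "'a l2_struct \<Rightarrow> nat \<Rightarrow> 'a" where
  "numeral_of M 0 = \<zero>\<^bsub>M\<^esub>"
| "numeral_of M (Suc n) = numeral_of M n \<oplus>\<^bsub>M\<^esub> \<one>\<^bsub>M\<^esub>"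

text \<open>The pairing function \<open>(x, y) = (x + y)\<^sup>2 + x\<close>, customary in subsystems of arithmetic.\<close>

definition pair :: "'a l2_struct \<Rightarrow> 'a \<Rightarrow> 'a \<Rightarrow> 'a" where
  "pair M x y = (x \<oplus>\<^bsub>M\<^esub> y) \<otimes>\<^bsub>M\<^esub> (x \<oplus>\<^bsub>M\<^esub> y) \<oplus>\<^bsub>M\<^esub> x"

text \<open>Tuples of standard length, by iterated pairing.\<close>

fun tuple :: "'a l2_struct \<Rightarrow> 'a list \<Rightarrow> 'a" where
  "tuple M [] = \<zero>\<^bsub>M\<^esub>"
| "tuple M [x] = x"
| "tuple M (x # y # xs) = pair M x (tuple M (y # xs))"

text \<open>
  \<open>subsets_of M n A\<close> is \<open>[A]\<^sup>n\<close> for standard \<open>n\<close>; an \<open>n\<close>-element subset is coded by the tuple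
  listing its elements in increasing order.
\<close>

definition subsets_of :: "'a l2_struct \<Rightarrow> nat \<Rightarrow> 'a set \<Rightarrow> 'a set" where
  "subsets_of M n A =
     {tuple M xs | xs. length xs = n \<and> set xs \<subseteq> A \<and> sorted_wrt (l2_less M) xs}"

text \<open>\<open>F\<close> is (the graph of) a function from \<open>A\<close> to \<open>B\<close> belonging to the structure.\<close>

definition is_fun :: "'a l2_struct \<Rightarrow> 'a set \<Rightarrow> 'a set \<Rightarrow> 'a set \<Rightarrow> bool" where
  "is_fun M A B F \<longleftrightarrow>
     F \<in> l2_sets M \<and>
     F \<subseteq> {pair M x y | x y. x \<in> A \<and> y \<in> B} \<and>
     (\<forall>x \<in> A. \<exists>!y. pair M x y \<in> F)"

text \<open>Cardinality in the sense of the structure: a bijection belonging to it, from \<open>{x. x < m}\<close>.\<close>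

definition has_card :: "'a l2_struct \<Rightarrow> 'a set \<Rightarrow> 'a \<Rightarrow> bool" where
  "has_card M A m \<longleftrightarrow>
     (\<exists>F. is_fun M (below M m) A F \<and> (\<forall>y \<in> A. \<exists>!x. x \<in> below M m \<and> pair M x y \<in> F))"

definition infinite_in :: "'a l2_struct \<Rightarrow> 'a set \<Rightarrow> bool" where
  "infinite_in M H \<longleftrightarrow> (\<forall>v. \<exists>x \<in> H. v \<prec>\<^bsub>M\<^esub> x)"

definition homogeneous :: "'a l2_struct \<Rightarrow> nat \<Rightarrow> 'a set \<Rightarrow> 'a set \<Rightarrow> bool" where
  "homogeneous M n f H \<longleftrightarrow> (\<exists>c. \<forall>s \<in> subsets_of M n H. pair M s c \<in> f)"

text \<open>
  Since \<open>2 ^ (n - 1)\<close> is standard, ``at most \<open>2 ^ (n - 1)\<close> values'' may be read with true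
  finiteness and cardinality.
\<close>

definition semi_homogeneous :: "'a l2_struct \<Rightarrow> nat \<Rightarrow> 'a set \<Rightarrow> 'a set \<Rightarrow> bool" where
  "semi_homogeneous M n f H \<longleftrightarrow>
     finite {c. \<exists>s \<in> subsets_of M n H. pair M s c \<in> f} \<and>
     card {c. \<exists>s \<in> subsets_of M n H. pair M s c \<in> f} \<le> 2 ^ (n - 1)"

text \<open>\<open>arrow M w m n j\<close> is the partition relation \<open>w \<rightarrow> (m)\<^sup>n\<^sub>j\<close>.\<close>

definition arrow :: "'a l2_struct \<Rightarrow> 'a \<Rightarrow> 'a \<Rightarrow> nat \<Rightarrow> 'a \<Rightarrow> bool" where
  "arrow M w m n j \<longleftrightarrow>
     (\<forall>A \<in> l2_sets M. has_card M A w \<longrightarrow>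
        (\<forall>f. is_fun M (subsets_of M n A) (one_to M j) f \<longrightarrow>
           (\<exists>H \<in> l2_sets M. H \<subseteq> A \<and> has_card M H m \<and> homogeneous M n f H)))"

definition packed :: "'a l2_struct \<Rightarrow> 'a set \<Rightarrow> 'a set \<Rightarrow> bool" where
  "packed M \<phi> H \<longleftrightarrow>
     infinite_in M
       {w. \<exists>u m. pair M w u \<in> \<phi> \<and> l2_le M u m \<and> has_card M (H \<inter> one_to M w) m}"


section \<open>Ramsey's theorem and the packed Ramsey theorem in a structure\<close>

text \<open>
  The exponent \<open>n\<close> is a standard number, whereas the number of colours is an element of the
  structure and may be nonstandard.
\<close>

definition RT :: "'a l2_struct \<Rightarrow> nat \<Rightarrow> 'a \<Rightarrow> bool" where
  "RT M n k \<longleftrightarrow>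
     (\<forall>f. is_fun M (subsets_of M n UNIV) (one_to M k) f \<longrightarrow>
        (\<exists>H \<in> l2_sets M. infinite_in M H \<and> homogeneous M n f H))"

definition PRT :: "'a l2_struct \<Rightarrow> nat \<Rightarrow> 'a \<Rightarrow> bool" where
  "PRT M n j \<longleftrightarrow>
     (\<forall>\<phi> f. is_fun M UNIV UNIV \<phi> \<longrightarrow>
        (\<forall>w u. pair M w u \<in> \<phi> \<longrightarrow> arrow M w u n (j \<oplus>\<^bsub>M\<^esub> \<one>\<^bsub>M\<^esub>)) \<longrightarrow>
        is_fun M (subsets_of M n UNIV) (one_to M j) f \<longrightarrow>
        (\<exists>H \<in> l2_sets M. packed M \<phi> H \<and> semi_homogeneous M n f H))"

end

theory Submission
  imports Defs
begin

text \<open>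
  Let \<open>I\<^sub>0, I\<^sub>1, \<dots>\<close> be consecutive intervals growing so fast that the left end of \<open>I\<^sub>i\<^sub>+\<^sub>1\<close> arrows
  \<open>\<phi>(w) = min I\<^sub>i + 2n\<close>, which is taken as the value of \<open>\<phi>\<close> on \<open>I\<^sub>i\<^sub>+\<^sub>1\<close>.  Colour an \<open>n\<close>-set by the way in
  which the intervals split it (\<open>2\<^sup>n\<^sup>-\<^sup>1 - 1\<close> colours), except that an \<open>n\<close>-set meeting no interval
  twice gets the colour under \<open>f\<close> of its set of interval indices.  A packed set has \<open>n\<close> elements in
  infinitely many of the intervals, so it realises every way of splitting; being semi-homogeneous
  it has room for only one more colour, and the indices of the intervals that it meets form a
  homogeneous set for \<open>f\<close>.

  Working in an arbitrary model, one needs primitive recursion (finite sets are coded by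
  divisibility, as in Goedel's \<open>\<beta>\<close> lemma) and the finite Ramsey theorem with an explicit bound, which
  is proved by external induction on the standard exponent.
\<close>

section \<open>Definability calculus\<close>

text \<open>The summand 2n in \<open>\<phi>\<close> comes from counting. If w lies in the interval
  I(i+1) and H has at least min I(i) + 2n elements up to w, then at most min I(i) of them lie before
  I(i), so I(i) and I(i+1) together contain 2n of them and one of the two contains n. As many as n
  are wanted in a single interval because a way of splitting may leave an n-set undivided. The
  obstacle is that \<open>\<phi>\<close> must belong to the model and satisfy the partition relation
  with one colour more than the given colouring has, while only \<open>\<Sigma>\<^sub>1\<close>
  induction is available and the number of colours may be nonstandard. The finite Ramsey theorem is
  therefore proved with a bound that is itself a \<open>\<Sigma>\<^sub>1\<close> function, and the
  left ends of the intervals are defined by recursion on that bound. The exponent is standard, so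
  n-sets can be handled as external lists and their ways of splitting can be counted outside the
  model.\<close>

text \<open>
  Predicates and functions of an environment \<open>e\<close> play the role of formulas and terms with de Bruijn
  variables \<open>e 0\<close>, \<open>e 1\<close>, \<dots>; \<open>S1 P\<close>, \<open>D P\<close> and \<open>F f\<close> below say that \<open>P\<close> is \<open>\<Sigma>\<^sub>1\<close>, that \<open>P\<close> is
  \<open>\<Delta>\<^sub>1\<close>, and that \<open>f\<close> has a \<open>\<Sigma>\<^sub>1\<close> graph, all with parameters.  The closure rules state binders in
  higher-order form, so that definability is established by backward chaining along the syntax.
\<close>

abbreviation env_cons :: "'a \<Rightarrow> (nat \<Rightarrow> 'a) \<Rightarrow> nat \<Rightarrow> 'a" (infixr "##" 65) where
  "x ## e \<equiv> case_nat x e"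

locale rca0_model =
  fixes M :: "'a l2_struct" (structure)
  assumes rca0: "RCA0 M"
begin

inductive trm :: "(nat \<Rightarrow> 'a) \<Rightarrow> ((nat \<Rightarrow> 'a) \<Rightarrow> 'a) \<Rightarrow> bool" for c where
  trm_var: "trm c (\<lambda>e. e i)"
| trm_const: "trm c (\<lambda>e. c i)"
| trm_zero: "trm c (\<lambda>e. \<zero>)"
| trm_one: "trm c (\<lambda>e. \<one>)"
| trm_add: "trm c s \<Longrightarrow> trm c t \<Longrightarrow> trm c (\<lambda>e. s e \<oplus> t e)"
| trm_mul: "trm c s \<Longrightarrow> trm c t \<Longrightarrow> trm c (\<lambda>e. s e \<otimes> t e)"

text \<open>Semantic counterpart of \<open>Sigma00\<close>. A binder pushes its variable to the
  front of the environment while the bounding term is evaluated in the old one; this reflects the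
  proviso that the bound variable does not occur in the bound. Disjunction and the bounded
  existential quantifier are recovered by negation.\<close>

inductive dl0 :: "(nat \<Rightarrow> 'a) \<Rightarrow> (nat \<Rightarrow> 'a set) \<Rightarrow> ((nat \<Rightarrow> 'a) \<Rightarrow> bool) \<Rightarrow> bool" for c E where
  dl0_eq: "trm c s \<Longrightarrow> trm c t \<Longrightarrow> dl0 c E (\<lambda>e. s e = t e)"
| dl0_less: "trm c s \<Longrightarrow> trm c t \<Longrightarrow> dl0 c E (\<lambda>e. s e \<prec> t e)"
| dl0_mem: "trm c t \<Longrightarrow> dl0 c E (\<lambda>e. t e \<in> E i)"
| dl0_neg: "dl0 c E P \<Longrightarrow> dl0 c E (\<lambda>e. \<not> P e)"
| dl0_conj: "dl0 c E P \<Longrightarrow> dl0 c E Q \<Longrightarrow> dl0 c E (\<lambda>e. P e \<and> Q e)"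
| dl0_all: "trm c t \<Longrightarrow> dl0 c E Q \<Longrightarrow> dl0 c E (\<lambda>e. \<forall>y. y \<prec> t e \<longrightarrow> Q (y ## e))"

lemma range_env_cons: "range (x ## e) = insert x (range e)"
proof
  show "range (x ## e) \<subseteq> insert x (range e)" by (auto split: nat.splits)
  have "x = (x ## e) 0" "e i = (x ## e) (Suc i)" for i by simp_all
  then show "insert x (range e) \<subseteq> range (x ## e)" by (metis insert_subset rangeI image_subset_iff)
qed

lemma trm_mono: "trm c t \<Longrightarrow> range c \<subseteq> range c' \<Longrightarrow> trm c' t"
proof (induction rule: trm.induct)
  case (trm_const i)
  then obtain j where "c i = c' j" by blast
  then show ?case using trm.trm_const[of c' j] by simp
qed (auto intro: trm.intros)

lemma dl0_mono: "dl0 c E P \<Longrightarrow> range c \<subseteq> range c' \<Longrightarrow> range E \<subseteq> range E' \<Longrightarrow> dl0 c' E' P"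
proof (induction rule: dl0.induct)
  case (dl0_mem t i)
  then obtain j where "E i = E' j" by blast
  then show ?case using dl0.dl0_mem[of c' t E' j] dl0_mem trm_mono by metis
qed (auto intro: dl0.intros trm_mono)

lemma trm_subst: "trm c t \<Longrightarrow> (\<And>i. trm c (s i)) \<Longrightarrow> trm c (\<lambda>e. t (\<lambda>i. s i e))"
  by (induction rule: trm.induct) (auto intro: trm.intros)

lemma dl0_subst: "dl0 c E P \<Longrightarrow> (\<And>i. trm c (s i)) \<Longrightarrow> dl0 c E (\<lambda>e. P (\<lambda>i. s i e))"
proof (induction arbitrary: s rule: dl0.induct)
  case (dl0_all t Q)
  \<comment> \<open>Under the binder, variable 0 stays bound and \<open>s\<close> acts on the rest
    of the environment.\<close>
  let ?s = "case_nat (\<lambda>e. e 0) (\<lambda>i e. s i (\<lambda>j. e (Suc j)))"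
  have "trm c (?s i)" for i
    using trm_subst[OF dl0_all.prems, where s = "\<lambda>j e. e (Suc j)"] by (cases i) (auto intro: trm.intros)
  moreover have "(\<lambda>i. ?s i (y ## e)) = y ## (\<lambda>i. s i e)" for y e
    by (rule ext) (simp split: nat.splits)
  ultimately show ?case
    using dl0.dl0_all[OF trm_subst[OF dl0_all(1) dl0_all.prems] dl0_all.IH[of ?s]] by simp
next
  case (dl0_eq a b)
  show ?case using dl0.dl0_eq[OF trm_subst[OF dl0_eq(1,3)] trm_subst[OF dl0_eq(2,3)]] .
next
  case (dl0_less a b)
  show ?case using dl0.dl0_less[OF trm_subst[OF dl0_less(1,3)] trm_subst[OF dl0_less(2,3)]] .
next
  case (dl0_mem t i)
  show ?case using dl0.dl0_mem[OF trm_subst[OF dl0_mem]] .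
qed (auto intro: dl0.intros)

text \<open>
  Variable \<open>i\<close> of the environment and constant \<open>c i\<close> are placed at the number variables \<open>\<rho> i\<close> and
  \<open>\<kappa> i\<close>; keeping infinitely many number variables free leaves room for bound variables, so that no
  formula ever has to be renamed.
\<close>

lemma trm_repr:
  "trm c t \<Longrightarrow> \<exists>\<tau>. term_vars \<tau> \<subseteq> range \<rho> \<union> range \<kappa> \<and>
     (\<forall>env. (\<forall>i. env (\<kappa> i) = c i) \<longrightarrow> eval_term M env \<tau> = t (\<lambda>i. env (\<rho> i)))"
proof (induction rule: trm.induct)
  case (trm_var i)
  show ?case by (rule exI[of _ "Var (\<rho> i)"]) auto
next
  case (trm_const i)
  show ?case by (rule exI[of _ "Var (\<kappa> i)"]) auto
next
  case trm_zero
  show ?case by (rule exI[of _ Zero]) auto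
next
  case trm_one
  show ?case by (rule exI[of _ One]) auto
next
  case (trm_add s t)
  then obtain a b where
    "term_vars a \<subseteq> range \<rho> \<union> range \<kappa>" "\<forall>env. (\<forall>i. env (\<kappa> i) = c i) \<longrightarrow> eval_term M env a = s (\<lambda>i. env (\<rho> i))"
    "term_vars b \<subseteq> range \<rho> \<union> range \<kappa>" "\<forall>env. (\<forall>i. env (\<kappa> i) = c i) \<longrightarrow> eval_term M env b = t (\<lambda>i. env (\<rho> i))"
    by blast
  then show ?case by (intro exI[of _ "Add a b"]) auto
next
  case (trm_mul s t)
  then obtain a b where
    "term_vars a \<subseteq> range \<rho> \<union> range \<kappa>" "\<forall>env. (\<forall>i. env (\<kappa> i) = c i) \<longrightarrow> eval_term M env a = s (\<lambda>i. env (\<rho> i))"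
    "term_vars b \<subseteq> range \<rho> \<union> range \<kappa>" "\<forall>env. (\<forall>i. env (\<kappa> i) = c i) \<longrightarrow> eval_term M env b = t (\<lambda>i. env (\<rho> i))"
    by blast
  then show ?case by (intro exI[of _ "Mul a b"]) auto
qed

lemma dl0_repr:
  "dl0 c E P \<Longrightarrow> infinite (- (range \<rho> \<union> range \<kappa>)) \<Longrightarrow>
    \<exists>p \<in> Sigma00. \<forall>env. (\<forall>i. env (\<kappa> i) = c i) \<longrightarrow> (sat M env E p \<longleftrightarrow> P (\<lambda>i. env (\<rho> i)))"
proof (induction arbitrary: \<rho> rule: dl0.induct)
  case (dl0_eq s t)
  obtain a b where
    "\<forall>env. (\<forall>i. env (\<kappa> i) = c i) \<longrightarrow> eval_term M env a = s (\<lambda>i. env (\<rho> i))"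
    "\<forall>env. (\<forall>i. env (\<kappa> i) = c i) \<longrightarrow> eval_term M env b = t (\<lambda>i. env (\<rho> i))"
    using trm_repr dl0_eq(1,2) by metis
  then show ?case by (intro bexI[of _ "Eq a b"]) (auto intro: Sigma00.intros)
next
  case (dl0_less s t)
  obtain a b where
    "\<forall>env. (\<forall>i. env (\<kappa> i) = c i) \<longrightarrow> eval_term M env a = s (\<lambda>i. env (\<rho> i))"
    "\<forall>env. (\<forall>i. env (\<kappa> i) = c i) \<longrightarrow> eval_term M env b = t (\<lambda>i. env (\<rho> i))"
    using trm_repr dl0_less(1,2) by metis
  then show ?case by (intro bexI[of _ "Less a b"]) (auto intro: Sigma00.intros)
next
  case (dl0_mem t i)
  obtain a where
    "\<forall>env. (\<forall>i. env (\<kappa> i) = c i) \<longrightarrow> eval_term M env a = t (\<lambda>i. env (\<rho> i))"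
    using trm_repr dl0_mem(1) by metis
  then show ?case by (intro bexI[of _ "Mem a i"]) (auto intro: Sigma00.intros)
next
  case (dl0_neg P)
  then obtain p where "p \<in> Sigma00" "\<forall>env. (\<forall>i. env (\<kappa> i) = c i) \<longrightarrow> (sat M env E p \<longleftrightarrow> P (\<lambda>i. env (\<rho> i)))"
    by metis
  then show ?case by (intro bexI[of _ "Neg p"]) (auto intro: Sigma00.intros)
next
  case (dl0_conj P Q)
  obtain p where "p \<in> Sigma00" "\<forall>env. (\<forall>i. env (\<kappa> i) = c i) \<longrightarrow> (sat M env E p \<longleftrightarrow> P (\<lambda>i. env (\<rho> i)))"
    using dl0_conj by metis
  moreover obtain q where "q \<in> Sigma00"
    "\<forall>env. (\<forall>i. env (\<kappa> i) = c i) \<longrightarrow> (sat M env E q \<longleftrightarrow> Q (\<lambda>i. env (\<rho> i)))"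
    using dl0_conj by metis
  ultimately show ?case by (intro bexI[of _ "And p q"]) (auto intro: Sigma00.intros)
next
  case (dl0_all t Q)
  obtain a where a: "term_vars a \<subseteq> range \<rho> \<union> range \<kappa>"
    "\<forall>env. (\<forall>i. env (\<kappa> i) = c i) \<longrightarrow> eval_term M env a = t (\<lambda>i. env (\<rho> i))"
    using trm_repr dl0_all(1) by metis
  obtain z where z: "z \<in> - (range \<rho> \<union> range \<kappa>)"
    using dl0_all.prems infinite_imp_nonempty by blast
  \<comment> \<open>Using up \<open>z\<close> removes a single point from the infinite stock of free
    variables, so the induction hypothesis applies to the placement
    \<open>z ## \<rho>\<close>.\<close>
  have "- (range (z ## \<rho>) \<union> range \<kappa>) = - (range \<rho> \<union> range \<kappa>) - {z}"
    by (auto simp: range_env_cons)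
  then have "infinite (- (range (z ## \<rho>) \<union> range \<kappa>))"
    using dl0_all.prems by simp
  then obtain p where p: "p \<in> Sigma00"
    "\<forall>env. (\<forall>i. env (\<kappa> i) = c i) \<longrightarrow> (sat M env E p \<longleftrightarrow> Q (\<lambda>i. env ((z ## \<rho>) i)))"
    using dl0_all.IH by metis
  have upd: "(\<lambda>i. (env(z := y)) ((z ## \<rho>) i)) = y ## (\<lambda>i. env (\<rho> i))"
    "(\<lambda>i. (env(z := y)) (\<rho> i)) = (\<lambda>i. env (\<rho> i))" for env :: "nat \<Rightarrow> 'a" and y
    using z by (auto simp: fun_eq_iff split: nat.splits)
  have kap: "(\<forall>i. (env(z := y)) (\<kappa> i) = c i) \<longleftrightarrow> (\<forall>i. env (\<kappa> i) = c i)" for env :: "nat \<Rightarrow> 'a" and y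
    using z by auto
  show ?case
  proof (intro bexI[of _ "AllN z (Imp (Less (Var z) a) p)"] allI impI)
    show "AllN z (Imp (Less (Var z) a) p) \<in> Sigma00"
      using p(1) a(1) z by (intro Sigma00.intros) auto
    fix env assume "\<forall>i. env (\<kappa> i) = c i"
    then show "sat M env E (AllN z (Imp (Less (Var z) a) p)) \<longleftrightarrow>
      (\<forall>y. y \<prec> t (\<lambda>i. env (\<rho> i)) \<longrightarrow> Q (y ## (\<lambda>i. env (\<rho> i))))"
      using a(2) p(2) kap upd by simp
  qed
qed

section \<open>Definability with arbitrary parameters\<close>

definition Tm :: "((nat \<Rightarrow> 'a) \<Rightarrow> 'a) \<Rightarrow> bool" where
  "Tm t \<longleftrightarrow> (\<exists>c. trm c t)"

definition Dl0 :: "((nat \<Rightarrow> 'a) \<Rightarrow> bool) \<Rightarrow> bool" where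
  "Dl0 P \<longleftrightarrow> (\<exists>c E. range E \<subseteq> l2_sets M \<and> dl0 c E P)"

text \<open>Interleaving gives two predicates a common sequence of parameters; by
  \<open>trm_mono\<close> and \<open>dl0_mono\<close>, definability survives the
  enlargement.\<close>

definition merge :: "(nat \<Rightarrow> 'b) \<Rightarrow> (nat \<Rightarrow> 'b) \<Rightarrow> nat \<Rightarrow> 'b" where
  "merge f g = (\<lambda>i. if even i then f (i div 2) else g (i div 2))"

lemma range_merge: "range (merge f g) = range f \<union> range g"
proof
  show "range (merge f g) \<subseteq> range f \<union> range g" by (auto simp: merge_def)
  have "f i = merge f g (2 * i)" "g i = merge f g (2 * i + 1)" for i by (simp_all add: merge_def)
  then show "range f \<union> range g \<subseteq> range (merge f g)" by blast
qed

lemma Tm_common: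
  assumes "Tm s" "Tm t" shows "\<exists>c. trm c s \<and> trm c t"
proof -
  obtain c d where "trm c s" "trm d t" using assms by (auto simp: Tm_def)
  then have "trm (merge c d) s" "trm (merge c d) t"
    by (auto intro: trm_mono simp: range_merge)
  then show ?thesis by blast
qed

lemma Dl0_common:
  assumes "Dl0 P" "Dl0 Q"
  shows "\<exists>c E. range E \<subseteq> l2_sets M \<and> dl0 c E P \<and> dl0 c E Q"
proof -
  obtain c E d F where "range E \<subseteq> l2_sets M" "range F \<subseteq> l2_sets M" "dl0 c E P" "dl0 d F Q"
    using assms by (auto simp: Dl0_def)
  then have "range (merge E F) \<subseteq> l2_sets M" "dl0 (merge c d) (merge E F) P" "dl0 (merge c d) (merge E F) Q"
    by (auto intro: dl0_mono simp: range_merge)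
  then show ?thesis by blast
qed

lemma Tm_Dl0_common:
  assumes "Tm t" "Dl0 Q"
  shows "\<exists>c E. range E \<subseteq> l2_sets M \<and> trm c t \<and> dl0 c E Q"
proof -
  obtain c E d where "range E \<subseteq> l2_sets M" "dl0 c E Q" "trm d t"
    using assms by (auto simp: Dl0_def Tm_def)
  then have "dl0 (merge c d) E Q" "trm (merge c d) t"
    by (auto intro: dl0_mono trm_mono simp: range_merge)
  then show ?thesis using \<open>range E \<subseteq> l2_sets M\<close> by blast
qed

lemma sets_nonempty: "l2_sets M \<noteq> {}"
  using rca0 by (simp add: RCA0_def)

lemma Tm_var: "Tm (\<lambda>e. e i)"
  unfolding Tm_def by (blast intro: trm.intros)

lemma Tm_const: "Tm (\<lambda>e. a)"
  unfolding Tm_def using trm_const[of "\<lambda>_. a"] by blast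

lemma Tm_add: "Tm s \<Longrightarrow> Tm t \<Longrightarrow> Tm (\<lambda>e. s e \<oplus> t e)"
  and Tm_mul: "Tm s \<Longrightarrow> Tm t \<Longrightarrow> Tm (\<lambda>e. s e \<otimes> t e)"
  using Tm_common[of s t] unfolding Tm_def by (blast intro: trm.intros)+

lemma ex_sets_sequence: "\<exists>E :: nat \<Rightarrow> 'a set. range E \<subseteq> l2_sets M"
proof -
  obtain X where "X \<in> l2_sets M" using sets_nonempty by blast
  then show ?thesis by (intro exI[of _ "\<lambda>_. X"]) auto
qed

lemma Dl0_eq:
  assumes "Tm s" "Tm t" shows "Dl0 (\<lambda>e. s e = t e)"
proof -
  obtain c where "trm c s" "trm c t"
    using Tm_common[OF assms] by blast
  moreover obtain E :: "nat \<Rightarrow> 'a set" where "range E \<subseteq> l2_sets M"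
    using ex_sets_sequence by (rule exE)
  ultimately show ?thesis using dl0_eq[of c s t E] unfolding Dl0_def by blast
qed

lemma Dl0_less:
  assumes "Tm s" "Tm t" shows "Dl0 (\<lambda>e. s e \<prec> t e)"
proof -
  obtain c where "trm c s" "trm c t"
    using Tm_common[OF assms] by blast
  moreover obtain E :: "nat \<Rightarrow> 'a set" where "range E \<subseteq> l2_sets M"
    using ex_sets_sequence by (rule exE)
  ultimately show ?thesis using dl0_less[of c s t E] unfolding Dl0_def by blast
qed

lemma Dl0_mem: "Tm t \<Longrightarrow> X \<in> l2_sets M \<Longrightarrow> Dl0 (\<lambda>e. t e \<in> X)"
  using dl0_mem[of _ t "\<lambda>_. X"] unfolding Dl0_def Tm_def by fastforce

lemma Dl0_neg: "Dl0 P \<Longrightarrow> Dl0 (\<lambda>e. \<not> P e)"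
  unfolding Dl0_def by (blast intro: dl0.intros)

lemma Dl0_conj:
  assumes "Dl0 P" "Dl0 Q" shows "Dl0 (\<lambda>e. P e \<and> Q e)"
proof -
  obtain c E where "range E \<subseteq> l2_sets M" "dl0 c E P" "dl0 c E Q"
    using Dl0_common[OF assms] by (elim exE conjE)
  then show ?thesis using dl0_conj[of c E P Q] unfolding Dl0_def by blast
qed

lemma Dl0_disj: "Dl0 P \<Longrightarrow> Dl0 Q \<Longrightarrow> Dl0 (\<lambda>e. P e \<or> Q e)"
  using Dl0_neg[OF Dl0_conj[OF Dl0_neg[of P] Dl0_neg[of Q]]] by simp

lemma Dl0_ball:
  assumes "Tm t" "Dl0 (\<lambda>e. Q (e 0) (\<lambda>i. e (Suc i)))"
  shows "Dl0 (\<lambda>e. \<forall>y. y \<prec> t e \<longrightarrow> Q y e)"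
proof -
  obtain c E where "range E \<subseteq> l2_sets M" "trm c t" "dl0 c E (\<lambda>e. Q (e 0) (\<lambda>i. e (Suc i)))"
    using Tm_Dl0_common[OF assms] by (elim exE conjE)
  then show ?thesis using dl0_all[of c t E] unfolding Dl0_def by fastforce
qed

lemma Dl0_bex:
  assumes "Tm t" "Dl0 (\<lambda>e. Q (e 0) (\<lambda>i. e (Suc i)))"
  shows "Dl0 (\<lambda>e. \<exists>y. y \<prec> t e \<and> Q y e)"
proof -
  have "Dl0 (\<lambda>e. \<not> (\<forall>y. y \<prec> t e \<longrightarrow> \<not> Q y e))"
    by (intro Dl0_neg Dl0_ball assms)
  then show ?thesis by simp
qed

lemma Dl0_subst:
  assumes "Dl0 P" "\<And>i. trm d (s i)" shows "Dl0 (\<lambda>e. P (\<lambda>i. s i e))"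
proof -
  obtain c E where E: "range E \<subseteq> l2_sets M" "dl0 c E P" using assms(1) unfolding Dl0_def by blast
  have "dl0 (merge c d) E (\<lambda>e. P (\<lambda>i. s i e))"
    by (rule dl0_subst) (auto intro: dl0_mono[OF E(2)] trm_mono[OF assms(2)] simp: range_merge)
  then show ?thesis using E(1) unfolding Dl0_def by blast
qed

lemma Dl0_reindex: "Dl0 P \<Longrightarrow> Dl0 (\<lambda>e. P (\<lambda>i. e (\<sigma> i)))"
  using Dl0_subst[of P _ "\<lambda>i e. e (\<sigma> i)"] trm_var by blast

definition S1 :: "((nat \<Rightarrow> 'a) \<Rightarrow> bool) \<Rightarrow> bool" where
  "S1 P \<longleftrightarrow> (\<exists>Q. Dl0 Q \<and> (\<forall>e. P e \<longleftrightarrow> (\<exists>y. Q (y ## e))))"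

lemma S1_ex_Dl0:
  assumes "Dl0 (\<lambda>e. Q (e 0) (\<lambda>i. e (Suc i)))"
  shows "S1 (\<lambda>e. \<exists>y. Q y e)"
  unfolding S1_def using assms by (intro exI[of _ "\<lambda>e. Q (e 0) (\<lambda>i. e (Suc i))"]) simp

lemma S1_Dl0: "Dl0 P \<Longrightarrow> S1 P"
  using S1_ex_Dl0[of "\<lambda>y e. P e"] Dl0_reindex[of P Suc] by simp

text \<open>Multiples of 3 will carry the environment and the residue class of 1 the constants,
  which leaves the class of 2 for bound variables.\<close>

lemma infinite_unused: "infinite (- (range (\<lambda>i::nat. 3 * i) \<union> range (\<lambda>i. 3 * i + 1)))"
proof -
  have "3 * i + 2 \<noteq> 3 * j" "3 * i + 2 \<noteq> 3 * j + 1" for i j :: nat by presburger+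
  then have "range (\<lambda>i::nat. 3 * i + 2) \<subseteq> - (range (\<lambda>i::nat. 3 * i) \<union> range (\<lambda>i. 3 * i + 1))"
    by auto
  moreover have "infinite (range (\<lambda>i::nat. 3 * i + 2))"
    using finite_imageD[of "\<lambda>i::nat. 3 * i + 2" UNIV] by (auto simp: inj_on_def)
  ultimately show ?thesis using infinite_super by blast
qed

text \<open>Number variable 0 is taken by the leading existential quantifier, so the environment of
  \<open>P\<close> begins at variable 3.\<close>

lemma S1_repr:
  assumes "S1 P"
  shows "\<exists>c E p. range E \<subseteq> l2_sets M \<and> p \<in> Sigma01 \<and>
    (\<forall>env. (\<forall>i. env (3 * i + 1) = c i) \<longrightarrow> (sat M env E p \<longleftrightarrow> P (\<lambda>i. env (3 * i + 3))))"
proof -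
  obtain Q c E where Q: "\<And>e. P e \<longleftrightarrow> (\<exists>y. Q (y ## e))" "range E \<subseteq> l2_sets M" "dl0 c E Q"
    using assms unfolding S1_def Dl0_def by blast
  let ?r = "\<lambda>i::nat. 3 * i" and ?k = "\<lambda>i::nat. 3 * i + 1"
  have inf: "infinite (- (range ?r \<union> range ?k))" by (rule infinite_unused)
  obtain p where p: "p \<in> Sigma00"
    "\<forall>env. (\<forall>i. env (?k i) = c i) \<longrightarrow> (sat M env E p \<longleftrightarrow> Q (\<lambda>i. env (?r i)))"
    using dl0_repr[OF Q(3) inf] by metis
  have eq: "(\<lambda>i. (env(0 := y)) (?r i)) = y ## (\<lambda>i. env (3 * i + 3))" for env :: "nat \<Rightarrow> 'a" and y
    by (rule ext) (auto split: nat.splits simp: algebra_simps)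
  have "sat M env E (ExN 0 p) \<longleftrightarrow> P (\<lambda>i. env (3 * i + 3))" if "\<forall>i. env (3 * i + 1) = c i" for env
  proof -
    have "(env(0 := y)) (3 * i + 1) = c i" for i y using that by simp
    then have "sat M (env(0 := y)) E p \<longleftrightarrow> Q (y ## (\<lambda>i. env (3 * i + 3)))" for y
      using p(2) eq by metis
    then show ?thesis using Q(1) by simp
  qed
  moreover have "ExN 0 p \<in> Sigma01" using p(1) by (auto simp: Sigma01_def)
  ultimately show ?thesis using Q(2) by blast
qed

text \<open>An assignment interpreting variable \<open>i\<close> of the environment by \<open>e i\<close> and constant \<open>i\<close> by \<open>c i\<close>.\<close>

definition lay :: "(nat \<Rightarrow> 'a) \<Rightarrow> (nat \<Rightarrow> 'a) \<Rightarrow> nat \<Rightarrow> 'a" where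
  "lay c e = (\<lambda>n. if n mod 3 = 1 then c (n div 3) else e (n div 3 - 1))"

lemma lay: "(lay c e) (3 * i + 1) = c i" "(\<lambda>i. (lay c e) (3 * i + 3)) = e"
proof -
  have "(3 * i + 3) mod 3 = 0" "(3 * i + 1) mod 3 = 1" "(3 * i + 1) div 3 = i" "(3 * i + 3) div 3 = Suc i" for i :: nat
    by presburger+
  then show "(lay c e) (3 * i + 1) = c i" "(\<lambda>i. (lay c e) (3 * i + 3)) = e" unfolding lay_def by auto
qed

lemma lay_upd: "((lay c e)(3 := a)) (3 * i + 1) = c i" "(\<lambda>i. ((lay c e)(3 := a)) (3 * i + 3)) = a ## (\<lambda>i. e (Suc i))"
proof -
  have "3 * i + 1 \<noteq> 3" by presburger
  then show "((lay c e)(3 := a)) (3 * i + 1) = c i" using lay(1)[of c e i] by simp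
  have "((lay c e)(3 := a)) (3 * i + 3) = (a ## (\<lambda>i. e (Suc i))) i" for i
  proof (cases i)
    case (Suc j)
    then have "3 * i + 3 \<noteq> 3" by simp
    then show ?thesis using Suc fun_cong[OF lay(2)[of c e], of i] by simp
  qed simp
  then show "(\<lambda>i. ((lay c e)(3 := a)) (3 * i + 3)) = a ## (\<lambda>i. e (Suc i))" by blast
qed

text \<open>Since variable 3 holds \<open>e 0\<close>, updating it in a fixed layout varies the
  induction variable and leaves the parameters in place.\<close>

lemma S1_induct:
  assumes "S1 (\<lambda>e. P (e 0))" and "P \<zero>" and "\<And>a. P a \<Longrightarrow> P (a \<oplus> \<one>)"
  shows "P a"
proof -
  obtain c E p where p: "range E \<subseteq> l2_sets M" "p \<in> Sigma01"
    "\<And>env. (\<forall>i. env (3 * i + 1) = c i) \<Longrightarrow> (sat M env E p \<longleftrightarrow> P (env 3))"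
    using S1_repr[OF assms(1)] by auto
  let ?e = "lay c (\<lambda>_. \<zero>)"
  have sat: "sat M (?e(3 := a)) E p \<longleftrightarrow> P a" for a
    using p(3)[of "?e(3 := a)"] lay_upd(1) by simp
  have E: "\<forall>v. E v \<in> l2_sets M" using p(1) by auto
  have "Sigma01_induction M" using rca0 by (simp add: RCA0_def)
  then have "sat M (?e(3 := \<zero>)) E p \<Longrightarrow>
      (\<forall>a. sat M (?e(3 := a)) E p \<longrightarrow> sat M (?e(3 := a \<oplus> \<one>)) E p) \<Longrightarrow>
      sat M (?e(3 := a)) E p" for a
    using p(2) E unfolding Sigma01_induction_def by blast
  then have ind: "sat M (?e(3 := \<zero>)) E p \<longrightarrow>
      (\<forall>a. sat M (?e(3 := a)) E p \<longrightarrow> sat M (?e(3 := a \<oplus> \<one>)) E p) \<longrightarrow>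
      (\<forall>a. sat M (?e(3 := a)) E p)" by blast
  have "P \<zero> \<longrightarrow> (\<forall>a. P a \<longrightarrow> P (a \<oplus> \<one>)) \<longrightarrow> (\<forall>a. P a)"
    using ind by (simp only: sat)
  then show ?thesis using assms(2,3) by blast
qed

text \<open>A \<open>\<Sigma>\<^sub>1\<close> description of the complement is negated to give the
  \<open>\<Pi>\<^sub>1\<close> formula of the schema. The parameters of both descriptions are merged
  beforehand because the schema evaluates its two formulas under one assignment.\<close>

lemma S1_comprehension:
  assumes "S1 (\<lambda>e. P (e 0))" "S1 (\<lambda>e. \<not> P (e 0))"
  shows "{a. P a} \<in> l2_sets M"
proof -
  obtain Q where Q: "Dl0 Q" "\<And>e. (\<not> P (e 0)) \<longleftrightarrow> (\<exists>y. Q (y ## e))"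
    using assms(2) by (auto simp: S1_def)
  obtain R where R: "Dl0 R" "\<And>e. P (e 0) \<longleftrightarrow> (\<exists>y. R (y ## e))"
    using assms(1) by (auto simp: S1_def)
  obtain c E where cE: "range E \<subseteq> l2_sets M" "dl0 c E Q" "dl0 c E R"
    using Dl0_common[OF Q(1) R(1)] by (elim exE conjE)
  let ?r = "\<lambda>i::nat. 3 * i" and ?k = "\<lambda>i::nat. 3 * i + 1"
  have inf: "infinite (- (range ?r \<union> range ?k))" by (rule infinite_unused)
  obtain q where q: "q \<in> Sigma00"
    "\<forall>env. (\<forall>i. env (?k i) = c i) \<longrightarrow> (sat M env E q \<longleftrightarrow> Q (\<lambda>i. env (?r i)))"
    using dl0_repr[OF cE(2) inf] by metis
  obtain r where r: "r \<in> Sigma00"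
    "\<forall>env. (\<forall>i. env (?k i) = c i) \<longrightarrow> (sat M env E r \<longleftrightarrow> R (\<lambda>i. env (?r i)))"
    using dl0_repr[OF cE(3) inf] by metis
  let ?e = "lay c (\<lambda>_. \<zero>)"
  have eq: "(\<lambda>i. (?e(3 := a, 0 := y)) (?r i)) = y ## (a ## (\<lambda>i. \<zero>))" for a y
  proof
    fix i
    have "(?e(3 := a)) (3 * Suc j) = (a ## (\<lambda>i. \<zero>)) j" for j
      using fun_cong[OF lay_upd(2)[of c "\<lambda>_. \<zero>" a], of j] by (simp add: add.commute)
    then show "(?e(3 := a, 0 := y)) (?r i) = (y ## (a ## (\<lambda>i. \<zero>))) i"
      by (cases i) simp_all
  qed
  have kk: "\<forall>i. (?e(3 := a, 0 := y)) (?k i) = c i" for a y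
    using lay_upd(1)[of c "\<lambda>_. \<zero>" a] by simp
  have satq: "sat M (?e(3 := a, 0 := y)) E q \<longleftrightarrow> Q (y ## (a ## (\<lambda>i. \<zero>)))"
    and satr: "sat M (?e(3 := a, 0 := y)) E r \<longleftrightarrow> R (y ## (a ## (\<lambda>i. \<zero>)))" for a y
    using q(2) r(2) kk eq by metis+
  have 1: "sat M (?e(3 := a)) E (ExN 0 r) \<longleftrightarrow> P a" for a
    using satr R(2)[of "a ## (\<lambda>i. \<zero>)"] by simp
  have 2: "sat M (?e(3 := a)) E (AllN 0 (Neg q)) \<longleftrightarrow> P a" for a
    using satq Q(2)[of "a ## (\<lambda>i. \<zero>)"] by auto
  have "ExN 0 r \<in> Sigma01" "AllN 0 (Neg q) \<in> Pi01"
    using q(1) r(1) by (auto simp: Sigma01_def Pi01_def intro: Sigma00.intros)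
  moreover have "Delta01_comprehension M" using rca0 by (simp add: RCA0_def)
  moreover have E: "\<forall>v. E v \<in> l2_sets M" using cE(1) by auto
  ultimately have "(\<forall>a. sat M (?e(3 := a)) E (ExN 0 r) \<longleftrightarrow> sat M (?e(3 := a)) E (AllN 0 (Neg q))) \<longrightarrow>
        {a. sat M (?e(3 := a)) E (ExN 0 r)} \<in> l2_sets M"
    unfolding Delta01_comprehension_def by blast
  then show ?thesis by (simp only: 1 2 simp_thms)
qed

end

section \<open>Arithmetic of the model\<close>

context rca0_model
begin

lemma ax_succ_nz: "x \<oplus> \<one> \<noteq> \<zero>"
  and ax_succ_inj: "x \<oplus> \<one> = y \<oplus> \<one> \<Longrightarrow> x = y"
  and ax_add_0: "x \<oplus> \<zero> = x"
  and ax_add_succ: "x \<oplus> (y \<oplus> \<one>) = (x \<oplus> y) \<oplus> \<one>"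
  and ax_mul_0: "x \<otimes> \<zero> = \<zero>"
  and ax_mul_succ: "x \<otimes> (y \<oplus> \<one>) = x \<otimes> y \<oplus> x"
  and ax_less_0: "\<not> x \<prec> \<zero>"
  and ax_less_succ: "x \<prec> y \<oplus> \<one> \<longleftrightarrow> x \<prec> y \<or> x = y"
  using rca0 unfolding RCA0_def basic_axioms_def by blast+

lemmas Tm_rules = Tm_const Tm_var Tm_add Tm_mul
lemmas Dl0_rules = Dl0_eq Dl0_less Dl0_mem Dl0_neg Dl0_conj Dl0_disj Dl0_ball Dl0_bex

lemma p_zero_add: "\<zero> \<oplus> x = x"
proof (rule S1_induct[of "\<lambda>x. \<zero> \<oplus> x = x"])
  show "S1 (\<lambda>e. \<zero> \<oplus> e 0 = e 0)" by (intro S1_Dl0 Dl0_rules Tm_rules)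
qed (simp_all add: ax_add_0 ax_add_succ)

lemma p_succ_add: "(x \<oplus> \<one>) \<oplus> y = (x \<oplus> y) \<oplus> \<one>"
proof (rule S1_induct[of "\<lambda>y. (x \<oplus> \<one>) \<oplus> y = (x \<oplus> y) \<oplus> \<one>"])
  show "S1 (\<lambda>e. (x \<oplus> \<one>) \<oplus> e 0 = (x \<oplus> e 0) \<oplus> \<one>)" by (intro S1_Dl0 Dl0_rules Tm_rules)
qed (simp_all add: ax_add_0 ax_add_succ)

lemma p_add_comm: "x \<oplus> y = y \<oplus> x"
proof (rule S1_induct[of "\<lambda>y. x \<oplus> y = y \<oplus> x"])
  show "S1 (\<lambda>e. x \<oplus> e 0 = e 0 \<oplus> x)" by (intro S1_Dl0 Dl0_rules Tm_rules)
qed (simp_all add: ax_add_0 ax_add_succ p_zero_add p_succ_add)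

lemma p_add_assoc: "(x \<oplus> y) \<oplus> z = x \<oplus> (y \<oplus> z)"
proof (rule S1_induct[of "\<lambda>z. (x \<oplus> y) \<oplus> z = x \<oplus> (y \<oplus> z)"])
  show "S1 (\<lambda>e. (x \<oplus> y) \<oplus> e 0 = x \<oplus> (y \<oplus> e 0))" by (intro S1_Dl0 Dl0_rules Tm_rules)
qed (simp_all add: ax_add_0 ax_add_succ)

lemma p_add_cancel: "z \<oplus> x = z \<oplus> y \<Longrightarrow> x = y"
proof -
  have "\<not> x \<oplus> z = y \<oplus> z \<or> x = y"
  proof (rule S1_induct[of "\<lambda>z. \<not> x \<oplus> z = y \<oplus> z \<or> x = y"])
    show "S1 (\<lambda>e. \<not> x \<oplus> e 0 = y \<oplus> e 0 \<or> x = y)" by (intro S1_Dl0 Dl0_rules Tm_rules)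
  qed (auto simp: ax_add_0 ax_add_succ dest: ax_succ_inj)
  then show "z \<oplus> x = z \<oplus> y \<Longrightarrow> x = y" by (simp add: p_add_comm)
qed

lemma p_zero_mul: "\<zero> \<otimes> x = \<zero>"
proof (rule S1_induct[of "\<lambda>x. \<zero> \<otimes> x = \<zero>"])
  show "S1 (\<lambda>e. \<zero> \<otimes> e 0 = \<zero>)" by (intro S1_Dl0 Dl0_rules Tm_rules)
qed (simp_all add: ax_mul_0 ax_mul_succ ax_add_0)

lemma p_succ_mul: "(x \<oplus> \<one>) \<otimes> y = x \<otimes> y \<oplus> y"
proof (rule S1_induct[of "\<lambda>y. (x \<oplus> \<one>) \<otimes> y = x \<otimes> y \<oplus> y"])
  show "S1 (\<lambda>e. (x \<oplus> \<one>) \<otimes> e 0 = x \<otimes> e 0 \<oplus> e 0)" by (intro S1_Dl0 Dl0_rules Tm_rules)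
  show "(x \<oplus> \<one>) \<otimes> (a \<oplus> \<one>) = x \<otimes> (a \<oplus> \<one>) \<oplus> (a \<oplus> \<one>)"
    if "(x \<oplus> \<one>) \<otimes> a = x \<otimes> a \<oplus> a" for a
    unfolding ax_mul_succ that using p_add_assoc p_add_comm by metis
qed (simp add: ax_mul_0 ax_add_0)

lemma p_mul_comm: "x \<otimes> y = y \<otimes> x"
proof (rule S1_induct[of "\<lambda>y. x \<otimes> y = y \<otimes> x"])
  show "S1 (\<lambda>e. x \<otimes> e 0 = e 0 \<otimes> x)" by (intro S1_Dl0 Dl0_rules Tm_rules)
qed (simp_all add: ax_mul_0 ax_mul_succ p_zero_mul p_succ_mul)

lemma p_distrib: "(x \<oplus> y) \<otimes> z = x \<otimes> z \<oplus> y \<otimes> z"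
proof (rule S1_induct[of "\<lambda>z. (x \<oplus> y) \<otimes> z = x \<otimes> z \<oplus> y \<otimes> z"])
  show "S1 (\<lambda>e. (x \<oplus> y) \<otimes> e 0 = x \<otimes> e 0 \<oplus> y \<otimes> e 0)" by (intro S1_Dl0 Dl0_rules Tm_rules)
  show "(x \<oplus> y) \<otimes> (a \<oplus> \<one>) = x \<otimes> (a \<oplus> \<one>) \<oplus> y \<otimes> (a \<oplus> \<one>)"
    if "(x \<oplus> y) \<otimes> a = x \<otimes> a \<oplus> y \<otimes> a" for a
    unfolding ax_mul_succ that using p_add_assoc p_add_comm by metis
qed (simp add: ax_mul_0 ax_add_0)

lemma p_mul_assoc: "(x \<otimes> y) \<otimes> z = x \<otimes> (y \<otimes> z)"
proof (rule S1_induct[of "\<lambda>z. (x \<otimes> y) \<otimes> z = x \<otimes> (y \<otimes> z)"])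
  show "S1 (\<lambda>e. (x \<otimes> y) \<otimes> e 0 = x \<otimes> (y \<otimes> e 0))" by (intro S1_Dl0 Dl0_rules Tm_rules)
  show "(x \<otimes> y) \<otimes> (a \<oplus> \<one>) = x \<otimes> (y \<otimes> (a \<oplus> \<one>))" if "(x \<otimes> y) \<otimes> a = x \<otimes> (y \<otimes> a)" for a
    unfolding ax_mul_succ that using p_distrib p_mul_comm by metis
qed (simp add: ax_mul_0)

lemma p_one_mul: "\<one> \<otimes> x = x"
  using ax_mul_succ[of x \<zero>] by (simp add: p_zero_add ax_mul_0 p_mul_comm)

lemma p_zero_or_succ: "x = \<zero> \<or> (\<exists>y. x = y \<oplus> \<one>)"
proof (rule S1_induct[of "\<lambda>x. x = \<zero> \<or> (\<exists>y. x = y \<oplus> \<one>)"])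
  have "S1 (\<lambda>e. \<exists>y. e 0 = \<zero> \<or> e 0 = y \<oplus> \<one>)" by (intro S1_ex_Dl0 Dl0_rules Tm_rules)
  then show "S1 (\<lambda>e. e 0 = \<zero> \<or> (\<exists>y. e 0 = y \<oplus> \<one>))" by simp
qed auto

lemma p_add_less: "x \<prec> x \<oplus> (z \<oplus> \<one>)"
proof (rule S1_induct[of "\<lambda>z. x \<prec> x \<oplus> (z \<oplus> \<one>)"])
  show "S1 (\<lambda>e. x \<prec> x \<oplus> (e 0 \<oplus> \<one>))" by (intro S1_Dl0 Dl0_rules Tm_rules)
qed (simp_all add: ax_add_succ ax_add_0 p_zero_add ax_less_succ)

text \<open>The axioms describe \<open>\<prec>\<close> only through successors; the order defined by
  addition is the form from which transitivity, totality and monotonicity follow.\<close>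

lemma p_less_iff: "x \<prec> y \<longleftrightarrow> (\<exists>z. y = x \<oplus> (z \<oplus> \<one>))"
proof
  have "\<not> x \<prec> y \<or> (\<exists>z. y = x \<oplus> (z \<oplus> \<one>))"
  proof (rule S1_induct[of "\<lambda>y. \<not> x \<prec> y \<or> (\<exists>z. y = x \<oplus> (z \<oplus> \<one>))"])
    have "S1 (\<lambda>e. \<exists>z. \<not> x \<prec> e 0 \<or> e 0 = x \<oplus> (z \<oplus> \<one>))" by (intro S1_ex_Dl0 Dl0_rules Tm_rules)
    then show "S1 (\<lambda>e. \<not> x \<prec> e 0 \<or> (\<exists>z. e 0 = x \<oplus> (z \<oplus> \<one>)))" by simp
    show "\<not> x \<prec> a \<oplus> \<one> \<or> (\<exists>z. a \<oplus> \<one> = x \<oplus> (z \<oplus> \<one>))"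
      if "\<not> x \<prec> a \<or> (\<exists>z. a = x \<oplus> (z \<oplus> \<one>))" for a
      using that ax_less_succ ax_add_succ ax_add_0 p_zero_add by metis
  qed (simp add: ax_less_0)
  then show "x \<prec> y \<Longrightarrow> \<exists>z. y = x \<oplus> (z \<oplus> \<one>)" by simp
qed (auto simp: p_add_less)

lemma p_le_iff: "l2_le M x y \<longleftrightarrow> (\<exists>z. y = x \<oplus> z)"
  unfolding l2_le_def p_less_iff using p_zero_or_succ ax_add_0 by metis

lemma p_irrefl: "\<not> x \<prec> x"
  using p_add_cancel ax_add_0 ax_succ_nz unfolding p_less_iff by metis

lemma p_trans: "x \<prec> y \<Longrightarrow> y \<prec> z \<Longrightarrow> x \<prec> z"
  unfolding p_less_iff using p_add_assoc ax_add_succ by metis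

lemma p_total: "x \<prec> y \<or> x = y \<or> y \<prec> x"
proof (rule S1_induct[of "\<lambda>x. x \<prec> y \<or> x = y \<or> y \<prec> x"])
  show "S1 (\<lambda>e. e 0 \<prec> y \<or> e 0 = y \<or> y \<prec> e 0)" by (intro S1_Dl0 Dl0_rules Tm_rules)
  show "\<zero> \<prec> y \<or> \<zero> = y \<or> y \<prec> \<zero>"
    using p_zero_or_succ[of y] p_add_less[of \<zero>] by (auto simp: p_zero_add)
  show "a \<oplus> \<one> \<prec> y \<or> a \<oplus> \<one> = y \<or> y \<prec> a \<oplus> \<one>" if "a \<prec> y \<or> a = y \<or> y \<prec> a" for a
    using that
  proof (elim disjE)
    assume "a \<prec> y"
    then obtain z where z: "y = a \<oplus> (z \<oplus> \<one>)" unfolding p_less_iff by blast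
    show ?thesis
    proof (cases "z = \<zero>")
      case False
      then obtain w where "z = w \<oplus> \<one>" using p_zero_or_succ by blast
      then have "y = (a \<oplus> \<one>) \<oplus> (w \<oplus> \<one>)" using z p_add_assoc p_add_comm by metis
      then show ?thesis using p_less_iff by blast
    qed (use z in \<open>simp add: p_zero_add\<close>)
  qed (auto simp: ax_less_succ)
qed

lemma p_mul_pos: "\<zero> \<prec> x \<Longrightarrow> \<zero> \<prec> y \<Longrightarrow> \<zero> \<prec> x \<otimes> y"
  unfolding p_less_iff using ax_mul_succ p_zero_add p_mul_comm p_add_assoc p_add_comm ax_add_succ by metis

lemma p_add_less_mono: "x \<prec> y \<Longrightarrow> z \<oplus> x \<prec> z \<oplus> y"
  unfolding p_less_iff using p_add_assoc by metis

lemma p_mul_less_mono: "x \<prec> y \<Longrightarrow> \<zero> \<prec> z \<Longrightarrow> z \<otimes> x \<prec> z \<otimes> y"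
proof -
  assume "x \<prec> y" "\<zero> \<prec> z"
  then obtain w where w: "y = x \<oplus> (w \<oplus> \<one>)" unfolding p_less_iff by blast
  have "\<zero> \<prec> z \<otimes> (w \<oplus> \<one>)" using p_mul_pos \<open>\<zero> \<prec> z\<close> p_add_less[of \<zero> w] by (simp add: p_zero_add)
  moreover have "z \<otimes> y = z \<otimes> x \<oplus> z \<otimes> (w \<oplus> \<one>)" unfolding w using p_distrib p_mul_comm by metis
  ultimately show "z \<otimes> x \<prec> z \<otimes> y" unfolding p_less_iff[of \<zero>] p_less_iff[of "z \<otimes> x"] p_zero_add by metis
qed

text \<open>Truncated subtraction is part of the signature of ordered semidomains; as for natural
  numbers, it is \<open>\<zero>\<close> where no difference exists.\<close>

definition msub :: "'a \<Rightarrow> 'a \<Rightarrow> 'a" (infixl "\<ominus>" 65) where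
  "x \<ominus> y = (if \<exists>z. y \<oplus> z = x then THE z. y \<oplus> z = x else \<zero>)"

lemma msub_eq: "y \<oplus> z = x \<Longrightarrow> x \<ominus> y = z"
  unfolding msub_def using p_add_cancel by (metis (mono_tags, lifting) the_equality)

lemma msub_zero: "x \<prec> y \<Longrightarrow> x \<ominus> y = \<zero>"
  unfolding msub_def using p_irrefl p_trans p_le_iff l2_le_def by metis

lemma msub_le: "l2_le M x y \<Longrightarrow> x \<ominus> y = \<zero>"
  unfolding l2_le_def using msub_zero msub_eq ax_add_0 by metis

end

text \<open>From here on the library's facts about ordered semidomains apply to the possibly
  nonstandard number domain.\<close>

sublocale rca0_model \<subseteq> A: linordered_semidom
  "l2_add M" "msub" "l2_le M" "l2_less M" "l2_zero M" "l2_mul M" "l2_one M"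
proof unfold_locales
  fix a b c :: 'a
  show "a \<oplus> b \<oplus> c = a \<oplus> (b \<oplus> c)" by (rule p_add_assoc)
  show "a \<oplus> b = b \<oplus> a" by (rule p_add_comm)
  show "a \<oplus> b \<ominus> a = b" by (rule msub_eq) simp
  show "a \<ominus> b \<ominus> c = a \<ominus> (b \<oplus> c)"
  proof (cases "\<exists>z. (b \<oplus> c) \<oplus> z = a")
    case True
    then obtain z where z: "(b \<oplus> c) \<oplus> z = a" by blast
    have "a \<ominus> (b \<oplus> c) = z" "a \<ominus> b = c \<oplus> z"
      by (intro msub_eq; use z p_add_assoc in metis)+
    then show ?thesis using msub_eq by simp
  next
    case False
    then have "a \<ominus> (b \<oplus> c) = \<zero>" unfolding msub_def by simp
    moreover have "a \<ominus> b \<ominus> c = \<zero>"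
    proof (cases "\<exists>z. b \<oplus> z = a")
      case True
      then obtain z where z: "b \<oplus> z = a" by blast
      then have "\<not> (\<exists>w. c \<oplus> w = z)" using False p_add_assoc by metis
      then show ?thesis using msub_eq[OF z] unfolding msub_def by simp
    next
      case False
      then have "a \<ominus> b = \<zero>" unfolding msub_def by simp
      moreover have "l2_le M \<zero> c" by (simp add: p_le_iff p_zero_add)
      ultimately show ?thesis using msub_le by simp
    qed
    ultimately show ?thesis by simp
  qed
  show "a \<otimes> b \<otimes> c = a \<otimes> (b \<otimes> c)" by (rule p_mul_assoc)
  show "a \<otimes> b = b \<otimes> a" by (rule p_mul_comm)
  show "\<one> \<otimes> a = a" by (rule p_one_mul)
  show "\<zero> \<oplus> a = a" by (rule p_zero_add)
  show "\<zero> \<otimes> a = \<zero>" by (rule p_zero_mul)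
  show "a \<otimes> \<zero> = \<zero>" by (rule ax_mul_0)
  show "a \<otimes> (b \<oplus> c) = a \<otimes> b \<oplus> a \<otimes> c" using p_distrib p_mul_comm by metis
  show "(a \<oplus> b) \<otimes> c = a \<otimes> c \<oplus> b \<otimes> c" by (rule p_distrib)
  show "\<zero> \<noteq> \<one>" using ax_succ_nz[of \<zero>] by (simp add: p_zero_add)
  show "a \<otimes> (b \<ominus> c) = a \<otimes> b \<ominus> a \<otimes> c"
  proof (cases "\<exists>z. c \<oplus> z = b")
    case True
    then obtain z where z: "c \<oplus> z = b" by blast
    then have "a \<otimes> c \<oplus> a \<otimes> z = a \<otimes> b"
      using p_distrib p_mul_comm by metis
    from msub_eq[OF this] show ?thesis using msub_eq[OF z] by simp
  next
    case False
    then have "b \<prec> c" using p_total p_le_iff l2_le_def by metis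
    then have "l2_le M (a \<otimes> b) (a \<otimes> c)"
      using p_distrib p_mul_comm unfolding p_less_iff p_le_iff by metis
    then show ?thesis using msub_le msub_zero[OF \<open>b \<prec> c\<close>] by (simp add: ax_mul_0)
  qed
  show "a \<noteq> \<zero> \<Longrightarrow> b \<noteq> \<zero> \<Longrightarrow> a \<otimes> b \<noteq> \<zero>"
    using p_mul_pos p_total ax_less_0 p_irrefl by metis
  show "a \<prec> b \<longleftrightarrow> l2_le M a b \<and> \<not> l2_le M b a"
    unfolding l2_le_def using p_irrefl p_trans by metis
  show "l2_le M a a" by (simp add: l2_le_def)
  show "l2_le M a b \<Longrightarrow> l2_le M b c \<Longrightarrow> l2_le M a c"
    unfolding l2_le_def using p_trans by metis
  show "l2_le M a b \<Longrightarrow> l2_le M b a \<Longrightarrow> a = b"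
    unfolding l2_le_def using p_trans p_irrefl by metis
  show "l2_le M a b \<or> l2_le M b a" unfolding l2_le_def using p_total by metis
  show "l2_le M a b \<Longrightarrow> l2_le M (c \<oplus> a) (c \<oplus> b)"
    unfolding l2_le_def using p_add_less_mono by metis
  show "a \<prec> b \<Longrightarrow> \<zero> \<prec> c \<Longrightarrow> c \<otimes> a \<prec> c \<otimes> b" by (rule p_mul_less_mono)
  show "\<zero> \<prec> \<one>" using p_add_less[of \<zero> \<zero>] by (simp add: p_zero_add)
  show "l2_le M b a \<Longrightarrow> a \<ominus> b \<oplus> b = a"
    unfolding p_le_iff using msub_eq p_add_comm by metis
qed

section \<open>Closure properties of \<open>\<Sigma>\<^sub>1\<close> and
  \<open>\<Delta>\<^sub>1\<close> predicates\<close>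

context rca0_model
begin

abbreviation mle (infix "\<preceq>" 50) where "x \<preceq> y \<equiv> l2_le M x y"

lemma zero_le [simp]: "\<zero> \<preceq> x"
  using ax_less_0 A.not_less by blast

lemma not_less_zero [simp]: "\<not> x \<prec> \<zero>"
  by (rule ax_less_0)

lemma less_succ_iff: "x \<prec> y \<oplus> \<one> \<longleftrightarrow> x \<preceq> y"
  by (simp add: l2_le_def ax_less_succ)

lemma succ_le_iff: "x \<oplus> \<one> \<preceq> y \<longleftrightarrow> x \<prec> y"
  using less_succ_iff A.not_less A.not_le by metis

lemma zero_cases: obtains "x = \<zero>" | y where "x = y \<oplus> \<one>"
  using p_zero_or_succ by blast

lemma add_self_le [simp]: "x \<preceq> x \<oplus> y" "x \<preceq> y \<oplus> x"
  by simp_all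

lemma env_reindex: "(\<lambda>i. e ((k ## \<sigma>) i)) = e k ## (\<lambda>i. e (\<sigma> i))"
  by (rule ext) (simp split: nat.splits)

lemma Dl0_reindex1:
  assumes "Dl0 Q" shows "Dl0 (\<lambda>e. Q (e k ## (\<lambda>i. e (\<sigma> i))))"
  using Dl0_reindex[OF assms, of "k ## \<sigma>"] by (simp only: env_reindex)

lemma Dl0_reindex2:
  assumes "Dl0 Q" shows "Dl0 (\<lambda>e. Q (e k ## (e l ## (\<lambda>i. e (\<sigma> i)))))"
  using Dl0_reindex1[OF assms, of k "l ## \<sigma>"] by (simp only: env_reindex)

lemma S1_reindex:
  assumes "S1 P" shows "S1 (\<lambda>e. P (\<lambda>i. e (\<sigma> i)))"
proof -
  obtain Q where Q: "Dl0 Q" "\<And>e. P e \<longleftrightarrow> (\<exists>y. Q (y ## e))" using assms by (auto simp: S1_def)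
  show ?thesis unfolding Q(2) by (intro S1_ex_Dl0 Dl0_reindex1 Q(1))
qed

lemma S1_disj:
  assumes "S1 P" "S1 P'" shows "S1 (\<lambda>e. P e \<or> P' e)"
proof -
  obtain Q where Q: "Dl0 Q" "\<And>e. P e \<longleftrightarrow> (\<exists>y. Q (y ## e))" using assms by (auto simp: S1_def)
  obtain R where R: "Dl0 R" "\<And>e. P' e \<longleftrightarrow> (\<exists>y. R (y ## e))" using assms by (auto simp: S1_def)
  have "S1 (\<lambda>e. \<exists>y. Q (y ## e) \<or> R (y ## e))" by (intro S1_ex_Dl0 Dl0_disj Dl0_reindex1 Q(1) R(1))
  then show ?thesis by (simp only: Q(2) R(2) ex_disj_distrib)
qed

lemma less_add_succ [simp]: "x \<prec> x \<oplus> y \<oplus> \<one>" "x \<prec> y \<oplus> x \<oplus> \<one>"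
  by (simp_all add: less_succ_iff)

text \<open>Two existential quantifiers are merged by bounding both witnesses by one number, such as
  their sum plus one, rather than by pairing, whose properties come later.\<close>

lemma S1_conj:
  assumes "S1 P" "S1 P'" shows "S1 (\<lambda>e. P e \<and> P' e)"
proof -
  obtain Q where Q: "Dl0 Q" "\<And>e. P e \<longleftrightarrow> (\<exists>y. Q (y ## e))" using assms by (auto simp: S1_def)
  obtain R where R: "Dl0 R" "\<And>e. P' e \<longleftrightarrow> (\<exists>y. R (y ## e))" using assms by (auto simp: S1_def)
  have "S1 (\<lambda>e. \<exists>z. (\<exists>y. y \<prec> z \<and> Q (y ## e)) \<and> (\<exists>y. y \<prec> z \<and> R (y ## e)))"
    by (intro S1_ex_Dl0 Dl0_conj Dl0_bex Dl0_reindex1 Tm_rules Q(1) R(1))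
  moreover have "P e \<and> P' e \<longleftrightarrow> (\<exists>z. (\<exists>y. y \<prec> z \<and> Q (y ## e)) \<and> (\<exists>y. y \<prec> z \<and> R (y ## e)))" for e
    unfolding Q(2) R(2) using less_add_succ by metis
  ultimately show ?thesis by simp
qed

lemma S1_ex:
  assumes "S1 (\<lambda>e. P (e 0) (\<lambda>i. e (Suc i)))" shows "S1 (\<lambda>e. \<exists>x. P x e)"
proof -
  obtain Q where Q: "Dl0 Q" "\<And>e. P (e 0) (\<lambda>i. e (Suc i)) \<longleftrightarrow> (\<exists>y. Q (y ## e))"
    using assms by (auto simp: S1_def)
  have P: "P x e \<longleftrightarrow> (\<exists>y. Q (y ## (x ## e)))" for x e using Q(2)[of "x ## e"] by simp
  have "S1 (\<lambda>e. \<exists>z. \<exists>x. x \<prec> z \<and> (\<exists>y. y \<prec> z \<and> Q (y ## (x ## e))))"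
    by (intro S1_ex_Dl0 Dl0_bex Dl0_reindex2 Tm_rules Q(1))
  moreover have "(\<exists>x. P x e) \<longleftrightarrow> (\<exists>z. \<exists>x. x \<prec> z \<and> (\<exists>y. y \<prec> z \<and> Q (y ## (x ## e))))" for e
    unfolding P using less_add_succ by metis
  ultimately show ?thesis by simp
qed

lemma less_trans_succ: "x \<prec> y \<Longrightarrow> x \<prec> y \<oplus> z \<oplus> \<one>"
  using less_succ_iff add_self_le(1) A.less_imp_le A.order_trans by metis

text \<open>Bounding principle, by induction on initial segments \<open>b'\<close>: the common bound
  is enlarged by one witness at each step. Witnesses are demanded only for
  \<open>x \<prec> b\<close>, so that the induction may run past \<open>b\<close>.\<close>

lemma S1_collection:
  assumes "Dl0 Q" "\<And>x. x \<prec> b \<Longrightarrow> \<exists>y. Q (y ## (x ## e))"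
  shows "\<exists>z. \<forall>x. x \<prec> b \<longrightarrow> (\<exists>y. y \<prec> z \<and> Q (y ## (x ## e)))"
proof -
  \<comment> \<open>Induction admits one free variable, so the whole environment \<open>e\<close> is
    frozen into constants.\<close>
  have Q: "Dl0 (\<lambda>f. Q (f 0 ## (f (Suc 0) ## e)))"
  proof -
    have "trm e ((case_nat (\<lambda>f. f 0) (case_nat (\<lambda>f. f (Suc 0)) (\<lambda>i f. e i))) i)" for i
      by (auto intro: trm.intros split: nat.splits)
    moreover have "(\<lambda>i. case_nat (\<lambda>f. f 0) (case_nat (\<lambda>f. f (Suc 0)) (\<lambda>i f. e i)) i f) = f 0 ## (f (Suc 0) ## e)" for f
      by (rule ext) (simp split: nat.splits)
    ultimately show ?thesis
      using Dl0_subst[OF assms(1), of e "case_nat (\<lambda>f. f 0) (case_nat (\<lambda>f. f (Suc 0)) (\<lambda>i f. e i))"] by (simp only:)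
  qed
  have "\<exists>z. \<forall>x. x \<prec> b' \<longrightarrow> (\<not> x \<prec> b \<or> (\<exists>y. y \<prec> z \<and> Q (y ## (x ## e))))" for b'
  proof (rule S1_induct[of "\<lambda>b'. \<exists>z. \<forall>x. x \<prec> b' \<longrightarrow> (\<not> x \<prec> b \<or> (\<exists>y. y \<prec> z \<and> Q (y ## (x ## e))))"])
    show "S1 (\<lambda>f. \<exists>z. \<forall>x. x \<prec> f 0 \<longrightarrow> (\<not> x \<prec> b \<or> (\<exists>y. y \<prec> z \<and> Q (y ## (x ## e)))))"
      by (intro S1_ex_Dl0 Dl0_rules Tm_rules Q)
    fix a assume "\<exists>z. \<forall>x. x \<prec> a \<longrightarrow> (\<not> x \<prec> b \<or> (\<exists>y. y \<prec> z \<and> Q (y ## (x ## e))))"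
    then obtain z where z: "\<And>x. x \<prec> a \<Longrightarrow> x \<prec> b \<Longrightarrow> \<exists>y. y \<prec> z \<and> Q (y ## (x ## e))" by blast
    obtain w where w: "a \<prec> b \<Longrightarrow> Q (w ## (a ## e))" using assms(2) by blast
    have "\<not> x \<prec> b \<or> (\<exists>y. y \<prec> z \<oplus> w \<oplus> \<one> \<and> Q (y ## (x ## e)))" if "x \<prec> a \<oplus> \<one>" for x
      using that w z less_add_succ(2)[of w z] less_trans_succ unfolding less_succ_iff l2_le_def
      by blast
    then show "\<exists>z. \<forall>x. x \<prec> a \<oplus> \<one> \<longrightarrow> (\<not> x \<prec> b \<or> (\<exists>y. y \<prec> z \<and> Q (y ## (x ## e))))" by blast
  qed simp
  from this[of b] show ?thesis by blast
qed

definition F :: "((nat \<Rightarrow> 'a) \<Rightarrow> 'a) \<Rightarrow> bool" where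
  "F f \<longleftrightarrow> S1 (\<lambda>e. e 0 = f (\<lambda>i. e (Suc i)))"

definition D :: "((nat \<Rightarrow> 'a) \<Rightarrow> bool) \<Rightarrow> bool" where
  "D P \<longleftrightarrow> S1 P \<and> S1 (\<lambda>e. \<not> P e)"

lemma S1_D: "D P \<Longrightarrow> S1 P" and S1_not_D: "D P \<Longrightarrow> S1 (\<lambda>e. \<not> P e)"
  by (auto simp: D_def)

lemma D_I: "S1 P \<Longrightarrow> S1 (\<lambda>e. \<not> P e) \<Longrightarrow> D P"
  by (simp add: D_def)

lemma D_Dl0: "Dl0 P \<Longrightarrow> D P"
  by (intro D_I S1_Dl0 Dl0_neg)

lemma D_neg: "D P \<Longrightarrow> D (\<lambda>e. \<not> P e)"
  by (simp add: D_def)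

lemma D_conj: "D P \<Longrightarrow> D Q \<Longrightarrow> D (\<lambda>e. P e \<and> Q e)"
  using S1_conj[of P Q] S1_disj[of "\<lambda>e. \<not> P e" "\<lambda>e. \<not> Q e"] by (simp add: D_def)

lemma D_disj: "D P \<Longrightarrow> D Q \<Longrightarrow> D (\<lambda>e. P e \<or> Q e)"
  using S1_disj[of P Q] S1_conj[of "\<lambda>e. \<not> P e" "\<lambda>e. \<not> Q e"] by (simp add: D_def)

lemma D_imp: "D P \<Longrightarrow> D Q \<Longrightarrow> D (\<lambda>e. P e \<longrightarrow> Q e)"
  unfolding imp_conv_disj by (intro D_disj D_neg)

lemma D_iff: "D P \<Longrightarrow> D Q \<Longrightarrow> D (\<lambda>e. P e = Q e)"
  using D_conj[OF D_imp[of P Q] D_imp[of Q P]] by (simp add: iff_conv_conj_imp)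

lemma D_bool: "D (\<lambda>e. b)"
proof -
  have "D (\<lambda>e. \<zero> = (if b then \<zero> else \<one>))" by (intro D_Dl0 Dl0_rules Tm_rules)
  then show ?thesis by (simp split: if_splits)
qed

lemma D_reindex: "D P \<Longrightarrow> D (\<lambda>e. P (\<lambda>i. e (\<sigma> i)))"
  unfolding D_def using S1_reindex[of P \<sigma>] S1_reindex[of "\<lambda>e. \<not> P e" \<sigma>] by simp

lemma S1_sub:
  assumes "F s" "S1 (\<lambda>e. P (e 0) (\<lambda>i. e (Suc i)))" shows "S1 (\<lambda>e. P (s e) e)"
proof -
  have "S1 (\<lambda>e. \<exists>x. x = s e \<and> P x e)"
    by (intro S1_ex S1_conj assms(2) assms(1)[unfolded F_def])
  then show ?thesis by simp
qed

text \<open>The value of a total function can be introduced by an existential quantifier in a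
  predicate and in its negation alike; this is why a \<open>\<Sigma>\<^sub>1\<close> graph is all
  that \<open>F\<close> asks for.\<close>

lemma D_sub:
  assumes "F s" "D (\<lambda>e. P (e 0) (\<lambda>i. e (Suc i)))" shows "D (\<lambda>e. P (s e) e)"
  using assms S1_sub[of s P] S1_sub[of s "\<lambda>x e. \<not> P x e"] by (simp add: D_def)

lemma F_reindex: "F f \<Longrightarrow> F (\<lambda>e. f (\<lambda>i. e (\<sigma> i)))"
  unfolding F_def using S1_reindex[of "\<lambda>e. e 0 = f (\<lambda>i. e (Suc i))" "0 ## (\<lambda>i. Suc (\<sigma> i))"] by simp

lemma F_sub:
  assumes "F s" "F (\<lambda>e. g (e 0) (\<lambda>i. e (Suc i)))" shows "F (\<lambda>e. g (s e) e)"
proof -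
  have "S1 (\<lambda>e. e 1 = g (e 0) (\<lambda>i. e (Suc (Suc i))))"
    using S1_reindex[OF assms(2)[unfolded F_def], of "1 ## (0 ## (\<lambda>i. Suc (Suc i)))"] by simp
  then have "S1 (\<lambda>e. e 0 = g (s (\<lambda>i. e (Suc i))) (\<lambda>i. e (Suc i)))"
    using S1_sub[OF F_reindex[OF assms(1), of Suc], of "\<lambda>x e. e 0 = g x (\<lambda>i. e (Suc i))"] by simp
  then show ?thesis unfolding F_def .
qed

lemma D_app1: "D (\<lambda>e. P (e 0)) \<Longrightarrow> F s \<Longrightarrow> D (\<lambda>e. P (s e))"
  using D_sub[of s "\<lambda>x e. P x"] by simp

lemma D_app2:
  assumes "D (\<lambda>e. P (e 0) (e 1))" "F s" "F t" shows "D (\<lambda>e. P (s e) (t e))"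
proof -
  have "D (\<lambda>e. P (s (\<lambda>i. e (Suc i))) (e 0))"
    using D_sub[OF F_reindex[OF assms(2), of Suc], of "\<lambda>x e. P x (e 0)"] assms(1) by simp
  then show ?thesis using D_sub[OF assms(3), of "\<lambda>x e. P (s e) x"] by simp
qed

lemma F_app1: "F (\<lambda>e. g (e 0)) \<Longrightarrow> F s \<Longrightarrow> F (\<lambda>e. g (s e))"
  using F_sub[of s "\<lambda>x e. g x"] by simp

lemma F_app2:
  assumes "F (\<lambda>e. g (e 0) (e 1))" "F s" "F t" shows "F (\<lambda>e. g (s e) (t e))"
proof -
  have "F (\<lambda>e. g (s (\<lambda>i. e (Suc i))) (e 0))"
    using F_sub[OF F_reindex[OF assms(2), of Suc], of "\<lambda>x e. g x (e 0)"] assms(1) by simp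
  then show ?thesis using F_sub[OF assms(3), of "\<lambda>x e. g (s e) x"] by simp
qed

lemma F_I: "S1 (\<lambda>e. e 0 = f (\<lambda>i. e (Suc i))) \<Longrightarrow> F f"
  by (simp add: F_def)

lemma F_const: "F (\<lambda>e. a)" and F_var: "F (\<lambda>e. e i)"
  unfolding F_def by (intro S1_Dl0 Dl0_rules Tm_rules)+

lemma F_add: "F s \<Longrightarrow> F t \<Longrightarrow> F (\<lambda>e. s e \<oplus> t e)"
  by (rule F_app2[of "\<lambda>x y. x \<oplus> y"], intro F_I S1_Dl0 Dl0_rules Tm_rules)

lemma F_mul: "F s \<Longrightarrow> F t \<Longrightarrow> F (\<lambda>e. s e \<otimes> t e)"
  by (rule F_app2[of "\<lambda>x y. x \<otimes> y"], intro F_I S1_Dl0 Dl0_rules Tm_rules)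

lemma D_eq: "F s \<Longrightarrow> F t \<Longrightarrow> D (\<lambda>e. s e = t e)"
  by (rule D_app2[of "\<lambda>x y. x = y"], intro D_Dl0 Dl0_rules Tm_rules)

lemma D_less: "F s \<Longrightarrow> F t \<Longrightarrow> D (\<lambda>e. s e \<prec> t e)"
  by (rule D_app2[of "\<lambda>x y. x \<prec> y"], intro D_Dl0 Dl0_rules Tm_rules)

lemma D_le: "F s \<Longrightarrow> F t \<Longrightarrow> D (\<lambda>e. s e \<preceq> t e)"
  unfolding l2_le_def by (intro D_disj D_eq D_less)

lemma D_mem: "X \<in> l2_sets M \<Longrightarrow> F t \<Longrightarrow> D (\<lambda>e. t e \<in> X)"
  by (rule D_app1[of "\<lambda>x. x \<in> X"], intro D_Dl0 Dl0_rules Tm_rules)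

text \<open>\<open>S1_collection\<close> moves the witness quantifier in front of the bounded one.
  The bound is a variable at first, since \<open>Dl0_ball\<close> accepts only terms, and
  \<open>t\<close> is substituted afterwards.\<close>

lemma S1_ball:
  assumes "F t" "S1 (\<lambda>e. P (e 0) (\<lambda>i. e (Suc i)))" shows "S1 (\<lambda>e. \<forall>x. x \<prec> t e \<longrightarrow> P x e)"
proof -
  obtain Q where Q: "Dl0 Q" "\<And>e. P (e 0) (\<lambda>i. e (Suc i)) \<longleftrightarrow> (\<exists>y. Q (y ## e))"
    using assms(2) by (auto simp: S1_def)
  have P: "P x e \<longleftrightarrow> (\<exists>y. Q (y ## (x ## e)))" for x e using Q(2)[of "x ## e"] by simp
  have "S1 (\<lambda>e. \<exists>z. \<forall>x. x \<prec> e 0 \<longrightarrow> (\<exists>y. y \<prec> z \<and> Q (y ## (x ## (\<lambda>i. e (Suc i))))))"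
    by (intro S1_ex_Dl0 Dl0_ball Dl0_bex Dl0_reindex2 Tm_rules Q(1))
  then have "S1 (\<lambda>e. \<exists>z. \<forall>x. x \<prec> t e \<longrightarrow> (\<exists>y. y \<prec> z \<and> Q (y ## (x ## e))))"
    by (rule S1_sub[OF assms(1)])
  moreover have "(\<forall>x. x \<prec> t e \<longrightarrow> P x e) \<longleftrightarrow> (\<exists>z. \<forall>x. x \<prec> t e \<longrightarrow> (\<exists>y. y \<prec> z \<and> Q (y ## (x ## e))))" for e
    unfolding P using S1_collection[OF Q(1), of "t e" e] by blast
  ultimately show ?thesis by simp
qed

lemma S1_bex:
  assumes "F t" "S1 (\<lambda>e. P (e 0) (\<lambda>i. e (Suc i)))" shows "S1 (\<lambda>e. \<exists>x. x \<prec> t e \<and> P x e)"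
  using S1_D[OF D_less[OF F_var F_reindex[OF assms(1), of Suc]], of 0] assms(2)
  by (intro S1_ex S1_conj)

lemma D_ball:
  assumes "F t" "D (\<lambda>e. P (e 0) (\<lambda>i. e (Suc i)))" shows "D (\<lambda>e. \<forall>x. x \<prec> t e \<longrightarrow> P x e)"
proof -
  have "S1 (\<lambda>e. \<exists>x. x \<prec> t e \<and> \<not> P x e)"
    by (intro S1_bex assms(1)) (use assms(2) in \<open>simp add: D_def\<close>)
  then have "S1 (\<lambda>e. \<not> (\<forall>x. x \<prec> t e \<longrightarrow> P x e))" by simp
  then show ?thesis using S1_ball[OF assms(1)] assms(2) by (simp add: D_def)
qed

lemma D_bex:
  assumes "F t" "D (\<lambda>e. P (e 0) (\<lambda>i. e (Suc i)))" shows "D (\<lambda>e. \<exists>x. x \<prec> t e \<and> P x e)"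
proof -
  have "D (\<lambda>e. \<not> (\<forall>x. x \<prec> t e \<longrightarrow> \<not> P x e))" by (intro D_neg D_ball assms)
  then show ?thesis by simp
qed

lemma D_ball_le:
  assumes "F t" "D (\<lambda>e. P (e 0) (\<lambda>i. e (Suc i)))" shows "D (\<lambda>e. \<forall>x. x \<preceq> t e \<longrightarrow> P x e)"
  using D_ball[OF F_add[OF assms(1) F_const[of \<one>]] assms(2)] by (simp add: less_succ_iff)

lemma D_bex_le:
  assumes "F t" "D (\<lambda>e. P (e 0) (\<lambda>i. e (Suc i)))" shows "D (\<lambda>e. \<exists>x. x \<preceq> t e \<and> P x e)"
  using D_bex[OF F_add[OF assms(1) F_const[of \<one>]] assms(2)] by (simp add: less_succ_iff)

lemma S1_imp: "D P \<Longrightarrow> S1 Q \<Longrightarrow> S1 (\<lambda>e. P e \<longrightarrow> Q e)"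
  unfolding imp_conv_disj by (intro S1_disj S1_not_D)

lemma F_graph_D: "D (\<lambda>e. e 0 = f (\<lambda>i. e (Suc i))) \<Longrightarrow> F f"
  by (rule F_I) (rule S1_D)

lemma F_if:
  assumes "D P" "F s" "F t" shows "F (\<lambda>e. if P e then s e else t e)"
proof -
  have "S1 (\<lambda>e. (P (\<lambda>i. e (Suc i)) \<and> e 0 = s (\<lambda>i. e (Suc i))) \<or>
      (\<not> P (\<lambda>i. e (Suc i)) \<and> e 0 = t (\<lambda>i. e (Suc i))))"
    using D_reindex[OF assms(1), of Suc] assms(2,3) unfolding F_def
    by (intro S1_disj S1_conj) (simp_all add: D_def)
  moreover have "(P (\<lambda>i. e (Suc i)) \<and> e 0 = s (\<lambda>i. e (Suc i))) \<or>
      (\<not> P (\<lambda>i. e (Suc i)) \<and> e 0 = t (\<lambda>i. e (Suc i))) \<longleftrightarrow>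
      e 0 = (if P (\<lambda>i. e (Suc i)) then s (\<lambda>i. e (Suc i)) else t (\<lambda>i. e (Suc i)))" for e
    by simp
  ultimately show ?thesis unfolding F_def by simp
qed

lemma F_msub: "F s \<Longrightarrow> F t \<Longrightarrow> F (\<lambda>e. s e \<ominus> t e)"
proof (rule F_app2[of "\<lambda>x y. x \<ominus> y"])
  have "z = x \<ominus> y \<longleftrightarrow> y \<oplus> z = x \<or> (x \<prec> y \<and> z = \<zero>)" for x y z
    using msub_eq msub_zero p_le_iff A.not_less by metis
  then show "F (\<lambda>e. e 0 \<ominus> e 1)"
    by (intro F_graph_D) (simp only:, intro D_disj D_conj D_eq D_less F_add F_var F_const)
qed

text \<open>If no member of \<open>P\<close> were least, having no member below \<open>b\<close>
  would be a \<open>\<Sigma>\<^sub>1\<close> condition on \<open>b\<close> closed under successor,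
  and induction would make \<open>P\<close> empty.\<close>

lemma D_least:
  assumes "D (\<lambda>e. P (e 0))" "P a"
  shows "\<exists>b. P b \<and> (\<forall>x. x \<prec> b \<longrightarrow> \<not> P x)"
proof (rule ccontr)
  assume no: "\<nexists>b. P b \<and> (\<forall>x. x \<prec> b \<longrightarrow> \<not> P x)"
  have "\<forall>x. x \<prec> b \<longrightarrow> \<not> P x" for b
  proof (rule S1_induct[of "\<lambda>b. \<forall>x. x \<prec> b \<longrightarrow> \<not> P x"])
    show "S1 (\<lambda>e. \<forall>x. x \<prec> e 0 \<longrightarrow> \<not> P x)"
      by (intro S1_D D_ball F_var D_neg assms(1))
  qed (use no in \<open>auto simp: ax_less_succ\<close>)
  from this[of "a \<oplus> \<one>"] show False using assms(2) by (auto simp: ax_less_succ)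
qed

definition least :: "('a \<Rightarrow> bool) \<Rightarrow> 'a" where
  "least P = (THE b. P b \<and> (\<forall>x. x \<prec> b \<longrightarrow> \<not> P x))"

lemma least_eqI: "P b \<Longrightarrow> (\<And>x. x \<prec> b \<Longrightarrow> \<not> P x) \<Longrightarrow> least P = b"
  unfolding least_def by (rule the_equality) (use A.neqE in blast)+

lemma least_props:
  assumes "D (\<lambda>e. P (e 0))" "P a"
  shows "P (least P)" "x \<prec> least P \<Longrightarrow> \<not> P x" "least P \<preceq> a"
proof -
  obtain b where b: "P b" "\<forall>x. x \<prec> b \<longrightarrow> \<not> P x" using D_least[OF assms] by blast
  then have eq: "least P = b" using least_eqI by blast
  show "P (least P)" "x \<prec> least P \<Longrightarrow> \<not> P x" using b eq by simp_all
  show "least P \<preceq> a" using assms(2) b eq A.not_less by blast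
qed

lemmas F_rules = F_const F_var F_add F_mul F_msub F_if
lemmas D_rules = D_bool D_eq D_less D_le D_neg D_conj D_disj D_imp D_iff D_ball_le D_bex_le D_ball D_bex
lemmas S1_rules = S1_ex S1_D

section \<open>Pairs and codes of finite sequences\<close>

lemma mul_ge_self: "\<zero> \<prec> y \<Longrightarrow> x \<preceq> x \<otimes> y"
proof -
  assume "\<zero> \<prec> y"
  then obtain z where "y = z \<oplus> \<one>" using zero_cases by auto
  then show ?thesis by (simp add: algebra_simps)
qed

lemma self_le_square: "x \<preceq> x \<otimes> x"
  using mul_ge_self[of x x] A.not_less A.order_trans zero_le by (metis ax_mul_0 l2_le_def)

lemma pair_ge: "x \<preceq> pair M x y" "y \<preceq> pair M x y"
proof -
  show "x \<preceq> pair M x y" unfolding pair_def by simp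
  have "y \<preceq> x \<oplus> y" by simp
  also have "x \<oplus> y \<preceq> (x \<oplus> y) \<otimes> (x \<oplus> y)" by (rule self_le_square)
  also have "\<dots> \<preceq> pair M x y" unfolding pair_def by simp
  finally show "y \<preceq> pair M x y" .
qed

lemma pair_mono: "x \<preceq> x' \<Longrightarrow> y \<preceq> y' \<Longrightarrow> pair M x y \<preceq> pair M x' y'"
  unfolding pair_def by (intro A.add_mono A.mult_mono) simp_all

text \<open>With s = x + y, the code lies between s^2 and s^2 + s, hence below (s + 1)^2: pairs with
  different sums are separated by squares.\<close>

lemma pair_less: "x \<oplus> y \<prec> x' \<oplus> y' \<Longrightarrow> pair M x y \<prec> pair M x' y'"
proof -
  assume "x \<oplus> y \<prec> x' \<oplus> y'"
  then have "(x \<oplus> y \<oplus> \<one>) \<otimes> (x \<oplus> y \<oplus> \<one>) \<preceq> (x' \<oplus> y') \<otimes> (x' \<oplus> y')"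
    unfolding succ_le_iff[symmetric] by (intro A.mult_mono) simp_all
  moreover have "pair M x y \<prec> (x \<oplus> y \<oplus> \<one>) \<otimes> (x \<oplus> y \<oplus> \<one>)"
  proof -
    let ?s = "x \<oplus> y"
    have "(s \<oplus> \<one>) \<otimes> (s \<oplus> \<one>) = (s \<otimes> s \<oplus> s) \<oplus> s \<oplus> \<one>" for s
      by (simp add: algebra_simps)
    moreover have "pair M x y \<preceq> ?s \<otimes> ?s \<oplus> ?s" unfolding pair_def by (intro A.add_mono) simp_all
    ultimately show ?thesis using less_add_succ(1) A.le_less_trans by metis
  qed
  ultimately show ?thesis unfolding pair_def[of _ x'] using A.less_le_trans add_self_le by metis
qed

lemma pair_inj [simp]: "pair M x y = pair M x' y' \<longleftrightarrow> x = x' \<and> y = y'"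
proof
  assume eq: "pair M x y = pair M x' y'"
  have "x \<oplus> y = x' \<oplus> y'"
    using pair_less[of x y x' y'] pair_less[of x' y' x y] eq p_total p_irrefl by metis
  then show "x = x' \<and> y = y'" using eq unfolding pair_def by auto
qed simp

text \<open>\<open>pair\<close> is not onto, and the value \<open>\<zero>\<close> off its range
  makes the projection total. The search for components can be bounded by the code itself, thanks to
  \<open>pair_ge\<close>.\<close>

definition pfst :: "'a \<Rightarrow> 'a" where
  "pfst z = (if \<exists>x y. z = pair M x y then THE x. \<exists>y. z = pair M x y else \<zero>)"

definition psnd :: "'a \<Rightarrow> 'a" where
  "psnd z = (if \<exists>x y. z = pair M x y then THE y. \<exists>x. z = pair M x y else \<zero>)"

lemma pfst_pair [simp]: "pfst (pair M x y) = x"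
  and psnd_pair [simp]: "psnd (pair M x y) = y"
  unfolding pfst_def psnd_def by auto

lemma F_pair: "F s \<Longrightarrow> F t \<Longrightarrow> F (\<lambda>e. pair M (s e) (t e))"
  unfolding pair_def by (intro F_rules)

lemma F_pfst: "F s \<Longrightarrow> F (\<lambda>e. pfst (s e))"
proof (rule F_app1[of pfst])
  have "x = pfst z \<longleftrightarrow> (\<exists>y. y \<preceq> z \<and> z = pair M x y) \<or>
      (\<not> (\<exists>x. x \<preceq> z \<and> (\<exists>y. y \<preceq> z \<and> z = pair M x y)) \<and> x = \<zero>)" for x z
  proof (cases "\<exists>x y. z = pair M x y")
    case True
    then obtain a b where z: "z = pair M a b" by blast
    have "a \<preceq> pair M a b" "b \<preceq> pair M a b" by (rule pair_ge)+
    then show ?thesis unfolding z by auto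
  qed (auto simp: pfst_def)
  then show "F (\<lambda>e. pfst (e 0))"
    by (intro F_graph_D) (simp only:, intro D_rules F_pair F_rules)
qed

lemma F_psnd: "F s \<Longrightarrow> F (\<lambda>e. psnd (s e))"
proof (rule F_app1[of psnd])
  have "x = psnd z \<longleftrightarrow> (\<exists>y. y \<preceq> z \<and> z = pair M y x) \<or>
      (\<not> (\<exists>x. x \<preceq> z \<and> (\<exists>y. y \<preceq> z \<and> z = pair M x y)) \<and> x = \<zero>)" for x z
  proof (cases "\<exists>x y. z = pair M x y")
    case True
    then obtain a b where z: "z = pair M a b" by blast
    have "a \<preceq> pair M a b" "b \<preceq> pair M a b" by (rule pair_ge)+
    then show ?thesis unfolding z by auto
  qed (auto simp: psnd_def)
  then show "F (\<lambda>e. psnd (e 0))"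
    by (intro F_graph_D) (simp only:, intro D_rules F_pair F_rules)
qed

section \<open>Coding finite sets by divisibility\<close>

abbreviation mdvd (infix "dvd\<^sub>M" 50) where "mdvd \<equiv> dvd.dvd (l2_mul M)"

lemma mdvd_iff: "d dvd\<^sub>M u \<longleftrightarrow> (\<exists>k. u = d \<otimes> k)"
  by (rule A.dvd_def)

lemma D_mdvd: "F s \<Longrightarrow> F t \<Longrightarrow> D (\<lambda>e. s e dvd\<^sub>M t e)"
proof (rule D_app2[of "\<lambda>d u. d dvd\<^sub>M u"])
  have "d dvd\<^sub>M u \<longleftrightarrow> (\<exists>k. k \<preceq> u \<and> u = d \<otimes> k)" for d u
    unfolding mdvd_iff using mul_ge_self[of d] A.mult.commute ax_mul_0 zero_le
    by (metis A.order_antisym A.order.refl A.not_less)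
  then show "D (\<lambda>e. e 0 dvd\<^sub>M e 1)"
    by (simp only:, intro D_rules F_rules)
qed

text \<open>The moduli of Goedel's beta function. The shift to x + 1 makes every modulus, that of x
  = 0 included, exceed 1 when v is positive.\<close>

definition modu :: "'a \<Rightarrow> 'a \<Rightarrow> 'a" where
  "modu v x = (x \<oplus> \<one>) \<otimes> v \<oplus> \<one>"

lemma F_modu: "F s \<Longrightarrow> F t \<Longrightarrow> F (\<lambda>e. modu (s e) (t e))"
  unfolding modu_def by (intro F_rules)

text \<open>
  An explicit Bezout identity shows that the moduli \<open>1 + (x + 1) v\<close> and \<open>1 + (y + 1) v\<close> are coprime
  if \<open>x - y\<close> divides \<open>v\<close>: with \<open>v = \<bar>x - y\<bar> q\<close> and \<open>K = (x + 1)\<^sup>2 q\<close> one has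
  \<open>K d - K d' = \<plusminus> (d - 1)\<^sup>2\<close>.
\<close>

lemma modu_coprime_aux:
  assumes "v = w \<otimes> q" "d = a \<otimes> v \<oplus> \<one>"
  shows "(a \<otimes> a \<otimes> q) \<otimes> (w \<otimes> v) \<oplus> (d \<oplus> d) = d \<otimes> d \<oplus> \<one>"
proof -
  have "(a \<otimes> a \<otimes> q) \<otimes> (w \<otimes> v) = (a \<otimes> (w \<otimes> q)) \<otimes> (a \<otimes> v)"
    by (simp add: ac_simps)
  then have "(a \<otimes> a \<otimes> q) \<otimes> (w \<otimes> v) = (a \<otimes> v) \<otimes> (a \<otimes> v)"
    by (simp only: assms(1)[symmetric])
  then show ?thesis unfolding assms(2) by (simp add: algebra_simps)
qed

lemma modu_coprime:
  assumes "x \<noteq> y" "\<And>w. x = y \<oplus> w \<or> y = x \<oplus> w \<Longrightarrow> w dvd\<^sub>M v" "modu v x dvd\<^sub>M u \<otimes> modu v y"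
  shows "modu v x dvd\<^sub>M u"
proof -
  let ?d = "modu v x" and ?d' = "modu v y"
  obtain w where w: "x = y \<oplus> w \<or> y = x \<oplus> w" using p_le_iff p_total l2_le_def by metis
  then obtain q where q: "v = w \<otimes> q" using assms(2) mdvd_iff by blast
  let ?K = "(x \<oplus> \<one>) \<otimes> (x \<oplus> \<one>) \<otimes> q"
  \<comment> \<open>This is K w v = (d - 1)^2, written without subtraction.\<close>
  have aux: "?K \<otimes> (w \<otimes> v) \<oplus> (?d \<oplus> ?d) = ?d \<otimes> ?d \<oplus> \<one>"
    using modu_coprime_aux[OF q, of ?d "x \<oplus> \<one>"] unfolding modu_def by simp
  have dd: "?d dvd\<^sub>M u \<otimes> ?d'" by (rule assms(3))
  from w show ?thesis
  proof
    assume "x = y \<oplus> w"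
    then have "?d = ?d' \<oplus> w \<otimes> v" unfolding modu_def by (simp add: algebra_simps)
    then have "?K \<otimes> ?d \<oplus> (?d \<oplus> ?d) = ?K \<otimes> ?d' \<oplus> (?d \<otimes> ?d \<oplus> \<one>)"
      unfolding aux[symmetric] by (metis A.distrib_left A.add.assoc)
    \<comment> \<open>After multiplication by \<open>u\<close>, every term except a single
      \<open>u\<close> is a multiple of \<open>?d\<close>.\<close>
    then have "u \<otimes> (?K \<otimes> ?d \<oplus> (?d \<oplus> ?d)) = u \<otimes> (?K \<otimes> ?d' \<oplus> (?d \<otimes> ?d \<oplus> \<one>))" by simp
    then have "?d \<otimes> (u \<otimes> ?K \<oplus> u \<oplus> u) = ?K \<otimes> (u \<otimes> ?d') \<oplus> ?d \<otimes> (u \<otimes> ?d) \<oplus> u"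
      by (simp add: algebra_simps)
    then have "?d dvd\<^sub>M (?K \<otimes> (u \<otimes> ?d') \<oplus> ?d \<otimes> (u \<otimes> ?d)) \<oplus> u" by (metis A.dvd_triv_left)
    moreover have "?d dvd\<^sub>M ?K \<otimes> (u \<otimes> ?d') \<oplus> ?d \<otimes> (u \<otimes> ?d)"
      using dd by (intro A.dvd_add) simp_all
    ultimately show ?thesis using A.dvd_add_right_iff by blast
  next
    assume "y = x \<oplus> w"
    then have "?d' = ?d \<oplus> w \<otimes> v" unfolding modu_def by (simp add: algebra_simps)
    then have "?K \<otimes> ?d' \<oplus> (?d \<oplus> ?d) = ?K \<otimes> ?d \<oplus> (?d \<otimes> ?d \<oplus> \<one>)"
      unfolding aux[symmetric] by (metis A.distrib_left A.add.assoc)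
    then have "u \<otimes> (?K \<otimes> ?d' \<oplus> (?d \<oplus> ?d)) = u \<otimes> (?K \<otimes> ?d \<oplus> (?d \<otimes> ?d \<oplus> \<one>))" by simp
    then have "?K \<otimes> (u \<otimes> ?d') \<oplus> ?d \<otimes> (u \<oplus> u) = ?d \<otimes> (?K \<otimes> u \<oplus> u \<otimes> ?d) \<oplus> u"
      by (simp add: algebra_simps)
    moreover have "?d dvd\<^sub>M ?K \<otimes> (u \<otimes> ?d') \<oplus> ?d \<otimes> (u \<oplus> u)"
      using dd by (intro A.dvd_add) simp_all
    ultimately have "?d dvd\<^sub>M ?d \<otimes> (?K \<otimes> u \<oplus> u \<otimes> ?d) \<oplus> u" by simp
    then show ?thesis using A.dvd_add_right_iff A.dvd_triv_left by blast
  qed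
qed

lemma common_multiple: "\<exists>v. \<zero> \<prec> v \<and> (\<forall>x. x \<prec> b \<longrightarrow> x \<oplus> \<one> dvd\<^sub>M v)"
proof (rule S1_induct[of "\<lambda>b. \<exists>v. \<zero> \<prec> v \<and> (\<forall>x. x \<prec> b \<longrightarrow> x \<oplus> \<one> dvd\<^sub>M v)"])
  show "S1 (\<lambda>e. \<exists>v. \<zero> \<prec> v \<and> (\<forall>x. x \<prec> e 0 \<longrightarrow> x \<oplus> \<one> dvd\<^sub>M v))"
    by (intro S1_rules D_rules F_rules D_mdvd)
  show "\<exists>v. \<zero> \<prec> v \<and> (\<forall>x. x \<prec> \<zero> \<longrightarrow> x \<oplus> \<one> dvd\<^sub>M v)" by (intro exI[of _ \<one>]) simp
  fix b assume "\<exists>v. \<zero> \<prec> v \<and> (\<forall>x. x \<prec> b \<longrightarrow> x \<oplus> \<one> dvd\<^sub>M v)"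
  then obtain v where v: "\<zero> \<prec> v" "\<And>x. x \<prec> b \<Longrightarrow> x \<oplus> \<one> dvd\<^sub>M v" by blast
  have "\<zero> \<prec> v \<otimes> (b \<oplus> \<one>)" using v(1) by (intro A.mult_pos_pos) (simp_all add: less_succ_iff)
  moreover have "x \<oplus> \<one> dvd\<^sub>M v \<otimes> (b \<oplus> \<one>)" if "x \<prec> b \<oplus> \<one>" for x
    using that v(2) by (auto simp: ax_less_succ intro: A.dvd_mult2)
  ultimately show "\<exists>v. \<zero> \<prec> v \<and> (\<forall>x. x \<prec> b \<oplus> \<one> \<longrightarrow> x \<oplus> \<one> dvd\<^sub>M v)" by blast
qed

lemma dvd_imp_le: "d dvd\<^sub>M u \<Longrightarrow> \<zero> \<prec> u \<Longrightarrow> d \<preceq> u"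
  unfolding mdvd_iff using mul_ge_self ax_mul_0 by (metis A.not_less A.order_antisym zero_le p_irrefl)

lemma less_modu: "\<zero> \<prec> v \<Longrightarrow> x \<oplus> \<one> \<prec> modu v x"
  unfolding modu_def less_succ_iff by (rule mul_ge_self)

text \<open>\<open>u\<close> is the product of the moduli of the members of \<open>P\<close>,
  multiplied up one number at a time; by coprimality a new factor makes no other modulus below
  \<open>b\<close> divide the product.\<close>

lemma set_code:
  assumes P: "D (\<lambda>e. P (e 0))"
  shows "\<exists>u v. \<zero> \<prec> u \<and> \<zero> \<prec> v \<and> (\<forall>x. x \<prec> b \<longrightarrow> (modu v x dvd\<^sub>M u \<longleftrightarrow> P x))"
proof -
  obtain v where v: "\<zero> \<prec> v" "\<And>x. x \<prec> b \<Longrightarrow> x \<oplus> \<one> dvd\<^sub>M v" using common_multiple by blast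
  \<comment> \<open>The distance of two distinct numbers below \<open>b\<close> is some
    \<open>z \<oplus> \<one>\<close> with \<open>z \<prec> b\<close>, so it divides
    \<open>v\<close>, as \<open>modu_coprime\<close> requires.\<close>
  have vw: "w dvd\<^sub>M v" if "x = y \<oplus> w \<or> y = x \<oplus> w" "x \<noteq> y" "x \<prec> b" "y \<prec> b" for x y w
  proof -
    have "w \<noteq> \<zero>" using that by auto
    then obtain z where z: "w = z \<oplus> \<one>" using zero_cases by blast
    have "w \<preceq> x \<or> w \<preceq> y" using that(1) by auto
    then have "z \<prec> b" using z that(3,4) succ_le_iff A.less_trans by metis
    then show ?thesis using v(2) z by simp
  qed
  let ?Q = "\<lambda>y. \<exists>u. \<zero> \<prec> u \<and> (\<forall>x. x \<prec> b \<longrightarrow> (modu v x dvd\<^sub>M u \<longleftrightarrow> x \<prec> y \<and> P x))"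
  have "?Q b"
  proof (rule S1_induct[of ?Q])
    show "S1 (\<lambda>e. ?Q (e 0))"
      by (intro S1_rules D_rules D_app1[OF P] F_rules D_mdvd F_modu)
    have "\<not> modu v x dvd\<^sub>M \<one>" for x
    proof
      assume "modu v x dvd\<^sub>M \<one>"
      then have "modu v x \<preceq> \<one>" by (rule dvd_imp_le) simp
      then have "x \<oplus> \<one> \<prec> \<one>" using less_modu[OF v(1), of x] A.less_le_trans by blast
      then show False by (metis add_self_le(2) A.not_less)
    qed
    then show "?Q \<zero>" by (intro exI[of _ \<one>]) simp
    fix y assume "?Q y"
    then obtain u where u: "\<zero> \<prec> u" "\<And>x. x \<prec> b \<Longrightarrow> modu v x dvd\<^sub>M u \<longleftrightarrow> x \<prec> y \<and> P x" by blast
    show "?Q (y \<oplus> \<one>)"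
    proof (cases "y \<prec> b \<and> P y")
      case True
      have "modu v x dvd\<^sub>M u \<otimes> modu v y \<longleftrightarrow> x \<prec> y \<oplus> \<one> \<and> P x" if "x \<prec> b" for x
      proof (cases "x = y")
        case False
        then have "modu v x dvd\<^sub>M u \<otimes> modu v y \<longleftrightarrow> modu v x dvd\<^sub>M u"
          using modu_coprime[OF False, of v u] vw[OF _ False that] True by (auto intro: A.dvd_mult2)
        then show ?thesis using u(2)[OF that] False by (simp add: ax_less_succ)
      qed (use True in \<open>simp add: ax_less_succ\<close>)
      moreover have "\<zero> \<prec> u \<otimes> modu v y"
        by (intro A.mult_pos_pos u(1)) (simp add: modu_def less_succ_iff)
      ultimately show ?thesis by blast
    next
      case False
      then show ?thesis using u by (intro exI[of _ u]) (auto simp: ax_less_succ)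
    qed
  qed
  then show ?thesis using v(1) by (metis (lifting))
qed

text \<open>The code pairs the two numbers that \<open>set_code\<close> yields for the graph of a
  sequence. The alternative \<open>y = c\<close> ends the search in every case, so that
  \<open>val\<close> is total.\<close>

definition val :: "'a \<Rightarrow> 'a \<Rightarrow> 'a" where
  "val c i = least (\<lambda>y. modu (psnd c) (pair M i y) dvd\<^sub>M pfst c \<or> y = c)"

lemma F_least:
  assumes "D (\<lambda>e. P (e 0) (\<lambda>i. e (Suc i)))" "\<And>e. \<exists>y. P y e"
    and "\<And>e. D (\<lambda>f. P (f 0) e)"
  shows "F (\<lambda>e. least (\<lambda>y. P y e))"
proof -
  have "y = least (\<lambda>y. P y e) \<longleftrightarrow> P y e \<and> (\<forall>x. x \<prec> y \<longrightarrow> \<not> P x e)" for y e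
    using least_props(1,2)[OF assms(3)] assms(2)[of e] least_eqI[of "\<lambda>y. P y e"] by metis
  moreover have "D (\<lambda>e. P (e 0) (\<lambda>i. e (Suc (Suc i))))"
    using D_reindex[OF assms(1), of "0 ## (\<lambda>i. Suc (Suc i))"] by simp
  ultimately show ?thesis
    by (intro F_graph_D) (simp only:, intro D_rules F_rules assms(1))
qed

lemma F_val: "F s \<Longrightarrow> F t \<Longrightarrow> F (\<lambda>e. val (s e) (t e))"
proof (rule F_app2[of val])
  show "F (\<lambda>e. val (e 0) (e 1))"
    unfolding val_def by (rule F_least; (intro D_rules D_mdvd F_rules F_modu F_psnd F_pfst F_pair)?) blast
qed

lemmas F_rules' = F_rules F_pair F_pfst F_psnd F_modu F_val

lemma function_bounded:
  assumes f: "F (\<lambda>e. f (e 0))"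
  shows "\<exists>B. \<forall>i. i \<prec> b \<longrightarrow> f i \<prec> B"
proof (rule S1_induct[of "\<lambda>b. \<exists>B. \<forall>i. i \<prec> b \<longrightarrow> f i \<prec> B"])
  show "S1 (\<lambda>e. \<exists>B. \<forall>i. i \<prec> e 0 \<longrightarrow> f i \<prec> B)"
    by (intro S1_rules D_rules F_app1[OF f] F_rules)
  fix b assume "\<exists>B. \<forall>i. i \<prec> b \<longrightarrow> f i \<prec> B"
  then obtain B where B: "\<And>i. i \<prec> b \<Longrightarrow> f i \<prec> B" by blast
  have "f i \<prec> B \<oplus> f b \<oplus> \<one>" if "i \<prec> b \<oplus> \<one>" for i
    using that B less_trans_succ less_add_succ(2) unfolding less_succ_iff[of i] l2_le_def[of _ i] by blast
  then show "\<exists>B. \<forall>i. i \<prec> b \<oplus> \<one> \<longrightarrow> f i \<prec> B" by blast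
qed simp

text \<open>By \<open>function_bounded\<close> the graph of \<open>f\<close> below \<open>b\<close>
  is a bounded set of pairs, so \<open>set_code\<close> applies to it.\<close>

lemma val_code:
  assumes f: "F (\<lambda>e. f (e 0))"
  shows "\<exists>c. \<forall>i. i \<prec> b \<longrightarrow> val c i = f i"
proof -
  obtain B where B: "\<And>i. i \<prec> b \<Longrightarrow> f i \<prec> B" using function_bounded[OF f] by blast
  let ?P = "\<lambda>z. \<exists>i. i \<prec> b \<and> z = pair M i (f i)"
  have "D (\<lambda>e. ?P (e 0))" by (intro D_rules F_pair F_app1[OF f] F_rules)
  from set_code[OF this, of "pair M b B \<oplus> \<one>"] obtain u v where uv: "\<zero> \<prec> u" "\<zero> \<prec> v"
    "\<And>x. x \<prec> pair M b B \<oplus> \<one> \<Longrightarrow> modu v x dvd\<^sub>M u \<longleftrightarrow> ?P x" by blast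
  let ?c = "pair M u v"
  have code: "modu v (pair M i y) dvd\<^sub>M u \<longleftrightarrow> y = f i" if "i \<prec> b" "y \<preceq> f i" for i y
  proof -
    have "y \<preceq> B" using that(2) B[OF that(1)] A.less_imp_le A.order_trans by blast
    then have "pair M i y \<prec> pair M b B \<oplus> \<one>"
      unfolding less_succ_iff using that(1) A.less_imp_le by (intro pair_mono)
    from uv(3)[OF this] show ?thesis using that(1) by auto
  qed
  have "val ?c i = f i" if "i \<prec> b" for i
  proof -
    \<comment> \<open>The chain of inequalities keeps \<open>f i\<close> below the default
      \<open>?c\<close>, so the search stops at the coded value.\<close>
    have fi: "modu v (pair M i (f i)) dvd\<^sub>M u" using code[OF that, of "f i"] by simp
    have "f i \<preceq> pair M i (f i)" by (rule pair_ge)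
    also have "\<dots> \<prec> pair M i (f i) \<oplus> \<one>" by simp
    also have "\<dots> \<prec> modu v (pair M i (f i))" by (rule less_modu[OF uv(2)])
    also have "\<dots> \<preceq> u" by (rule dvd_imp_le[OF fi uv(1)])
    also have "u \<preceq> ?c" by (rule pair_ge)
    finally have fc: "f i \<prec> ?c" .
    show ?thesis unfolding val_def pfst_pair psnd_pair
    proof (rule least_eqI)
      show "modu v (pair M i (f i)) dvd\<^sub>M u \<or> f i = ?c" using fi ..
      fix y assume y: "y \<prec> f i"
      then have "y \<noteq> f i" "y \<noteq> ?c" using fc p_irrefl p_trans by blast+
      then show "\<not> (modu v (pair M i y) dvd\<^sub>M u \<or> y = ?c)"
        using code[OF that A.less_imp_le[OF y]] by blast
    qed
  qed
  then show ?thesis by blast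
qed

section \<open>Primitive recursion\<close>

definition iter_code :: "'a \<Rightarrow> ('a \<Rightarrow> 'a \<Rightarrow> 'a) \<Rightarrow> 'a \<Rightarrow> 'a \<Rightarrow> bool" where
  "iter_code a h c n \<longleftrightarrow> val c \<zero> = a \<and> (\<forall>i. i \<prec> n \<longrightarrow> val c (i \<oplus> \<one>) = h i (val c i))"

definition prec :: "'a \<Rightarrow> ('a \<Rightarrow> 'a \<Rightarrow> 'a) \<Rightarrow> 'a \<Rightarrow> 'a" where
  "prec a h n = (THE y. \<exists>c. iter_code a h c n \<and> val c n = y)"

text \<open>Codes do not support appending: the extension by one value is described as a
  \<open>\<Sigma>\<^sub>1\<close> function and coded afresh by \<open>val_code\<close>.\<close>

lemma iter_code_ex:
  assumes h: "F (\<lambda>e. h (e 0) (e 1))"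
  shows "\<exists>c. iter_code a h c n"
proof (rule S1_induct[of "\<lambda>n. \<exists>c. iter_code a h c n"])
  show "S1 (\<lambda>e. \<exists>c. iter_code a h c (e 0))"
    unfolding iter_code_def by (intro S1_rules D_rules F_app2[OF h] F_rules')
  obtain c where "\<forall>i. i \<prec> \<one> \<longrightarrow> val c i = a" using val_code[OF F_const] by blast
  moreover have "\<zero> \<prec> \<one>" by simp
  ultimately have "val c \<zero> = a" by blast
  then show "\<exists>c. iter_code a h c \<zero>" unfolding iter_code_def by auto
next
  fix n assume "\<exists>c. iter_code a h c n"
  then obtain c where c: "iter_code a h c n" by blast
  let ?f = "\<lambda>i. if i = n \<oplus> \<one> then h n (val c n) else val c i"
  have "F (\<lambda>e. ?f (e 0))" by (intro F_if D_rules F_app2[OF h] F_rules')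
  \<comment> \<open>Positions up to n + 1 must be correct, hence the strict bound n + 2.\<close>
  from val_code[of ?f, OF this, of "n \<oplus> \<one> \<oplus> \<one>"]
  obtain c' where c': "\<And>i. i \<prec> n \<oplus> \<one> \<oplus> \<one> \<Longrightarrow> val c' i = ?f i" by blast
  have "val c' \<zero> = a" using c c'[of \<zero>] ax_succ_nz[of n]
    by (simp add: iter_code_def less_succ_iff)
  moreover have "val c' (i \<oplus> \<one>) = h i (val c' i)" if "i \<prec> n \<oplus> \<one>" for i
  proof -
    have i: "i \<oplus> \<one> \<prec> n \<oplus> \<one> \<oplus> \<one>" "i \<prec> n \<oplus> \<one> \<oplus> \<one>"
      using that ax_less_succ[of i "n \<oplus> \<one>"] by simp_all
    have "val c' (i \<oplus> \<one>) = ?f (i \<oplus> \<one>)" by (rule c'[OF i(1)])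
    moreover have "val c' i = ?f i" by (rule c'[OF i(2)])
    moreover have "i \<noteq> n \<oplus> \<one>" using that p_irrefl by blast
    ultimately show ?thesis using c that by (auto simp: iter_code_def ax_less_succ)
  qed
  ultimately show "\<exists>c. iter_code a h c (n \<oplus> \<one>)" unfolding iter_code_def by blast
qed

lemma iter_code_unique:
  assumes h: "F (\<lambda>e. h (e 0) (e 1))" and c: "iter_code a h c n" and c': "iter_code a h c' m"
    and "i \<preceq> n" "i \<preceq> m"
  shows "val c i = val c' i"
proof -
  have "i \<preceq> n \<and> i \<preceq> m \<longrightarrow> val c i = val c' i"
  proof (rule S1_induct[of "\<lambda>i. i \<preceq> n \<and> i \<preceq> m \<longrightarrow> val c i = val c' i"])
    show "S1 (\<lambda>e. e 0 \<preceq> n \<and> e 0 \<preceq> m \<longrightarrow> val c (e 0) = val c' (e 0))"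
      by (intro S1_rules D_rules F_rules')
    show "\<zero> \<preceq> n \<and> \<zero> \<preceq> m \<longrightarrow> val c \<zero> = val c' \<zero>" using c c' by (simp add: iter_code_def)
    fix i assume "i \<preceq> n \<and> i \<preceq> m \<longrightarrow> val c i = val c' i"
    then show "i \<oplus> \<one> \<preceq> n \<and> i \<oplus> \<one> \<preceq> m \<longrightarrow> val c (i \<oplus> \<one>) = val c' (i \<oplus> \<one>)"
      using c c' A.less_imp_le unfolding iter_code_def succ_le_iff by metis
  qed
  then show ?thesis using assms(4,5) by blast
qed

lemma prec_eq:
  assumes h: "F (\<lambda>e. h (e 0) (e 1))" and c: "iter_code a h c n"
  shows "prec a h n = val c n"
  unfolding prec_def
proof (rule the_equality)
  show "\<exists>c'. iter_code a h c' n \<and> val c' n = val c n" using c by blast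
  fix y assume "\<exists>c'. iter_code a h c' n \<and> val c' n = y"
  then show "y = val c n" using iter_code_unique[OF h _ c, of _ n n] by auto
qed

lemma prec_0:
  assumes h: "F (\<lambda>e. h (e 0) (e 1))" shows "prec a h \<zero> = a"
proof -
  obtain c where c: "iter_code a h c \<zero>" using iter_code_ex[OF h] by blast
  then show ?thesis using prec_eq[OF h c] by (simp add: iter_code_def)
qed

lemma prec_succ:
  assumes h: "F (\<lambda>e. h (e 0) (e 1))" shows "prec a h (n \<oplus> \<one>) = h n (prec a h n)"
proof -
  obtain c where c: "iter_code a h c (n \<oplus> \<one>)" using iter_code_ex[OF h] by blast
  moreover then have c': "iter_code a h c n" by (auto simp: iter_code_def ax_less_succ)
  ultimately show ?thesis using prec_eq[OF h c] prec_eq[OF h c'] by (simp add: iter_code_def)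
qed

lemma S1_subst:
  assumes "S1 P" "\<And>i. trm d (s i)" shows "S1 (\<lambda>e. P (\<lambda>i. s i e))"
proof -
  obtain Q where Q: "Dl0 Q" "\<And>e. P e \<longleftrightarrow> (\<exists>y. Q (y ## e))" using assms(1) by (auto simp: S1_def)
  let ?s = "case_nat (\<lambda>e. e 0) (\<lambda>i e. s i (\<lambda>j. e (Suc j)))"
  have "trm d (?s i)" for i
    using trm_subst[OF assms(2), where s = "\<lambda>j e. e (Suc j)"] by (cases i) (auto intro: trm.intros)
  from Dl0_subst[OF Q(1), where s = ?s, OF this] have "Dl0 (\<lambda>e. Q (\<lambda>i. ?s i e))" .
  moreover have "(\<lambda>i. ?s i e) = e 0 ## (\<lambda>i. s i (\<lambda>j. e (Suc j)))" for e
    by (rule ext) (simp split: nat.splits)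
  ultimately have "Dl0 (\<lambda>e. Q (e 0 ## (\<lambda>i. s i (\<lambda>j. e (Suc j)))))" by simp
  then show ?thesis unfolding Q(2) by (rule S1_ex_Dl0)
qed

text \<open>The facts about recursion concern step functions of two variables; any further
  dependence on the environment is absorbed by turning its tail into constants.\<close>

lemma F_fix_tail:
  assumes "F (\<lambda>e. h (e 0) (e 1) (\<lambda>i. e (Suc (Suc i))))"
  shows "F (\<lambda>f. h (f 0) (f 1) e)"
proof -
  let ?s = "case_nat (\<lambda>f. f 0) (case_nat (\<lambda>f. f (Suc 0)) (case_nat (\<lambda>f. f (Suc (Suc 0))) (\<lambda>i f. e i)))"
  have "trm e (?s i)" for i by (auto intro: trm.intros split: nat.splits)
  from S1_subst[OF assms[unfolded F_def], where s = ?s, OF this] show ?thesis by (simp add: F_def)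
qed

lemma F_prec:
  assumes "F a" "F (\<lambda>e. h (e 0) (e 1) (\<lambda>i. e (Suc (Suc i))))" "F n"
  shows "F (\<lambda>e. prec (a e) (\<lambda>i y. h i y e) (n e))"
proof -
  have h: "F (\<lambda>f. h (f 0) (f 1) e)" for e by (rule F_fix_tail[OF assms(2)])
  have eq: "y = prec (a e) (\<lambda>i y. h i y e) n \<longleftrightarrow>
      (\<exists>c. iter_code (a e) (\<lambda>i y. h i y e) c n \<and> y = val c n)" for y e n
    using iter_code_ex[OF h] prec_eq[OF h] by metis
  \<comment> \<open>Inside both binders of the graph below, variable 0 is the step, 1 the code, 2
    the value and 3 the length, so the environment of \<open>h\<close> begins at 4.\<close>
  have h1: "F (\<lambda>e. h (e 0) (val (e 1) (e 0)) (\<lambda>i. e (Suc (Suc (Suc (Suc i))))))"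
  proof -
    have "F (\<lambda>e. h (e 1) (e 0) (\<lambda>i. e (Suc (Suc (Suc (Suc (Suc i)))))))"
      using F_reindex[OF assms(2), of "1 ## (0 ## (\<lambda>i. Suc (Suc (Suc (Suc (Suc i))))))"] by simp
    then show ?thesis
      using F_sub[OF F_val[OF F_var[of 1] F_var[of 0]], of "\<lambda>x e. h (e 0) x (\<lambda>i. e (Suc (Suc (Suc (Suc i)))))"]
      by simp
  qed
  have "F (\<lambda>e. prec (a (\<lambda>i. e (Suc i))) (\<lambda>i y. h i y (\<lambda>i. e (Suc i))) (e 0))"
  proof (rule F_I)
    have "S1 (\<lambda>e. \<exists>c. iter_code (a (\<lambda>i. e (Suc (Suc i)))) (\<lambda>i y. h i y (\<lambda>i. e (Suc (Suc i)))) c (e 1) \<and>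
        e 0 = val c (e 1))"
      unfolding iter_code_def
      using F_reindex[OF assms(1), of "\<lambda>i. Suc (Suc (Suc i))"] h1
      by (intro S1_rules D_rules F_val F_var F_add F_const) simp_all
    then show "S1 (\<lambda>e. e 0 = prec (a (\<lambda>i. e (Suc (Suc i)))) (\<lambda>i y. h i y (\<lambda>i. e (Suc (Suc i)))) (e (Suc 0)))"
      by (simp add: eq)
  qed
  then show ?thesis by (rule F_sub[OF assms(3)])
qed

section \<open>Counting\<close>

text \<open>Sizes are measured by counting below a bound, a \<open>\<Sigma>\<^sub>1\<close> function
  open to induction; the bijections of \<open>has_card\<close> are converted to and from
  counts.\<close>

definition cnt :: "('a \<Rightarrow> bool) \<Rightarrow> 'a \<Rightarrow> 'a" where
  "cnt P x = prec \<zero> (\<lambda>i y. if P i then y \<oplus> \<one> else y) x"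

lemma F_cnt:
  assumes "D (\<lambda>e. P (e 0) (\<lambda>i. e (Suc i)))" "F t"
  shows "F (\<lambda>e. cnt (\<lambda>x. P x e) (t e))"
  unfolding cnt_def
proof (rule F_prec[OF F_const _ assms(2)])
  show "F (\<lambda>e. if P (e 0) (\<lambda>i. e (Suc (Suc i))) then e 1 \<oplus> \<one> else e 1)"
    using D_reindex[OF assms(1), of "0 ## (\<lambda>i. Suc (Suc i))"]
    by (intro F_if F_rules) simp
qed

lemma cnt_0 [simp]:
  assumes P: "D (\<lambda>e. P (e 0))" shows "cnt P \<zero> = \<zero>"
  unfolding cnt_def by (rule prec_0) (intro F_rules D_app1[OF P])

lemma cnt_succ:
  assumes P: "D (\<lambda>e. P (e 0))" shows "cnt P (x \<oplus> \<one>) = (if P x then cnt P x \<oplus> \<one> else cnt P x)"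
  unfolding cnt_def by (subst prec_succ) (intro F_rules D_app1[OF P], simp)

lemma cnt_mono:
  assumes P: "D (\<lambda>e. P (e 0))" and Q: "D (\<lambda>e. Q (e 0))" and imp: "\<And>i. i \<prec> x \<Longrightarrow> P i \<Longrightarrow> Q i"
  shows "cnt P x \<preceq> cnt Q x"
proof -
  have "x' \<preceq> x \<longrightarrow> cnt P x' \<preceq> cnt Q x'" for x'
  proof (rule S1_induct[of "\<lambda>x'. x' \<preceq> x \<longrightarrow> cnt P x' \<preceq> cnt Q x'"])
    show "S1 (\<lambda>e. e 0 \<preceq> x \<longrightarrow> cnt P (e 0) \<preceq> cnt Q (e 0))"
      by (intro S1_rules D_rules F_cnt D_app1[OF P] D_app1[OF Q] F_rules)
    fix y assume "y \<preceq> x \<longrightarrow> cnt P y \<preceq> cnt Q y"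
    then show "y \<oplus> \<one> \<preceq> x \<longrightarrow> cnt P (y \<oplus> \<one>) \<preceq> cnt Q (y \<oplus> \<one>)"
      using imp[of y] A.less_imp_le[of y x]
      by (auto simp: cnt_succ[OF P] cnt_succ[OF Q] succ_le_iff intro: A.order_trans)
  qed (simp add: cnt_0[OF P] cnt_0[OF Q])
  then show ?thesis by simp
qed

lemma cnt_add_le:
  assumes P: "D (\<lambda>e. P (e 0))" shows "cnt P x \<preceq> cnt P (x \<oplus> d) \<and> cnt P (x \<oplus> d) \<preceq> cnt P x \<oplus> d"
proof (rule S1_induct[of "\<lambda>d. cnt P x \<preceq> cnt P (x \<oplus> d) \<and> cnt P (x \<oplus> d) \<preceq> cnt P x \<oplus> d"])
  show "S1 (\<lambda>e. cnt P x \<preceq> cnt P (x \<oplus> e 0) \<and> cnt P (x \<oplus> e 0) \<preceq> cnt P x \<oplus> e 0)"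
    by (intro S1_rules D_rules F_cnt D_app1[OF P] F_rules)
  fix d assume IH: "cnt P x \<preceq> cnt P (x \<oplus> d) \<and> cnt P (x \<oplus> d) \<preceq> cnt P x \<oplus> d"
  have "cnt P (x \<oplus> d) \<preceq> cnt P (x \<oplus> d \<oplus> \<one>)" "cnt P (x \<oplus> d \<oplus> \<one>) \<preceq> cnt P (x \<oplus> d) \<oplus> \<one>"
    by (simp_all add: cnt_succ[OF P])
  moreover have "cnt P (x \<oplus> d) \<oplus> \<one> \<preceq> cnt P x \<oplus> d \<oplus> \<one>" using IH by simp
  ultimately show "cnt P x \<preceq> cnt P (x \<oplus> (d \<oplus> \<one>)) \<and> cnt P (x \<oplus> (d \<oplus> \<one>)) \<preceq> cnt P x \<oplus> (d \<oplus> \<one>)"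
    using IH unfolding A.add.assoc[symmetric] by (meson A.order_trans)
qed simp

lemma cnt_mono_arg:
  assumes P: "D (\<lambda>e. P (e 0))" and "x \<preceq> y" shows "cnt P x \<preceq> cnt P y"
proof -
  obtain d where "y = x \<oplus> d" using assms(2) p_le_iff by blast
  then show ?thesis using cnt_add_le[OF P, of x d] by simp
qed

lemma cnt_le:
  assumes P: "D (\<lambda>e. P (e 0))" shows "cnt P x \<preceq> x"
  using cnt_add_le[OF P, of \<zero> x] by (simp add: cnt_0[OF P])

lemma cnt_union:
  assumes P: "D (\<lambda>e. P (e 0))" and Q: "D (\<lambda>e. Q (e 0))"
  shows "cnt (\<lambda>i. P i \<or> Q i) x \<preceq> cnt P x \<oplus> cnt Q x"
proof (rule S1_induct[of "\<lambda>x. cnt (\<lambda>i. P i \<or> Q i) x \<preceq> cnt P x \<oplus> cnt Q x"])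
  have PQ: "D (\<lambda>e. P (e 0) \<or> Q (e 0))" by (intro D_disj P Q)
  show "S1 (\<lambda>e. cnt (\<lambda>i. P i \<or> Q i) (e 0) \<preceq> cnt P (e 0) \<oplus> cnt Q (e 0))"
    by (intro S1_rules D_rules F_add F_cnt D_app1[OF P] D_app1[OF Q] F_rules)
  show "cnt (\<lambda>i. P i \<or> Q i) \<zero> \<preceq> cnt P \<zero> \<oplus> cnt Q \<zero>" by (simp add: cnt_0[OF PQ])
  fix y assume IH: "cnt (\<lambda>i. P i \<or> Q i) y \<preceq> cnt P y \<oplus> cnt Q y"
  have "cnt (\<lambda>i. P i \<or> Q i) y \<oplus> \<one> \<preceq> cnt P y \<oplus> cnt Q y \<oplus> \<one>" using IH by simp
  moreover have "\<dots> \<preceq> cnt P y \<oplus> \<one> \<oplus> (cnt Q y \<oplus> \<one>)" "cnt P y \<oplus> cnt Q y \<oplus> \<one> = cnt P y \<oplus> (cnt Q y \<oplus> \<one>)"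
    "cnt P y \<oplus> cnt Q y \<oplus> \<one> = cnt P y \<oplus> \<one> \<oplus> cnt Q y"
    by (simp_all add: ac_simps)
  ultimately show "cnt (\<lambda>i. P i \<or> Q i) (y \<oplus> \<one>) \<preceq> cnt P (y \<oplus> \<one>) \<oplus> cnt Q (y \<oplus> \<one>)"
    using IH unfolding cnt_succ[OF P] cnt_succ[OF Q] cnt_succ[OF PQ]
    by (auto intro: A.order_trans)
qed

lemma cnt_insert:
  assumes P: "D (\<lambda>e. P (e 0))" and "\<not> P a"
  shows "cnt (\<lambda>i. P i \<or> i = a) x = (if a \<prec> x then cnt P x \<oplus> \<one> else cnt P x)"
proof (rule S1_induct[of "\<lambda>x. cnt (\<lambda>i. P i \<or> i = a) x = (if a \<prec> x then cnt P x \<oplus> \<one> else cnt P x)"])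
  have PQ: "D (\<lambda>e. P (e 0) \<or> e 0 = a)" by (intro D_rules F_rules P)
  show "S1 (\<lambda>e. cnt (\<lambda>i. P i \<or> i = a) (e 0) = (if a \<prec> e 0 then cnt P (e 0) \<oplus> \<one> else cnt P (e 0)))"
    by (intro S1_rules D_rules F_add F_if F_cnt D_app1[OF P] F_rules)
  show "cnt (\<lambda>i. P i \<or> i = a) \<zero> = (if a \<prec> \<zero> then cnt P \<zero> \<oplus> \<one> else cnt P \<zero>)"
    by (simp add: cnt_0[OF PQ] cnt_0[OF P])
  fix y assume IH: "cnt (\<lambda>i. P i \<or> i = a) y = (if a \<prec> y then cnt P y \<oplus> \<one> else cnt P y)"
  then show "cnt (\<lambda>i. P i \<or> i = a) (y \<oplus> \<one>) = (if a \<prec> y \<oplus> \<one> then cnt P (y \<oplus> \<one>) \<oplus> \<one> else cnt P (y \<oplus> \<one>))"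
    unfolding cnt_succ[OF P] cnt_succ[OF PQ] using assms(2) p_irrefl by (cases "y = a") (simp_all add: ax_less_succ)
qed

text \<open>A counting function grows by at most one per step, and it grows only at members of
  \<open>P\<close>; so each intermediate value is left at such a member.\<close>

lemma cnt_attain:
  assumes P: "D (\<lambda>e. P (e 0))" and "y \<prec> cnt P x"
  shows "\<exists>i. i \<prec> x \<and> P i \<and> cnt P i = y"
proof -
  have "y \<prec> cnt P x \<longrightarrow> (\<exists>i. i \<prec> x \<and> (P i \<and> cnt P i = y))"
  proof (rule S1_induct[of "\<lambda>x. y \<prec> cnt P x \<longrightarrow> (\<exists>i. i \<prec> x \<and> (P i \<and> cnt P i = y))"])
    show "S1 (\<lambda>e. y \<prec> cnt P (e 0) \<longrightarrow> (\<exists>i. i \<prec> e 0 \<and> (P i \<and> cnt P i = y)))"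
      by (intro S1_rules D_rules F_cnt D_app1[OF P] F_rules)
  qed (auto simp: cnt_0[OF P] cnt_succ[OF P] ax_less_succ split: if_splits)
  then show ?thesis using assms(2) by blast
qed

lemma cnt_reach:
  assumes P: "D (\<lambda>e. P (e 0))" and "y \<preceq> cnt P x"
  shows "\<exists>z. z \<preceq> x \<and> cnt P z = y"
  using cnt_attain[OF P, of y x] assms(2) A.less_imp_le unfolding l2_le_def[of _ y] by blast

text \<open>The number \<open>C\<close> of classes may be nonstandard, so the classes are joined one
  by one under \<open>\<Sigma>\<^sub>1\<close> induction, each contributing at most
  \<open>N\<close>.\<close>

lemma cnt_pigeonhole:
  assumes P: "D (\<lambda>e. P (e 0))" and G: "F (\<lambda>e. G (e 0))"
    and "\<And>i. i \<prec> x \<Longrightarrow> P i \<Longrightarrow> G i \<prec> C" and "C \<otimes> N \<prec> cnt P x"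
  shows "\<exists>k. k \<prec> C \<and> N \<prec> cnt (\<lambda>i. P i \<and> G i = k) x"
proof (rule ccontr)
  assume "\<not> ?thesis"
  then have small: "\<And>k. k \<prec> C \<Longrightarrow> cnt (\<lambda>i. P i \<and> G i = k) x \<preceq> N" using A.not_less by blast
  have Dk: "D (\<lambda>e. P (e 0) \<and> G (e 0) \<prec> k)" "D (\<lambda>e. P (e 0) \<and> G (e 0) = k)" for k
    by (intro D_rules P G F_rules)+
  have "C' \<preceq> C \<longrightarrow> cnt (\<lambda>i. P i \<and> G i \<prec> C') x \<preceq> C' \<otimes> N" for C'
  proof (rule S1_induct[of "\<lambda>C'. C' \<preceq> C \<longrightarrow> cnt (\<lambda>i. P i \<and> G i \<prec> C') x \<preceq> C' \<otimes> N"])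
    show "S1 (\<lambda>e. e 0 \<preceq> C \<longrightarrow> cnt (\<lambda>i. P i \<and> G i \<prec> e 0) x \<preceq> e 0 \<otimes> N)"
      by (intro S1_rules D_rules F_mul F_cnt D_app1[OF P] F_app1[OF G] F_rules)
    have "cnt (\<lambda>i. P i \<and> G i \<prec> \<zero>) x \<preceq> cnt (\<lambda>i. False) x"
      by (rule cnt_mono[OF Dk(1)]) (auto intro: D_bool)
    moreover have "cnt (\<lambda>i. False) x = \<zero>"
    proof (rule S1_induct[of "\<lambda>x. cnt (\<lambda>i. False) x = \<zero>"])
      show "S1 (\<lambda>e. cnt (\<lambda>i. False) (e 0) = \<zero>)" by (intro S1_rules D_rules F_cnt F_rules)
    qed (simp_all add: cnt_succ[of "\<lambda>_. False"] cnt_0[of "\<lambda>_. False"] D_bool)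
    ultimately show "\<zero> \<preceq> C \<longrightarrow> cnt (\<lambda>i. P i \<and> G i \<prec> \<zero>) x \<preceq> \<zero> \<otimes> N" by simp
    fix k assume IH: "k \<preceq> C \<longrightarrow> cnt (\<lambda>i. P i \<and> G i \<prec> k) x \<preceq> k \<otimes> N"
    show "k \<oplus> \<one> \<preceq> C \<longrightarrow> cnt (\<lambda>i. P i \<and> G i \<prec> k \<oplus> \<one>) x \<preceq> (k \<oplus> \<one>) \<otimes> N"
    proof
      assume "k \<oplus> \<one> \<preceq> C"
      then have k: "k \<prec> C" by (simp add: succ_le_iff)
      have "(\<lambda>i. P i \<and> G i \<prec> k \<oplus> \<one>) = (\<lambda>i. (P i \<and> G i \<prec> k) \<or> (P i \<and> G i = k))"
        by (auto simp: ax_less_succ)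
      then have "cnt (\<lambda>i. P i \<and> G i \<prec> k \<oplus> \<one>) x \<preceq> cnt (\<lambda>i. P i \<and> G i \<prec> k) x \<oplus> cnt (\<lambda>i. P i \<and> G i = k) x"
        using cnt_union[OF Dk(1)[of k] Dk(2)[of k]] by simp
      also have "\<dots> \<preceq> k \<otimes> N \<oplus> N" using IH k small[OF k] A.less_imp_le by (intro A.add_mono) blast+
      also have "\<dots> = (k \<oplus> \<one>) \<otimes> N" by (simp add: algebra_simps)
      finally show "cnt (\<lambda>i. P i \<and> G i \<prec> k \<oplus> \<one>) x \<preceq> (k \<oplus> \<one>) \<otimes> N" .
    qed
  qed
  then have "cnt (\<lambda>i. P i \<and> G i \<prec> C) x \<preceq> C \<otimes> N" by simp
  moreover have "cnt P x \<preceq> cnt (\<lambda>i. P i \<and> G i \<prec> C) x" by (rule cnt_mono[OF P Dk(1)]) (use assms(3) in blast)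
  ultimately show False using assms(4) A.not_less A.order_trans by blast
qed

text \<open>Connects bijections with counting: values enter the image one by one, and injectivity
  makes each of them new.\<close>

lemma cnt_image:
  assumes h: "F (\<lambda>e. h (e 0))" and inj: "\<And>i j. i \<prec> r \<Longrightarrow> j \<prec> r \<Longrightarrow> h i = h j \<Longrightarrow> i = j"
    and b: "\<And>i. i \<prec> r \<Longrightarrow> h i \<prec> b"
  shows "cnt (\<lambda>y. \<exists>k. k \<prec> r \<and> y = h k) b = r"
proof -
  have "q \<preceq> r \<longrightarrow> cnt (\<lambda>y. \<exists>k. k \<prec> q \<and> y = h k) b = q" for q
  proof (rule S1_induct[of "\<lambda>q. q \<preceq> r \<longrightarrow> cnt (\<lambda>y. \<exists>k. k \<prec> q \<and> y = h k) b = q"])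
    show "S1 (\<lambda>e. e 0 \<preceq> r \<longrightarrow> cnt (\<lambda>y. \<exists>k. k \<prec> e 0 \<and> y = h k) b = e 0)"
      by (intro S1_rules D_rules F_cnt F_app1[OF h] F_rules)
    have "cnt (\<lambda>y. False) b \<preceq> \<zero>"
    proof (rule ccontr)
      assume "\<not> cnt (\<lambda>y. False) b \<preceq> \<zero>"
      then show False using cnt_attain[of "\<lambda>_. False" \<zero> b] D_bool A.not_less by blast
    qed
    then show "\<zero> \<preceq> r \<longrightarrow> cnt (\<lambda>y. \<exists>k. k \<prec> \<zero> \<and> y = h k) b = \<zero>" using A.order_antisym by simp
    fix q assume IH: "q \<preceq> r \<longrightarrow> cnt (\<lambda>y. \<exists>k. k \<prec> q \<and> y = h k) b = q"
    have Dq: "D (\<lambda>e. \<exists>k. k \<prec> q \<and> e 0 = h k)" by (intro D_rules F_app1[OF h] F_rules)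
    show "q \<oplus> \<one> \<preceq> r \<longrightarrow> cnt (\<lambda>y. \<exists>k. k \<prec> q \<oplus> \<one> \<and> y = h k) b = q \<oplus> \<one>"
    proof
      assume "q \<oplus> \<one> \<preceq> r"
      then have q: "q \<prec> r" by (simp add: succ_le_iff)
      have "(\<lambda>y. \<exists>k. k \<prec> q \<oplus> \<one> \<and> y = h k) = (\<lambda>y. (\<exists>k. k \<prec> q \<and> y = h k) \<or> y = h q)"
        by (auto simp: ax_less_succ)
      moreover have "\<not> (\<exists>k. k \<prec> q \<and> h q = h k)"
        using inj q p_irrefl p_trans by metis
      ultimately show "cnt (\<lambda>y. \<exists>k. k \<prec> q \<oplus> \<one> \<and> y = h k) b = q \<oplus> \<one>"
        using cnt_insert[OF Dq, of "h q" b] IH b[OF q] q A.less_imp_le by auto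
    qed
  qed
  then show ?thesis by simp
qed

section \<open>Tuples of standard length\<close>

text \<open>The length is a standard number, so such a list is just \<open>n\<close> functions, and
  closure properties follow by external induction, with heads split off by
  \<open>FL_Suc_cases\<close>.\<close>

definition FL :: "nat \<Rightarrow> ((nat \<Rightarrow> 'a) \<Rightarrow> 'a list) \<Rightarrow> bool" where
  "FL n L \<longleftrightarrow> (\<forall>e. length (L e) = n) \<and> (\<forall>i<n. F (\<lambda>e. L e ! i))"

lemma FL_Nil: "FL 0 (\<lambda>e. [])"
  by (simp add: FL_def)

lemma FL_Cons:
  assumes "F t" "FL n L" shows "FL (Suc n) (\<lambda>e. t e # L e)"
proof -
  have "F (\<lambda>e. (t e # L e) ! i)" if "i < Suc n" for i
    using assms that by (cases i) (auto simp: FL_def)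
  then show ?thesis using assms(2) by (simp add: FL_def)
qed

lemma FL_Suc_cases:
  assumes "FL (Suc n) L"
  obtains t K where "F t" "FL n K" "L = (\<lambda>e. t e # K e)"
proof
  show "F (\<lambda>e. L e ! 0)" using assms by (simp add: FL_def)
  have "L e \<noteq> []" for e using assms unfolding FL_def by (metis list.size(3) nat.distinct(1))
  then show "L = (\<lambda>e. L e ! 0 # tl (L e))" by (auto simp: hd_conv_nth[symmetric])
  have "F (\<lambda>e. tl (L e) ! i)" if "i < n" for i
  proof -
    have "tl (L e) ! i = L e ! Suc i" for e using assms that by (simp add: FL_def nth_tl)
    then show ?thesis using assms that by (simp add: FL_def)
  qed
  then show "FL n (\<lambda>e. tl (L e))" using assms by (simp add: FL_def)
qed

lemma FL_0_cases: "FL 0 L \<Longrightarrow> L = (\<lambda>e. [])"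
  by (auto simp: FL_def)

lemma FL_append: "FL n L \<Longrightarrow> FL m K \<Longrightarrow> FL (n + m) (\<lambda>e. L e @ K e)"
proof (induction n arbitrary: L)
  case 0
  then show ?case using FL_0_cases[of L] by simp
next
  case (Suc n)
  obtain t L' where L: "F t" "FL n L'" "L = (\<lambda>e. t e # L' e)" using FL_Suc_cases[OF Suc.prems(1)] .
  then show ?case using FL_Cons[OF L(1) Suc.IH[OF L(2) Suc.prems(2)]] by simp
qed

lemma FL_map:
  assumes g: "F (\<lambda>e. g (e 0) (\<lambda>i. e (Suc i)))"
  shows "FL n L \<Longrightarrow> FL n (\<lambda>e. map (\<lambda>x. g x e) (L e))"
proof (induction n arbitrary: L)
  case 0
  then show ?case using FL_0_cases[of L] FL_Nil by simp
next
  case (Suc n)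
  obtain t L' where L: "F t" "FL n L'" "L = (\<lambda>e. t e # L' e)" using FL_Suc_cases[OF Suc.prems(1)] .
  then show ?case using FL_Cons[OF F_sub[OF L(1) g] Suc.IH[OF L(2)]] by simp
qed

lemma FL_replicate: "F t \<Longrightarrow> FL n (\<lambda>e. replicate n (t e))"
  by (induction n) (auto intro: FL_Nil FL_Cons)

lemma tuple_Cons: "xs \<noteq> [] \<Longrightarrow> tuple M (x # xs) = pair M x (tuple M xs)"
  by (cases xs) simp_all

lemma F_tuple: "FL n L \<Longrightarrow> F (\<lambda>e. tuple M (L e))"
proof (induction n arbitrary: L)
  case 0
  then show ?case using FL_0_cases[of L] F_const by simp
next
  case (Suc n)
  obtain t L' where L: "F t" "FL n L'" "L = (\<lambda>e. t e # L' e)" using FL_Suc_cases[OF Suc.prems(1)] .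
  show ?case
  proof (cases n)
    case 0
    then show ?thesis using L FL_0_cases[of L'] by simp
  next
    case (Suc m)
    then have "L' e \<noteq> []" for e using L(2) unfolding FL_def by (metis list.size(3) nat.distinct(1))
    then show ?thesis using F_pair[OF L(1) Suc.IH[OF L(2)]] L(3) by (simp add: tuple_Cons)
  qed
qed

lemma D_list_all:
  assumes P: "D (\<lambda>e. P (e 0) (\<lambda>i. e (Suc i)))"
  shows "FL n L \<Longrightarrow> D (\<lambda>e. \<forall>x\<in>set (L e). P x e)"
proof (induction n arbitrary: L)
  case 0
  then show ?case using FL_0_cases[of L] D_bool by simp
next
  case (Suc n)
  obtain t L' where L: "F t" "FL n L'" "L = (\<lambda>e. t e # L' e)" using FL_Suc_cases[OF Suc.prems(1)] .
  then show ?case using D_conj[OF D_sub[OF L(1) P] Suc.IH[OF L(2)]] by simp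
qed

lemma D_sorted: "FL n L \<Longrightarrow> D (\<lambda>e. sorted_wrt (l2_less M) (L e))"
proof (induction n arbitrary: L)
  case 0
  then show ?case using FL_0_cases[of L] D_bool by simp
next
  case (Suc n)
  obtain t L' where L: "F t" "FL n L'" "L = (\<lambda>e. t e # L' e)" using FL_Suc_cases[OF Suc.prems(1)] .
  have "D (\<lambda>e. \<forall>y\<in>set (L' e). t e \<prec> y)"
    by (rule D_list_all[OF _ L(2)]) (intro D_less F_var F_reindex[OF L(1)])
  then show ?case using D_conj[OF _ Suc.IH[OF L(2)]] L(3) by simp
qed

text \<open>Iterated pairing does not record a length, so decoding takes it as an argument. Numbers
  that code no such list are nevertheless decoded to some list.\<close>

fun untuple :: "nat \<Rightarrow> 'a \<Rightarrow> 'a list" where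
  "untuple 0 z = []"
| "untuple (Suc 0) z = [z]"
| "untuple (Suc (Suc n)) z = pfst z # untuple (Suc n) (psnd z)"

lemma length_untuple [simp]: "length (untuple n z) = n"
  by (induction n z rule: untuple.induct) simp_all

lemma untuple_tuple: "untuple (length xs) (tuple M xs) = xs"
  by (induction xs rule: induct_list012) simp_all

lemma untuple_tuple': "length xs = n \<Longrightarrow> untuple n (tuple M xs) = xs"
  using untuple_tuple by blast

lemma FL_untuple: "F t \<Longrightarrow> FL n (\<lambda>e. untuple n (t e))"
proof (induction n arbitrary: t rule: less_induct)
  case (less n)
  consider "n = 0" | "n = Suc 0" | m where "n = Suc (Suc m)" by (metis not0_implies_Suc)
  then show ?case
  proof cases
    case 2
    then show ?thesis using FL_Cons[OF less.prems FL_Nil] by simp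
  next
    case 3
    then show ?thesis using FL_Cons[OF F_pfst[OF less.prems] less.IH[OF _ F_psnd[OF less.prems], of "Suc m"]] by simp
  qed (simp add: FL_Nil)
qed

lemma tuple_ge: "x \<in> set xs \<Longrightarrow> x \<preceq> tuple M xs"
proof (induction xs rule: induct_list012)
  case (3 y z zs)
  then consider "x = y" | "x \<preceq> tuple M (z # zs)" by auto
  then show ?case
    by cases (simp_all add: pair_ge A.order_trans[OF _ pair_ge(2)])
qed simp_all

lemma tuple_le_replicate: "(\<And>y. y \<in> set xs \<Longrightarrow> y \<preceq> x) \<Longrightarrow> tuple M xs \<preceq> tuple M (replicate (length xs) x)"
proof (induction xs rule: induct_list012)
  case (3 y z zs)
  then show ?case using pair_mono[of y x "tuple M (z # zs)"] by simp
qed simp_all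

text \<open>Inspecting the decoded list replaces the quantifier over lists, which makes membership
  \<open>\<Delta>\<^sub>1\<close>; re-encoding rules out numbers that code no list of length
  \<open>n\<close>.\<close>

lemma mem_subsets_of_iff:
  "z \<in> subsets_of M n A \<longleftrightarrow>
    tuple M (untuple n z) = z \<and> (\<forall>x\<in>set (untuple n z). x \<in> A) \<and> sorted_wrt (l2_less M) (untuple n z)"
proof
  assume "z \<in> subsets_of M n A"
  then show "tuple M (untuple n z) = z \<and> (\<forall>x\<in>set (untuple n z). x \<in> A) \<and> sorted_wrt (l2_less M) (untuple n z)"
    by (auto simp: subsets_of_def untuple_tuple)
next
  assume "tuple M (untuple n z) = z \<and> (\<forall>x\<in>set (untuple n z). x \<in> A) \<and> sorted_wrt (l2_less M) (untuple n z)"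
  then show "z \<in> subsets_of M n A" unfolding subsets_of_def
    by (intro CollectI exI[of _ "untuple n z"]) auto
qed

lemma D_subsets_of:
  assumes "A \<in> l2_sets M" "F t" shows "D (\<lambda>e. t e \<in> subsets_of M n A)"
  unfolding mem_subsets_of_iff
  by (intro D_conj D_eq F_tuple[OF FL_untuple] D_list_all[OF _ FL_untuple] D_sorted[OF FL_untuple] D_mem F_var assms)

lemma comprehension: "D (\<lambda>e. P (e 0)) \<Longrightarrow> {x. P x} \<in> l2_sets M"
  by (intro S1_comprehension S1_D S1_not_D)

section \<open>Functions and cardinalities of the structure\<close>

text \<open>Graphs in the structure are traded for functions of the calculus. The value
  \<open>\<zero>\<close> outside \<open>X\<close> makes the function total, and this is where
  definability of \<open>X\<close> enters.\<close>

lemma is_fun_obtain: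
  assumes f: "is_fun M X B f" and X: "D (\<lambda>e. e 0 \<in> X)"
  obtains G where "F (\<lambda>e. G (e 0))" "\<And>z. z \<in> X \<Longrightarrow> G z \<in> B"
    "\<And>z y. pair M z y \<in> f \<longleftrightarrow> z \<in> X \<and> y = G z"
proof -
  have fX: "f \<in> l2_sets M" "f \<subseteq> {pair M x y | x y. x \<in> X \<and> y \<in> B}"
    and ex: "\<And>x. x \<in> X \<Longrightarrow> \<exists>!y. pair M x y \<in> f"
    using f by (auto simp: is_fun_def)
  have sub: "pair M z y \<in> f \<Longrightarrow> z \<in> X \<and> y \<in> B" for z y using fX(2) by auto
  define G where "G z = (if z \<in> X then THE y. pair M z y \<in> f else \<zero>)" for z
  have G: "pair M z (G z) \<in> f" if "z \<in> X" for z
    using theI'[OF ex[OF that]] that by (simp add: G_def)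
  have eq: "y = G z \<longleftrightarrow> pair M z y \<in> f \<or> (z \<notin> X \<and> y = \<zero>)" for y z
    using G[of z] ex[of z] sub[of z y] by (cases "z \<in> X") (auto simp: G_def)
  show ?thesis
  proof
    show "F (\<lambda>e. G (e 0))"
      by (intro F_graph_D) (simp only: eq, intro D_rules D_mem[OF fX(1)] D_app1[OF X] F_rules F_pair)
    show "z \<in> X \<Longrightarrow> G z \<in> B" for z using G sub by blast
    show "pair M z y \<in> f \<longleftrightarrow> z \<in> X \<and> y = G z" for z y using eq[of y z] sub[of z y] by blast
  qed
qed

lemma has_card_inj:
  assumes "has_card M A m"
  obtains h where "F (\<lambda>e. h (e 0))" "\<And>k. k \<prec> m \<Longrightarrow> h k \<in> A"
    "\<And>i j. i \<prec> m \<Longrightarrow> j \<prec> m \<Longrightarrow> h i = h j \<Longrightarrow> i = j"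
proof -
  obtain f where f: "is_fun M (below M m) A f"
    "\<And>y. y \<in> A \<Longrightarrow> \<exists>!x. x \<in> below M m \<and> pair M x y \<in> f"
    using assms unfolding has_card_def by blast
  have "D (\<lambda>e. e 0 \<in> below M m)" unfolding below_def mem_Collect_eq by (intro D_rules F_rules)
  then obtain h where h: "F (\<lambda>e. h (e 0))" "\<And>k. k \<in> below M m \<Longrightarrow> h k \<in> A"
    "\<And>k y. pair M k y \<in> f \<longleftrightarrow> k \<in> below M m \<and> y = h k"
    using is_fun_obtain[OF f(1)] by blast
  show ?thesis
  proof
    show "F (\<lambda>e. h (e 0))" by (rule h(1))
    show "k \<prec> m \<Longrightarrow> h k \<in> A" for k using h(2) by (simp add: below_def)
    show "i = j" if "i \<prec> m" "j \<prec> m" "h i = h j" for i j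
    proof -
      have "i \<in> below M m \<and> pair M i (h i) \<in> f" "j \<in> below M m \<and> pair M j (h i) \<in> f"
        using that h(3) by (simp_all add: below_def)
      moreover have "h i \<in> A" using h(2)[of i] that(1) by (simp add: below_def)
      ultimately show ?thesis using f(2) by blast
    qed
  qed
qed

lemma has_card_le_cnt:
  assumes "has_card M A m" "A \<in> l2_sets M" "\<And>x. x \<in> A \<Longrightarrow> x \<prec> b"
  shows "m \<preceq> cnt (\<lambda>x. x \<in> A) b"
proof -
  obtain h where h: "F (\<lambda>e. h (e 0))" "\<And>k. k \<prec> m \<Longrightarrow> h k \<in> A"
    "\<And>i j. i \<prec> m \<Longrightarrow> j \<prec> m \<Longrightarrow> h i = h j \<Longrightarrow> i = j"
    using has_card_inj[OF assms(1)] by blast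
  have "cnt (\<lambda>y. \<exists>k. k \<prec> m \<and> y = h k) b = m"
    by (rule cnt_image[OF h(1,3)]) (use h(2) assms(3) in auto)
  moreover have "cnt (\<lambda>y. \<exists>k. k \<prec> m \<and> y = h k) b \<preceq> cnt (\<lambda>x. x \<in> A) b"
  proof (rule cnt_mono)
    show "D (\<lambda>e. \<exists>k. k \<prec> m \<and> e 0 = h k)" by (intro D_rules F_rules F_app1[OF h(1)])
    show "D (\<lambda>e. e 0 \<in> A)" by (intro D_mem assms F_var)
  qed (use h(2) in blast)
  ultimately show ?thesis by simp
qed

text \<open>No bound for \<open>A\<close> is given, but \<open>function_bounded\<close> bounds the
  image of an initial segment.\<close>

lemma has_card_cnt_ex:
  assumes "has_card M A m" "A \<in> l2_sets M"
  shows "\<exists>b. m \<preceq> cnt (\<lambda>x. x \<in> A) b"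
proof -
  obtain h where h: "F (\<lambda>e. h (e 0))" "\<And>k. k \<prec> m \<Longrightarrow> h k \<in> A"
    "\<And>i j. i \<prec> m \<Longrightarrow> j \<prec> m \<Longrightarrow> h i = h j \<Longrightarrow> i = j"
    using has_card_inj[OF assms(1)] by blast
  obtain b where b: "\<And>k. k \<prec> m \<Longrightarrow> h k \<prec> b" using function_bounded[OF h(1)] by blast
  have "cnt (\<lambda>y. \<exists>k. k \<prec> m \<and> y = h k) b = m"
    by (rule cnt_image[OF h(1,3) b])
  moreover have "cnt (\<lambda>y. \<exists>k. k \<prec> m \<and> y = h k) b \<preceq> cnt (\<lambda>x. x \<in> A) b"
  proof (rule cnt_mono)
    show "D (\<lambda>e. \<exists>k. k \<prec> m \<and> e 0 = h k)" by (intro D_rules F_rules F_app1[OF h(1)])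
    show "D (\<lambda>e. e 0 \<in> A)" by (intro D_mem assms F_var)
  qed (use h(2) in blast)
  ultimately show ?thesis by auto
qed

lemma cnt_less:
  assumes P: "D (\<lambda>e. P (e 0))" and "P y" "y \<prec> z"
  shows "cnt P y \<prec> cnt P z"
proof -
  have "cnt P (y \<oplus> \<one>) \<preceq> cnt P z" using assms(3) by (intro cnt_mono_arg[OF P]) (simp add: succ_le_iff)
  then show ?thesis using assms(2) by (simp add: cnt_succ[OF P] succ_le_iff)
qed

text \<open>The bijection sends x to the element of \<open>A\<close> with exactly x predecessors in
  \<open>A\<close>.\<close>

lemma cnt_has_card:
  assumes A: "A \<in> l2_sets M"
  shows "has_card M {x \<in> A. x \<prec> b} (cnt (\<lambda>x. x \<in> A) b)"
proof -
  let ?c = "cnt (\<lambda>x. x \<in> A)"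
  let ?f = "{z. \<exists>y. y \<prec> b \<and> (y \<in> A \<and> z = pair M (?c y) y)}"
  have DA: "D (\<lambda>e. e 0 \<in> A)" by (intro D_mem A F_var)
  have inj: "y = y'" if "y \<in> A" "y' \<in> A" "?c y = ?c y'" for y y'
    using cnt_less[OF DA, of y y'] cnt_less[OF DA, of y' y] that p_total[of y y'] p_irrefl by metis
  have "?f \<in> l2_sets M"
    by (rule comprehension) (intro D_rules D_mem[OF A] F_pair F_cnt F_rules)
  moreover have "?f \<subseteq> {pair M x y | x y. x \<in> below M (?c b) \<and> y \<in> {x \<in> A. x \<prec> b}}"
    unfolding below_def using cnt_less[OF DA] by blast
  moreover have "\<exists>!y. pair M x y \<in> ?f" if x: "x \<in> below M (?c b)" for x
  proof -
    obtain y where "y \<prec> b" "y \<in> A" "?c y = x" using cnt_attain[OF DA, of x b] x by (auto simp: below_def)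
    then show ?thesis using inj by auto
  qed
  moreover have "\<exists>!x. x \<in> below M (?c b) \<and> pair M x y \<in> ?f" if "y \<in> {x \<in> A. x \<prec> b}" for y
    using that cnt_less[OF DA, of y b] by (auto simp: below_def)
  ultimately show ?thesis unfolding has_card_def is_fun_def by (intro exI[of _ ?f]) auto
qed

section \<open>The finite Ramsey theorem inside the structure\<close>

text \<open>Sizes are counted below a common \<open>b\<close>, and colours are numbers below
  \<open>C\<close>. \<open>R\<close> is a function of the calculus because the intervals are later
  defined by recursion on it. Colourings are functions on codes, so that the induction on
  \<open>n\<close> can compose them freely.\<close>

definition ramsey_bound :: "nat \<Rightarrow> 'a \<Rightarrow> ('a \<Rightarrow> 'a) \<Rightarrow> bool" where
  "ramsey_bound n C R \<longleftrightarrow> F (\<lambda>e. R (e 0)) \<and>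
    (\<forall>u A b G. A \<in> l2_sets M \<longrightarrow> F (\<lambda>e. G (e 0)) \<longrightarrow>
      (\<forall>xs. length xs = n \<longrightarrow> set xs \<subseteq> A \<longrightarrow> sorted_wrt (l2_less M) xs \<longrightarrow> G (tuple M xs) \<prec> C) \<longrightarrow>
      R u \<preceq> cnt (\<lambda>x. x \<in> A) b \<longrightarrow>
      (\<exists>H \<in> l2_sets M. H \<subseteq> A \<and> u \<preceq> cnt (\<lambda>x. x \<in> H) b \<and>
        (\<exists>col. \<forall>xs. length xs = n \<longrightarrow> set xs \<subseteq> H \<longrightarrow> sorted_wrt (l2_less M) xs \<longrightarrow> G (tuple M xs) = col)))"

lemma step_strict_mono:
  assumes f: "F (\<lambda>e. f (e 0))" and "\<And>k. f k \<prec> f (k \<oplus> \<one>)" and "i \<prec> j"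
  shows "f i \<prec> f j"
proof -
  have "i \<prec> j \<longrightarrow> f i \<prec> f j"
  proof (rule S1_induct[of "\<lambda>j. i \<prec> j \<longrightarrow> f i \<prec> f j"])
    show "S1 (\<lambda>e. i \<prec> e 0 \<longrightarrow> f i \<prec> f (e 0))" by (intro S1_rules D_rules F_app1[OF f] F_rules)
    fix a assume "i \<prec> a \<longrightarrow> f i \<prec> f a"
    then show "i \<prec> a \<oplus> \<one> \<longrightarrow> f i \<prec> f (a \<oplus> \<one>)"
      using assms(2) p_trans unfolding ax_less_succ by blast
  qed simp
  then show ?thesis using assms(3) by blast
qed

section \<open>Stage construction of an end-homogeneous sequence\<close>

definition is_increasing :: "nat \<Rightarrow> 'a \<Rightarrow> bool" where
  "is_increasing n t \<longleftrightarrow> tuple M (untuple n t) = t \<and> sorted_wrt (l2_less M) (untuple n t)"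

text \<open>Tuples are handled through the indices of their entries in the sequence coded by
  \<open>c\<close>: \<open>t\<close> codes n indices, and \<open>G\<close> is applied to an (n +
  1)-tuple.\<close>

definition ext_col :: "nat \<Rightarrow> ('a \<Rightarrow> 'a) \<Rightarrow> 'a \<Rightarrow> 'a \<Rightarrow> 'a \<Rightarrow> 'a" where
  "ext_col n G c t y = G (tuple M (map (\<lambda>s. val c s) (untuple n t) @ [y]))"

text \<open>
  In a stage construction \<open>c\<close> codes the elements chosen so far and \<open>d\<close> the colours to which the
  remaining candidates have been restricted: stage \<open>s\<close> fixes the colour of every
  extension of the increasing tuple of elements whose tuple of indices is coded by \<open>s\<close>.
\<close>

definition candidate :: "nat \<Rightarrow> ('a \<Rightarrow> 'a) \<Rightarrow> 'a set \<Rightarrow> 'a \<Rightarrow> 'a \<Rightarrow> 'a \<Rightarrow> 'a \<Rightarrow> bool" where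
  "candidate n G A c d t y \<longleftrightarrow> y \<in> A \<and>
    (\<forall>s. s \<prec> t \<longrightarrow> val c s \<prec> y \<and> (is_increasing n s \<longrightarrow> ext_col n G c s y = val d s))"

lemma D_is_increasing: "F t \<Longrightarrow> D (\<lambda>e. is_increasing n (t e))"
  unfolding is_increasing_def
  by (intro D_conj D_eq F_tuple[OF FL_untuple] D_sorted[OF FL_untuple])

lemma F_ext_col:
  assumes G: "F (\<lambda>e. G (e 0))" and "F c" "F t" "F y"
  shows "F (\<lambda>e. ext_col n G (c e) (t e) (y e))"
proof -
  have "F (\<lambda>e. val (c (\<lambda>i. e (Suc i))) (e 0))" by (rule F_val[OF F_reindex[OF assms(2)] F_var])
  from FL_map[of "\<lambda>s e. val (c e) s", OF this FL_untuple[OF assms(3), of n]]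
  have "FL n (\<lambda>e. map (\<lambda>s. val (c e) s) (untuple n (t e)))" .
  from F_tuple[OF FL_append[OF this FL_Cons[OF assms(4) FL_Nil]]]
  show ?thesis unfolding ext_col_def by (rule F_app1[OF G])
qed

lemma D_candidate:
  assumes G: "F (\<lambda>e. G (e 0))" and A: "A \<in> l2_sets M" and "F c" "F d" "F t" "F y"
  shows "D (\<lambda>e. candidate n G A (c e) (d e) (t e) (y e))"
  unfolding candidate_def
  by (intro D_rules D_mem[OF A] D_is_increasing F_ext_col[OF G] F_val F_var
      assms F_reindex[OF assms(3)] F_reindex[OF assms(4)] F_reindex[OF assms(5)] F_reindex[OF assms(6)])

text \<open>Ensures that the entries named by the tuple of stage \<open>s\<close> are chosen by the
  time of that stage.\<close>

lemma is_increasing_less: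
  assumes "is_increasing n s" "x \<in> set (untuple n s)" shows "x \<preceq> s"
  using tuple_ge[OF assms(2)] assms(1) by (simp add: is_increasing_def)

text \<open>The index bound \<open>is_increasing_less\<close> confines every reference to
  \<open>c\<close> to positions below \<open>t\<close>, so codes can be extended without disturbing
  earlier stages.\<close>

lemma candidate_cong:
  assumes "\<And>s. s \<prec> t \<Longrightarrow> val c s = val c' s" "\<And>s. s \<prec> t \<Longrightarrow> val d s = val d' s"
  shows "candidate n G A c d t y \<longleftrightarrow> candidate n G A c' d' t y"
proof -
  have "ext_col n G c s y = ext_col n G c' s y" if "s \<prec> t" "is_increasing n s" for s
  proof -
    have "map (\<lambda>s. val c s) (untuple n s) = map (\<lambda>s. val c' s) (untuple n s)"
      using assms(1) is_increasing_less[OF that(2)] that(1) A.le_less_trans by (intro map_cong) blast+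
    then show ?thesis unfolding ext_col_def by (simp only:)
  qed
  then show ?thesis unfolding candidate_def using assms by auto
qed

lemma val_extend: "\<exists>c'. val c' t = x \<and> (\<forall>s. s \<prec> t \<longrightarrow> val c' s = val c s)"
proof -
  let ?f = "\<lambda>s. if s = t then x else val c s"
  have "F (\<lambda>e. ?f (e 0))" by (intro F_if D_rules F_rules')
  from val_code[of ?f, OF this, of "t \<oplus> \<one>"] obtain c' where "\<forall>s. s \<prec> t \<oplus> \<one> \<longrightarrow> val c' s = ?f s" by blast
  then show ?thesis using p_irrefl by (intro exI[of _ c']) (auto simp: ax_less_succ)
qed

lemma ext_col_list:
  assumes cand: "\<And>s. s \<preceq> t \<Longrightarrow> candidate n G A c d s (val c s)" and "y \<in> A"
    and y: "\<And>s. s \<preceq> t \<Longrightarrow> val c s \<prec> y" and inc: "is_increasing n t"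
  shows "length (map (\<lambda>s. val c s) (untuple n t) @ [y]) = Suc n"
    and "set (map (\<lambda>s. val c s) (untuple n t) @ [y]) \<subseteq> A"
    and "sorted_wrt (l2_less M) (map (\<lambda>s. val c s) (untuple n t) @ [y])"
proof -
  have le: "s \<preceq> t" if "s \<in> set (untuple n t)" for s using is_increasing_less[OF inc that] .
  show "length (map (\<lambda>s. val c s) (untuple n t) @ [y]) = Suc n" by simp
  show "set (map (\<lambda>s. val c s) (untuple n t) @ [y]) \<subseteq> A"
    using le cand assms(2) by (auto simp: candidate_def)
  have "val c s \<prec> val c s'" if "s \<prec> s'" "s' \<preceq> t" for s s'
    using cand[OF that(2)] that(1) by (auto simp: candidate_def)
  then have "sorted_wrt (\<lambda>s s'. val c s \<prec> val c s') (untuple n t)"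
    using inc le by (auto simp: is_increasing_def intro: sorted_wrt_mono_rel[rotated])
  then show "sorted_wrt (l2_less M) (map (\<lambda>s. val c s) (untuple n t) @ [y])"
    using y le by (simp add: sorted_wrt_append sorted_wrt_map)
qed

text \<open>One candidate is used up as the next element, the others are sorted by the colour that
  they give to the tuple of stage \<open>t\<close>, and the pigeonhole principle retains more than
  \<open>N\<close>. Treating one tuple per stage limits the number of classes to \<open>C\<close>,
  so that no power of \<open>C\<close> has to be formed.\<close>

lemma candidate_step:
  assumes G: "F (\<lambda>e. G (e 0))" and A: "A \<in> l2_sets M" and C: "\<zero> \<prec> C"
    and col: "\<And>xs. length xs = Suc n \<Longrightarrow> set xs \<subseteq> A \<Longrightarrow> sorted_wrt (l2_less M) xs \<Longrightarrow> G (tuple M xs) \<prec> C"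
    and cand: "\<And>s. s \<prec> t \<Longrightarrow> candidate n G A c d s (val c s) \<and> val c s \<prec> b"
    and N: "C \<otimes> N \<oplus> \<one> \<prec> cnt (candidate n G A c d t) b"
  shows "\<exists>c' d'. (\<forall>s. s \<prec> t \<oplus> \<one> \<longrightarrow> candidate n G A c' d' s (val c' s) \<and> val c' s \<prec> b) \<and>
      N \<prec> cnt (candidate n G A c' d' (t \<oplus> \<one>)) b"
proof -
  let ?S = "candidate n G A c d t"
  have DS: "D (\<lambda>e. ?S (e 0))" by (intro D_candidate G A F_rules)
  have "\<zero> \<prec> cnt ?S b" using N A.le_less_trans zero_le by blast
  then obtain z where z: "z \<prec> b" "?S z" using cnt_attain[OF DS] by blast
  \<comment> \<open>The least candidate is taken so that all others lie above it, as candidates of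
    the next stage must.\<close>
  define x where "x = least ?S"
  have x: "?S x" "\<And>y. ?S y \<Longrightarrow> y = x \<or> x \<prec> y" "x \<prec> b"
    using least_props[OF DS z(2)] z(1) p_total A.le_less_trans unfolding x_def by blast+
  let ?W = "\<lambda>y. ?S y \<and> x \<prec> y"
  have DW: "D (\<lambda>e. ?W (e 0))" by (intro D_conj DS D_less F_rules)
  have "?S = (\<lambda>y. ?W y \<or> y = x)" using x by blast
  then have "cnt ?S b = cnt ?W b \<oplus> \<one>" using cnt_insert[OF DW, of x b] x(3) p_irrefl by simp
  then have W: "C \<otimes> N \<prec> cnt ?W b" using N by simp
  \<comment> \<open>Entry \<open>t\<close> is set before sorting, because the tuple coded by
    \<open>t\<close> may use the index \<open>t\<close> itself.\<close>
  obtain c' where c': "val c' t = x" "\<And>s. s \<prec> t \<Longrightarrow> val c' s = val c s"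
    using val_extend by blast
  \<comment> \<open>If \<open>t\<close> codes no increasing tuple, all candidates fall into the
    class \<open>\<zero>\<close>, which is below \<open>C\<close> because \<open>C\<close> is
    positive.\<close>
  let ?g = "\<lambda>y. if is_increasing n t then ext_col n G c' t y else \<zero>"
  have "F (\<lambda>e. ?g (e 0))" by (intro F_if D_is_increasing F_ext_col[OF G] F_rules)
  moreover have cc: "candidate n G A c' d s y \<longleftrightarrow> candidate n G A c d s y" if "s \<preceq> t" for s y
    using that c'(2) A.less_le_trans by (intro candidate_cong) blast+
  have cand': "candidate n G A c' d s (val c' s)" if "s \<preceq> t" for s
    using that cc[OF that] cand[of s] c' x(1) unfolding l2_le_def by auto
  have "?g y \<prec> C" if "y \<prec> b" "?W y" for y
  proof (cases "is_increasing n t")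
    case True
    have "val c' s \<prec> y" if "s \<preceq> t" for s
      using that c' \<open>?W y\<close> unfolding l2_le_def by (auto simp: candidate_def)
    moreover have "y \<in> A" using that(2) by (simp add: candidate_def)
    ultimately show ?thesis
      using col[OF ext_col_list[of t n G A c' d y]] cand' True by (simp add: ext_col_def)
  qed (simp add: C)
  ultimately obtain k where k: "N \<prec> cnt (\<lambda>y. ?W y \<and> ?g y = k) b"
    using cnt_pigeonhole[OF DW, of ?g b C N] W by blast
  obtain d' where d': "val d' t = k" "\<And>s. s \<prec> t \<Longrightarrow> val d' s = val d s"
    using val_extend by blast
  have dd: "candidate n G A c' d' s y \<longleftrightarrow> candidate n G A c' d s y" if "s \<preceq> t" for s y
    using that d'(2) A.less_le_trans by (intro candidate_cong) blast+
  have "candidate n G A c' d' s (val c' s) \<and> val c' s \<prec> b" if "s \<prec> t \<oplus> \<one>" for s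
    using that dd cand' cand c' x(3) unfolding less_succ_iff by (auto simp: l2_le_def)
  moreover have "N \<prec> cnt (candidate n G A c' d' (t \<oplus> \<one>)) b"
  proof -
    have "cnt (\<lambda>y. ?W y \<and> ?g y = k) b \<preceq> cnt (candidate n G A c' d' (t \<oplus> \<one>)) b"
    proof (rule cnt_mono)
      show "D (\<lambda>e. (?S (e 0) \<and> x \<prec> e 0) \<and> (if is_increasing n t then ext_col n G c' t (e 0) else \<zero>) = k)"
        by (intro D_conj DW D_eq F_if D_is_increasing F_ext_col[OF G] F_rules)
      show "D (\<lambda>e. candidate n G A c' d' (t \<oplus> \<one>) (e 0))" by (intro D_candidate G A F_rules)
      fix y assume y: "?W y \<and> ?g y = k"
      then have "candidate n G A c' d' t y" using dd[of t y] cc[of t y] by simp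
      then show "candidate n G A c' d' (t \<oplus> \<one>) y"
        using y c'(1) d'(1) unfolding candidate_def ax_less_succ by auto
    qed
    then show ?thesis using k A.less_le_trans by blast
  qed
  ultimately show ?thesis by blast
qed

text \<open>The number of candidates required with a given number of stages to go. The two added
  units turn the strict inequality assumed in \<open>candidate_step\<close> into a weak one.\<close>

definition stage_bound :: "'a \<Rightarrow> 'a \<Rightarrow> 'a" where
  "stage_bound C = prec \<one> (\<lambda>i y. C \<otimes> y \<oplus> \<one> \<oplus> \<one>)"

lemma stage_bound_succ: "stage_bound C (s \<oplus> \<one>) = C \<otimes> stage_bound C s \<oplus> \<one> \<oplus> \<one>"
  unfolding stage_bound_def by (intro prec_succ F_rules)

lemma F_stage_bound: "F t \<Longrightarrow> F (\<lambda>e. stage_bound C (t e))"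
  unfolding stage_bound_def by (intro F_prec F_rules)

text \<open>The argument of Erdos and Rado: the colour of a tuple no longer depends on its last
  entry, provided that this entry is chosen after the stage numbered by the code of the other
  indices.\<close>

lemma end_homogeneous:
  assumes G: "F (\<lambda>e. G (e 0))" and A: "A \<in> l2_sets M" and C: "\<zero> \<prec> C"
    and col: "\<And>xs. length xs = Suc n \<Longrightarrow> set xs \<subseteq> A \<Longrightarrow> sorted_wrt (l2_less M) xs \<Longrightarrow> G (tuple M xs) \<prec> C"
    and T: "stage_bound C T \<preceq> cnt (\<lambda>x. x \<in> A) b"
  shows "\<exists>c d. \<forall>s. s \<prec> T \<longrightarrow> candidate n G A c d s (val c s) \<and> val c s \<prec> b"
proof -
  \<comment> \<open>Expressing the abundance of candidates by a count keeps the invariant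
    \<open>\<Sigma>\<^sub>1\<close>; the bound refers to the stages still to come.\<close>
  let ?P = "\<lambda>t c d. (\<forall>s. s \<prec> t \<longrightarrow> candidate n G A c d s (val c s) \<and> val c s \<prec> b) \<and>
     stage_bound C (T \<ominus> t) \<preceq> cnt (\<lambda>y. candidate n G A c d t y) b"
  have "t \<preceq> T \<longrightarrow> (\<exists>c d. ?P t c d)" for t
  proof (rule S1_induct[of "\<lambda>t. t \<preceq> T \<longrightarrow> (\<exists>c d. ?P t c d)"])
    show "S1 (\<lambda>e. e 0 \<preceq> T \<longrightarrow> (\<exists>c d. ?P (e 0) c d))"
      by (intro S1_imp S1_rules D_rules F_stage_bound F_cnt D_candidate G A F_val F_rules)
    have "candidate n G A c d \<zero> = (\<lambda>y. y \<in> A)" for c d by (auto simp: candidate_def)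
    then show "\<zero> \<preceq> T \<longrightarrow> (\<exists>c d. ?P \<zero> c d)" using T by simp
    fix t assume IH: "t \<preceq> T \<longrightarrow> (\<exists>c d. ?P t c d)"
    show "t \<oplus> \<one> \<preceq> T \<longrightarrow> (\<exists>c d. ?P (t \<oplus> \<one>) c d)"
    proof
      assume tT: "t \<oplus> \<one> \<preceq> T"
      then obtain w where w: "T = t \<oplus> \<one> \<oplus> w" using p_le_iff by blast
      have "T = t \<oplus> (w \<oplus> \<one>)" unfolding w by (simp add: ac_simps)
      then have Tt: "T \<ominus> t = w \<oplus> \<one>" "T \<ominus> (t \<oplus> \<one>) = w" using w by simp_all
      obtain c d where cd: "?P t c d" using IH tT A.less_imp_le unfolding succ_le_iff by blast
      then have "C \<otimes> stage_bound C w \<oplus> \<one> \<oplus> \<one> \<preceq> cnt (candidate n G A c d t) b"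
        unfolding Tt stage_bound_succ by blast
      then have "C \<otimes> stage_bound C w \<oplus> \<one> \<prec> cnt (candidate n G A c d t) b"
        unfolding succ_le_iff .
      from candidate_step[OF G A C col _ this] cd obtain c' d' where
        "\<forall>s. s \<prec> t \<oplus> \<one> \<longrightarrow> candidate n G A c' d' s (val c' s) \<and> val c' s \<prec> b"
        "stage_bound C w \<prec> cnt (candidate n G A c' d' (t \<oplus> \<one>)) b"
        by blast
      then show "\<exists>c d. ?P (t \<oplus> \<one>) c d" unfolding Tt using A.less_imp_le by blast
    qed
  qed
  then show ?thesis by blast
qed

section \<open>Induction on the exponent\<close>

lemma ramsey_bound_0: "ramsey_bound 0 C (\<lambda>u. u)"
  unfolding ramsey_bound_def by (auto intro: F_var)

text \<open>A colour is fixed only for tuples whose code is below the index of the last entry, hence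
  the passage to sparser indices. Adding the code of the constant tuple is enough because, by
  \<open>tuple_le_replicate\<close>, it dominates the codes of tuples with smaller entries.\<close>

definition thin :: "nat \<Rightarrow> 'a \<Rightarrow> 'a" where
  "thin n = prec \<one> (\<lambda>i y. y \<oplus> tuple M (replicate n y) \<oplus> \<one>)"

lemma F_thin_step: "F t \<Longrightarrow> F (\<lambda>e. t e \<oplus> tuple M (replicate n (t e)) \<oplus> \<one>)"
  by (intro F_add F_tuple[OF FL_replicate] F_const)

lemma thin_0: "thin n \<zero> = \<one>"
  unfolding thin_def by (intro prec_0 F_thin_step F_var)

lemma thin_succ: "thin n (k \<oplus> \<one>) = thin n k \<oplus> tuple M (replicate n (thin n k)) \<oplus> \<one>"
  unfolding thin_def by (intro prec_succ F_thin_step F_var)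

lemma F_thin: "F t \<Longrightarrow> F (\<lambda>e. thin n (t e))"
  unfolding thin_def by (intro F_prec F_thin_step F_rules)

lemma thin_less: "i \<prec> j \<Longrightarrow> thin n i \<prec> thin n j"
  by (rule step_strict_mono) (simp_all add: F_thin F_var thin_succ)

lemma thin_le: "i \<preceq> j \<Longrightarrow> thin n i \<preceq> thin n j"
  using thin_less unfolding l2_le_def by blast

text \<open>The growth of \<^term>\<open>thin\<close> puts the code of every index tuple before all later indices.\<close>

lemma thin_tuple:
  assumes "\<And>i. i \<in> set ks \<Longrightarrow> i \<prec> k"
  shows "tuple M (map (thin (length ks)) ks) \<prec> thin (length ks) k"
proof (cases k rule: zero_cases)
  case 1
  then have "ks = []" using assms by (cases ks) auto
  then show ?thesis using 1 by (simp add: thin_0)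
next
  case (2 l)
  let ?g = "thin (length ks)"
  have "tuple M (map ?g ks) \<preceq> tuple M (replicate (length (map ?g ks)) (?g l))"
    by (rule tuple_le_replicate) (use assms 2 in \<open>auto simp: less_succ_iff intro: thin_le\<close>)
  also have "\<dots> \<prec> ?g k" unfolding 2 thin_succ by simp
  finally show ?thesis .
qed

text \<open>Of the thinned entries, the last is set aside as a common end. Appending it turns
  \<open>G\<close> into a colouring of the n-tuples of the \<open>R u\<close> others, to which the
  bound for \<open>n\<close> applies, and end-homogeneity transfers the resulting colour to all
  other ends.\<close>

lemma ramsey_bound_Suc:
  assumes R: "ramsey_bound n C R" and C: "\<zero> \<prec> C"
  shows "ramsey_bound (Suc n) C (\<lambda>u. stage_bound C (thin n (R u) \<oplus> \<one>))"
  unfolding ramsey_bound_def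
proof (intro conjI allI impI)
  have FR: "F (\<lambda>e. R (e 0))" using R by (simp add: ramsey_bound_def)
  show "F (\<lambda>e. stage_bound C (thin n (R (e 0)) \<oplus> \<one>))"
    by (intro F_stage_bound F_add F_thin FR F_const)
  fix u A b G
  assume A: "A \<in> l2_sets M" and G: "F (\<lambda>e. G (e 0))"
    and col: "\<forall>xs. length xs = Suc n \<longrightarrow> set xs \<subseteq> A \<longrightarrow> sorted_wrt (l2_less M) xs \<longrightarrow> G (tuple M xs) \<prec> C"
    and big: "stage_bound C (thin n (R u) \<oplus> \<one>) \<preceq> cnt (\<lambda>x. x \<in> A) b"
  define r where "r = R u"
  let ?g = "thin n"
  \<comment> \<open>The additional stage makes the index \<open>?g r\<close> itself available; its
    entry will be the common end.\<close>
  obtain c d where cd: "\<And>s. s \<preceq> ?g r \<Longrightarrow> candidate n G A c d s (val c s)"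
    "\<And>s. s \<preceq> ?g r \<Longrightarrow> val c s \<prec> b"
    using end_homogeneous[OF G A C _ big] col unfolding r_def less_succ_iff by blast
  have incr: "val c s \<prec> val c s'" if "s \<prec> s'" "s' \<preceq> ?g r" for s s'
    using cd(1)[OF that(2)] that(1) by (auto simp: candidate_def)
  let ?f = "\<lambda>k. val c (?g k)"
  have Ff: "F (\<lambda>e. ?f (e 0))" by (intro F_val F_thin F_rules)
  have f_less: "?f i \<prec> ?f j" if "i \<prec> j" "j \<preceq> r" for i j
    using incr thin_less thin_le that by blast
  have f_less_iff: "i \<prec> j" if "?f i \<prec> ?f j" "i \<preceq> r" for i j
    using f_less[of j i] that p_total p_irrefl p_trans by metis
  have f_A: "?f i \<in> A" if "i \<preceq> r" for i using cd(1)[OF thin_le[OF that]] by (simp add: candidate_def)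
  let ?B = "{y. \<exists>k. k \<prec> r \<and> y = ?f k}"
  let ?last = "?f r"
  let ?G' = "\<lambda>z. G (tuple M (untuple n z @ [?last]))"
  have DB: "D (\<lambda>e. \<exists>k. k \<prec> r \<and> e 0 = ?f k)" by (intro D_rules F_val F_thin F_rules)
  have B: "?B \<in> l2_sets M" by (rule comprehension[OF DB])
  have FG': "F (\<lambda>e. ?G' (e 0))"
    using F_tuple[OF FL_append[OF FL_untuple[OF F_var[of 0], of n] FL_Cons[OF F_const[of ?last] FL_Nil]]]
    by (rule F_app1[OF G])
  have BA: "?B \<subseteq> A" using f_A A.less_imp_le by blast
  have "cnt (\<lambda>y. \<exists>k. k \<prec> r \<and> y = ?f k) b = r"
  proof (rule cnt_image[OF Ff])
    show "i = j" if "i \<prec> r" "j \<prec> r" "?f i = ?f j" for i j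
      using f_less[of i j] f_less[of j i] that p_total[of i j] p_irrefl A.less_imp_le by metis
    show "i \<prec> r \<Longrightarrow> ?f i \<prec> b" for i using cd(2)[OF thin_le] A.less_imp_le by blast
  qed
  then have Bcnt: "R u \<preceq> cnt (\<lambda>x. x \<in> ?B) b" unfolding r_def by simp
  have G'col: "?G' (tuple M xs) \<prec> C" if "length xs = n" "set xs \<subseteq> ?B" "sorted_wrt (l2_less M) xs" for xs
  proof -
    have "x \<prec> ?last" if "x \<in> ?B" for x using that f_less[of _ r] by auto
    then have "\<forall>x\<in>set xs. x \<prec> ?last" using that(2) by blast
    then have "sorted_wrt (l2_less M) (xs @ [?last])" using that(3) by (simp add: sorted_wrt_append)
    moreover have "set (xs @ [?last]) \<subseteq> A" using that BA f_A[of r] by auto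
    ultimately have "G (tuple M (xs @ [?last])) \<prec> C" using col that(1) by simp
    then show ?thesis using untuple_tuple'[OF that(1)] by simp
  qed
  obtain H cl where H: "H \<in> l2_sets M" "H \<subseteq> ?B" "u \<preceq> cnt (\<lambda>x. x \<in> H) b"
    and cl: "\<And>xs. length xs = n \<Longrightarrow> set xs \<subseteq> H \<Longrightarrow> sorted_wrt (l2_less M) xs \<Longrightarrow> ?G' (tuple M xs) = cl"
  proof -
    have "\<exists>H \<in> l2_sets M. H \<subseteq> ?B \<and> u \<preceq> cnt (\<lambda>x. x \<in> H) b \<and>
        (\<exists>col. \<forall>xs. length xs = n \<longrightarrow> set xs \<subseteq> H \<longrightarrow> sorted_wrt (l2_less M) xs \<longrightarrow> ?G' (tuple M xs) = col)"
      using R[unfolded ramsey_bound_def, THEN conjunct2, THEN spec, THEN spec, THEN spec, THEN spec,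
          THEN mp, THEN mp, THEN mp, THEN mp, of ?B ?G' u b] B FG' G'col Bcnt by blast
    then show ?thesis using that by blast
  qed
  have "G (tuple M xs) = cl" if xs: "length xs = Suc n" "set xs \<subseteq> H" "sorted_wrt (l2_less M) xs" for xs
  proof -
    obtain ys y where ys: "xs = ys @ [y]" using xs(1) by (metis length_Suc_conv_rev)
    have ysH: "set ys \<subseteq> H" "length ys = n" "sorted_wrt (l2_less M) ys" "y \<in> H" "\<And>x. x \<in> set ys \<Longrightarrow> x \<prec> y"
      using xs unfolding ys by (auto simp: sorted_wrt_append)
    obtain k where k: "k \<prec> r" "y = ?f k" using ysH(4) H(2) by blast
    have "\<exists>i. i \<prec> k \<and> x = ?f i" if x: "x \<in> set ys" for x
    proof -
      obtain i where "i \<prec> r" "x = ?f i" using x ysH(1) H(2) by blast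
      then show ?thesis using f_less_iff[of i k] ysH(5)[OF x] k A.less_imp_le by blast
    qed
    then obtain h where h: "\<And>x. x \<in> set ys \<Longrightarrow> h x \<prec> k \<and> x = ?f (h x)" by metis
    define ks where "ks = map h ys"
    have len: "length ks = n" using ysH(2) by (simp add: ks_def)
    have ks: "map ?f ks = ys" "\<And>i. i \<in> set ks \<Longrightarrow> i \<prec> k"
      unfolding ks_def using h by (auto intro: map_idI)
    let ?t = "tuple M (map ?g ks)"
    have unt: "untuple n ?t = map ?g ks" by (rule untuple_tuple') (simp add: len)
    have t: "?t \<prec> ?g k" using thin_tuple[of ks k] ks(2) len by simp
    have kr: "i \<preceq> r" if "i \<in> set ks" for i
      using ks(2)[OF that] k(1) A.less_trans A.less_imp_le by blast
    have "sorted_wrt (\<lambda>i j. ?f i \<prec> ?f j) ks"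
      using ysH(3) unfolding ks(1)[symmetric] by (simp add: sorted_wrt_map)
    then have "sorted_wrt (\<lambda>i j. ?g i \<prec> ?g j) ks"
      by (rule sorted_wrt_mono_rel[rotated]) (use f_less_iff kr thin_less in blast)
    then have inc: "is_increasing n ?t" unfolding is_increasing_def unt by (simp add: sorted_wrt_map)
    have ext: "ext_col n G c ?t x = G (tuple M (ys @ [x]))" for x
      unfolding ext_col_def unt ks(1)[symmetric] by (simp add: comp_def)
    \<comment> \<open>Both \<open>y\<close> and the common end are chosen after stage
      \<open>?t\<close>, so appending either to \<open>ys\<close> gives the colour recorded at that
      stage.\<close>
    have "candidate n G A c d (?g k) y"
      using cd(1)[of "?g k"] thin_le k A.less_imp_le by blast
    then have "ext_col n G c ?t y = val d ?t" using t inc by (auto simp: candidate_def)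
    moreover have "candidate n G A c d (?g r) ?last" by (rule cd(1)) simp
    then have "ext_col n G c ?t ?last = val d ?t"
      using inc p_trans[OF t thin_less[OF k(1)]] by (auto simp: candidate_def)
    ultimately have "G (tuple M (ys @ [y])) = G (tuple M (ys @ [?last]))" unfolding ext by simp
    also have "\<dots> = cl" using cl[OF ysH(2,1,3)] untuple_tuple'[OF ysH(2)] by simp
    finally show ?thesis unfolding ys .
  qed
  then show "\<exists>H\<in>l2_sets M. H \<subseteq> A \<and> u \<preceq> cnt (\<lambda>x. x \<in> H) b \<and>
      (\<exists>col. \<forall>xs. length xs = Suc n \<longrightarrow> set xs \<subseteq> H \<longrightarrow> sorted_wrt (l2_less M) xs \<longrightarrow> G (tuple M xs) = col)"
    using H BA by blast
qed

lemma finite_ramsey: "\<zero> \<prec> C \<Longrightarrow> \<exists>R. ramsey_bound n C R"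
  by (induction n) (blast intro: ramsey_bound_0 ramsey_bound_Suc)+

text \<open>The colours 1 to j of \<open>arrow\<close> are numbers below j + 1, hence the number of
  colours in the hypothesis.\<close>

lemma ramsey_arrow:
  assumes R: "ramsey_bound n (j \<oplus> \<one>) R" and w: "R u \<preceq> w"
  shows "arrow M w u n j"
  unfolding arrow_def
proof (intro ballI allI impI)
  fix A f assume A: "A \<in> l2_sets M" and card: "has_card M A w"
    and f: "is_fun M (subsets_of M n A) (one_to M j) f"
  have "D (\<lambda>e. e 0 \<in> subsets_of M n A)" by (rule D_subsets_of[OF A F_var])
  then obtain G where G: "F (\<lambda>e. G (e 0))" "\<And>z. z \<in> subsets_of M n A \<Longrightarrow> G z \<in> one_to M j"
    "\<And>z y. pair M z y \<in> f \<longleftrightarrow> z \<in> subsets_of M n A \<and> y = G z"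
    using is_fun_obtain[OF f] by blast
  obtain b where b: "w \<preceq> cnt (\<lambda>x. x \<in> A) b" using has_card_cnt_ex[OF card A] by blast
  have col: "G (tuple M xs) \<prec> j \<oplus> \<one>"
    if "length xs = n" "set xs \<subseteq> A" "sorted_wrt (l2_less M) xs" for xs
  proof -
    have "tuple M xs \<in> subsets_of M n A" using that by (auto simp: subsets_of_def)
    then show ?thesis using G(2) by (auto simp: one_to_def less_succ_iff)
  qed
  have "\<exists>H \<in> l2_sets M. H \<subseteq> A \<and> u \<preceq> cnt (\<lambda>x. x \<in> H) b \<and>
      (\<exists>col. \<forall>xs. length xs = n \<longrightarrow> set xs \<subseteq> H \<longrightarrow> sorted_wrt (l2_less M) xs \<longrightarrow> G (tuple M xs) = col)"
    using R[unfolded ramsey_bound_def, THEN conjunct2, THEN spec, THEN spec, THEN spec, THEN spec,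
        THEN mp, THEN mp, THEN mp, THEN mp, of A G u b] A G(1) col A.order_trans[OF w b] by blast
  then obtain H cl where H: "H \<in> l2_sets M" "H \<subseteq> A" "u \<preceq> cnt (\<lambda>x. x \<in> H) b"
    and cl: "\<And>xs. length xs = n \<Longrightarrow> set xs \<subseteq> H \<Longrightarrow> sorted_wrt (l2_less M) xs \<Longrightarrow> G (tuple M xs) = cl"
    by blast
  have DH: "D (\<lambda>e. e 0 \<in> H)" by (intro D_mem H F_var)
  \<comment> \<open>\<open>has_card\<close> asks for exactly \<open>u\<close> elements, so the
    homogeneous set is cut off where its count reaches \<open>u\<close>.\<close>
  obtain z where z: "cnt (\<lambda>x. x \<in> H) z = u" using cnt_reach[OF DH H(3)] by blast
  let ?H = "{x \<in> H. x \<prec> z}"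
  have "?H \<in> l2_sets M" by (rule comprehension) (intro D_rules D_mem[OF H(1)] F_rules)
  moreover have "has_card M ?H u" using cnt_has_card[OF H(1), of z] z by simp
  moreover have "homogeneous M n f ?H"
    unfolding homogeneous_def
  proof (intro exI[of _ cl] ballI)
    fix s assume "s \<in> subsets_of M n ?H"
    then obtain xs where xs: "s = tuple M xs" "length xs = n" "set xs \<subseteq> H" "sorted_wrt (l2_less M) xs"
      by (auto simp: subsets_of_def)
    then have "s \<in> subsets_of M n A" using H(2) by (auto simp: subsets_of_def)
    then show "pair M s cl \<in> f" using G(3) cl xs by simp
  qed
  moreover have "?H \<subseteq> A" using H(2) by blast
  ultimately show "\<exists>H\<in>l2_sets M. H \<subseteq> A \<and> has_card M H u \<and> homogeneous M n f H"
    by (intro bexI[of _ ?H] conjI)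
qed

end

section \<open>Block partitions\<close>

text \<open>The binary digits, lowest first, tell for each two neighbours whether they share a value
  of \<open>f\<close>. When \<open>f\<close> is the interval index and the list is increasing, this
  number describes how the intervals split it; 0 means that no interval is met twice.\<close>

fun tie_pattern :: "('a \<Rightarrow> 'b) \<Rightarrow> 'a list \<Rightarrow> nat" where
  "tie_pattern f (x # y # ys) = (if f x = f y then 1 else 0) + 2 * tie_pattern f (y # ys)"
| "tie_pattern f xs = 0"

lemma tie_pattern_less: "tie_pattern f xs < 2 ^ (length xs - 1)"
  by (induction xs rule: induct_list012) auto

section \<open>Standard numerals, graphs, and lists obtained from counts\<close>

context rca0_model
begin

lemma numeral_of_add: "numeral_of M (a + b) = numeral_of M a \<oplus> numeral_of M b"
  by (induction b) (simp_all add: A.add.assoc)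

lemma numeral_of_mono: "a \<le> b \<Longrightarrow> numeral_of M a \<preceq> numeral_of M b"
  using numeral_of_add[of a "b - a"] by simp

lemma numeral_of_less: "a < b \<Longrightarrow> numeral_of M a \<prec> numeral_of M b"
  using numeral_of_mono[of "Suc a" b] by (simp add: succ_le_iff)

lemma numeral_of_eq_iff [simp]: "numeral_of M a = numeral_of M b \<longleftrightarrow> a = b"
  using numeral_of_less[of a b] numeral_of_less[of b a] p_irrefl by (metis nat_neq_iff)

definition fgraph :: "'a set \<Rightarrow> ('a \<Rightarrow> 'a) \<Rightarrow> 'a set" where
  "fgraph X G = {pair M z (G z) | z. z \<in> X}"

lemma pair_mem_fgraph [simp]: "pair M z y \<in> fgraph X G \<longleftrightarrow> z \<in> X \<and> y = G z"
  by (auto simp: fgraph_def)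

lemma fgraph_is_fun:
  assumes G: "F (\<lambda>e. G (e 0))" and X: "D (\<lambda>e. e 0 \<in> X)" and B: "\<And>z. z \<in> X \<Longrightarrow> G z \<in> B"
  shows "is_fun M X B (fgraph X G)"
proof -
  \<comment> \<open>The bound \<open>z \<preceq> w\<close>, justified by \<open>pair_ge\<close>,
    makes the graph \<open>\<Delta>\<^sub>1\<close>.\<close>
  have "{w. \<exists>z. z \<preceq> w \<and> (z \<in> X \<and> w = pair M z (G z))} \<in> l2_sets M"
    by (rule comprehension) (intro D_rules D_app1[OF X] F_pair F_app1[OF G] F_rules)
  also have "{w. \<exists>z. z \<preceq> w \<and> (z \<in> X \<and> w = pair M z (G z))} = fgraph X G"
    using pair_ge(1) by (auto simp: fgraph_def)
  finally show ?thesis unfolding is_fun_def using B by (auto simp: fgraph_def)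
qed

lemma UNIV_mem_sets: "UNIV \<in> l2_sets M"
  using comprehension[of "\<lambda>_. True"] D_bool by simp

text \<open>Because \<open>n\<close> is standard, an internal count can be turned into an actual
  list by external induction, one element at a time from the top.\<close>

lemma cnt_gap_list:
  assumes P: "D (\<lambda>e. P (e 0))" and "cnt P x \<oplus> numeral_of M n \<preceq> cnt P y"
  shows "\<exists>xs. length xs = n \<and> sorted_wrt (l2_less M) xs \<and> (\<forall>z\<in>set xs. P z \<and> x \<preceq> z \<and> z \<prec> y)"
  using assms(2)
proof (induction n arbitrary: y)
  case (Suc n)
  have "cnt P x \<oplus> numeral_of M n \<prec> cnt P y"
    using Suc.prems by (simp add: succ_le_iff A.add.assoc[symmetric])
  then obtain z where z: "z \<prec> y" "P z" "cnt P z = cnt P x \<oplus> numeral_of M n"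
    using cnt_attain[OF P] by blast
  then obtain xs where xs: "length xs = n" "sorted_wrt (l2_less M) xs"
    "\<forall>w\<in>set xs. P w \<and> x \<preceq> w \<and> w \<prec> z"
    using Suc.IH[of z] by auto
  have "\<not> z \<prec> x" using cnt_less[OF P z(2), of x] z(3) by (auto simp: A.not_less[symmetric])
  then have "x \<preceq> z" using A.not_less by blast
  then show ?case using xs z p_trans by (intro exI[of _ "xs @ [z]"]) (auto simp: sorted_wrt_append)
qed simp

end

text \<open>Interval i consists of the numbers from \<open>a i\<close> up to but excluding
  \<open>a (i \<oplus> \<one>)\<close>. Starting at \<open>\<zero>\<close> and increasing strictly,
  \<open>a\<close> leaves no number uncovered.\<close>

locale block_partition = rca0_model +
  fixes a :: "'a \<Rightarrow> 'a"
  assumes F_a: "F (\<lambda>e. a (e 0))" and a_0: "a \<zero> = \<zero>" and a_step: "a i \<prec> a (i \<oplus> \<one>)"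
begin

definition idx :: "'a \<Rightarrow> 'a" where
  "idx x = least (\<lambda>i. x \<prec> a (i \<oplus> \<one>))"

lemma a_less: "i \<prec> j \<Longrightarrow> a i \<prec> a j"
  by (rule step_strict_mono[OF F_a a_step])

lemma a_mono: "i \<preceq> j \<Longrightarrow> a i \<preceq> a j"
  using a_less unfolding l2_le_def by blast

lemma le_a: "i \<preceq> a i"
proof (rule S1_induct[of "\<lambda>i. i \<preceq> a i"])
  show "S1 (\<lambda>e. e 0 \<preceq> a (e 0))" by (intro S1_rules D_rules F_app1[OF F_a] F_rules)
  show "\<And>i. i \<preceq> a i \<Longrightarrow> i \<oplus> \<one> \<preceq> a (i \<oplus> \<one>)"
    using a_step A.le_less_trans unfolding succ_le_iff by blast
qed simp

lemma D_idx: "D (\<lambda>e. x \<prec> a (e 0 \<oplus> \<one>))"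
  by (intro D_rules F_app1[OF F_a] F_rules)

lemma idx_ex: "x \<prec> a (x \<oplus> \<one>)"
  using le_a[of "x \<oplus> \<one>"] by (simp add: succ_le_iff)

lemma less_a_idx: "x \<prec> a (idx x \<oplus> \<one>)"
  unfolding idx_def by (rule least_props(1)[OF D_idx, where a = x]) (rule idx_ex)

lemma a_idx_le: "a (idx x) \<preceq> x"
proof (cases "idx x" rule: zero_cases)
  case (2 i)
  then have "\<not> x \<prec> a (i \<oplus> \<one>)"
    using least_props(2)[OF D_idx[of x] idx_ex[of x], of i] unfolding idx_def by simp
  then show ?thesis using 2 A.not_less by simp
qed (simp add: a_0)

lemma F_idx: "F t \<Longrightarrow> F (\<lambda>e. idx (t e))"
proof (rule F_app1[of idx])
  show "F (\<lambda>e. idx (e 0))"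
    unfolding idx_def
  proof (rule F_least)
    show "D (\<lambda>e. e (Suc 0) \<prec> a (e 0 \<oplus> \<one>))" by (intro D_rules F_app1[OF F_a] F_rules)
    show "\<exists>y. e 0 \<prec> a (y \<oplus> \<one>)" for e :: "nat \<Rightarrow> 'a" using idx_ex by blast
    show "D (\<lambda>f. e 0 \<prec> a (f 0 \<oplus> \<one>))" for e :: "nat \<Rightarrow> 'a" by (rule D_idx)
  qed
qed

lemma idx_less_iff: "idx x \<prec> i \<longleftrightarrow> x \<prec> a i"
proof
  assume "idx x \<prec> i"
  then have "a (idx x \<oplus> \<one>) \<preceq> a i" by (intro a_mono) (simp add: succ_le_iff)
  then show "x \<prec> a i" using less_a_idx A.less_le_trans by blast
next
  assume "x \<prec> a i"
  then have "\<not> a i \<preceq> a (idx x)" using a_idx_le A.le_less_trans A.order_trans A.not_le by metis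
  then show "idx x \<prec> i" using a_mono A.not_le by blast
qed

lemma le_idx_iff: "i \<preceq> idx x \<longleftrightarrow> a i \<preceq> x"
  using idx_less_iff A.not_less by metis

lemma idx_mono: "x \<preceq> y \<Longrightarrow> idx x \<preceq> idx y"
  using le_idx_iff a_idx_le A.order_trans by blast

lemma less_if_idx_less: "idx x \<prec> idx y \<Longrightarrow> x \<prec> y"
  using idx_mono A.not_le by blast

lemma idx_eqI: "a i \<preceq> x \<Longrightarrow> x \<prec> a (i \<oplus> \<one>) \<Longrightarrow> idx x = i"
  using le_idx_iff idx_less_iff less_succ_iff A.order_antisym by blast

lemma sorted_idx_if_no_tie:
  "sorted_wrt (l2_less M) xs \<Longrightarrow> tie_pattern idx xs = 0 \<Longrightarrow> sorted_wrt (l2_less M) (map idx xs)"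
proof (induction xs rule: induct_list012)
  case (3 x y zs)
  have "idx x \<prec> idx y" using 3(3,4) idx_mono[of x y] by (auto simp: l2_le_def split: if_splits)
  moreover have "sorted_wrt (l2_less M) (map idx (y # zs))" using 3 by (auto split: if_splits)
  ultimately show ?case using p_trans by auto
qed simp_all

lemma no_tie_if_sorted_idx: "sorted_wrt (l2_less M) (map idx xs) \<Longrightarrow> tie_pattern idx xs = 0"
  by (induction xs rule: induct_list012) (auto simp: p_irrefl)

text \<open>\<open>numeral_of\<close> takes external numbers and is no function of the structure;
  the recursion for the pattern is unwound along the list, whose length is standard.\<close>

lemma F_tie_pattern: "FL n L \<Longrightarrow> F (\<lambda>e. numeral_of M (tie_pattern idx (L e)))"
proof (induction n arbitrary: L)
  case 0
  then show ?case using FL_0_cases[of L] F_const by simp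
next
  case (Suc n)
  obtain t K where K: "F t" "FL n K" "L = (\<lambda>e. t e # K e)" using FL_Suc_cases[OF Suc.prems(1)] .
  show ?case
  proof (cases n)
    case 0
    then show ?thesis using K FL_0_cases[of K] F_const by simp
  next
    case (Suc m)
    then obtain s J where J: "F s" "FL m J" "K = (\<lambda>e. s e # J e)"
      using FL_Suc_cases[of m K] K(2) by metis
    have "numeral_of M (tie_pattern idx (L e)) = (if idx (t e) = idx (s e) then \<one> else \<zero>) \<oplus>
        (numeral_of M (tie_pattern idx (K e)) \<oplus> numeral_of M (tie_pattern idx (K e)))" for e
      unfolding K(3) J(3) by (simp add: numeral_of_add mult_2 ac_simps)
    moreover have "F (\<lambda>e. (if idx (t e) = idx (s e) then \<one> else \<zero>) \<oplus>
        (numeral_of M (tie_pattern idx (K e)) \<oplus> numeral_of M (tie_pattern idx (K e))))"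
      by (intro F_add F_if D_eq F_idx K(1) J(1) Suc.IH[OF K(2)] F_const)
    ultimately show ?thesis by simp
  qed
qed

text \<open>The tuple grows from its end to its front. Before \<open>y # ys\<close>, spare elements
  \<open>zs\<close> from the interval of \<open>y\<close> are kept, enough for all the ties that may
  still be demanded.\<close>

lemma realise_tie_pattern_aux:
  assumes blk: "\<And>v. \<exists>i xs. v \<preceq> i \<and> length xs = n \<and> sorted_wrt (l2_less M) xs \<and> set xs \<subseteq> H \<and>
      (\<forall>x\<in>set xs. idx x = i)"
    and "l < n" "q < 2 ^ l"
  shows "\<exists>zs y ys. length ys = l \<and> length zs = n - Suc l \<and> sorted_wrt (l2_less M) (zs @ y # ys) \<and>
      set (zs @ y # ys) \<subseteq> H \<and> tie_pattern idx (y # ys) = q \<and> v \<preceq> idx y \<and> (\<forall>x\<in>set zs. idx x = idx y)"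
  using assms(2,3)
proof (induction l arbitrary: q v)
  case 0
  obtain i xs where xs: "v \<preceq> i" "length xs = n" "sorted_wrt (l2_less M) xs" "set xs \<subseteq> H"
    "\<forall>x\<in>set xs. idx x = i" using blk by blast
  obtain zs y where "xs = zs @ [y]" using xs(2) 0 by (cases xs rule: rev_cases) auto
  then show ?case using xs 0 by (intro exI[of _ zs] exI[of _ y] exI[of _ "[]"]) auto
next
  case (Suc l)
  \<comment> \<open>\<open>q div 2\<close> is the pattern of the tail, and the parity of
    \<open>q\<close> decides about the new first pair.\<close>
  have q: "q div 2 < 2 ^ l" using Suc.prems by auto
  show ?case
  proof (cases "odd q")
    case True
    obtain zs y ys where IH: "length ys = l" "length zs = n - Suc l" "sorted_wrt (l2_less M) (zs @ y # ys)"
      "set (zs @ y # ys) \<subseteq> H" "tie_pattern idx (y # ys) = q div 2" "v \<preceq> idx y" "\<forall>x\<in>set zs. idx x = idx y"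
      using Suc.IH[OF _ q] Suc.prems(1) by (meson Suc_lessD)
    \<comment> \<open>A tie is produced by the last of the spare elements.\<close>
    obtain zs' x where zs: "zs = zs' @ [x]"
      using IH(2) Suc.prems(1) by (cases zs rule: rev_cases) auto
    have "tie_pattern idx (x # y # ys) = q" using IH(5,7) True by (simp add: zs)
    then show ?thesis using IH zs by (intro exI[of _ zs'] exI[of _ x] exI[of _ "y # ys"]) auto
  next
    case False
    \<comment> \<open>Without a tie the new head comes from an earlier interval, so that interval is
      fixed before the induction hypothesis is asked for a list beyond it.\<close>
    obtain i xs where xs: "v \<preceq> i" "length xs = n" "sorted_wrt (l2_less M) xs" "set xs \<subseteq> H"
      "\<forall>x\<in>set xs. idx x = i" using blk by blast
    obtain zs y ys where IH: "length ys = l" "length zs = n - Suc l" "sorted_wrt (l2_less M) (zs @ y # ys)"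
      "set (zs @ y # ys) \<subseteq> H" "tie_pattern idx (y # ys) = q div 2" "i \<oplus> \<one> \<preceq> idx y"
      using Suc.IH[OF _ q, of "i \<oplus> \<one>"] Suc.prems(1) by (meson Suc_lessD)
    \<comment> \<open>What remains is the new head together with exactly as many spare elements as
      the invariant prescribes.\<close>
    define ws where "ws = drop (Suc l) xs"
    have ws: "length ws = n - Suc l" "sorted_wrt (l2_less M) ws" "set ws \<subseteq> set xs"
      using xs by (simp_all add: ws_def sorted_wrt_drop set_drop_subset)
    obtain ws' x where wx: "ws = ws' @ [x]"
      using ws(1) Suc.prems(1) by (cases ws rule: rev_cases) auto
    have "\<forall>w\<in>set ws. w \<prec> y"
      using ws(3) xs(5) IH(6) less_if_idx_less[of _ y] by (auto simp: succ_le_iff)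
    moreover have "sorted_wrt (l2_less M) (y # ys)" using IH(3) by (simp add: sorted_wrt_append)
    ultimately have "sorted_wrt (l2_less M) (ws @ y # ys)"
      using ws(2) p_trans by (auto simp: sorted_wrt_append)
    moreover have "idx x \<noteq> idx y" using ws(3) wx xs(5) IH(6) p_irrefl by (auto simp: succ_le_iff)
    then have "tie_pattern idx (x # y # ys) = q" using IH(5) False by simp
    ultimately show ?thesis using IH(1,4) ws(1,3) xs(1,4,5) unfolding wx
      by (intro exI[of _ ws'] exI[of _ x] exI[of _ "y # ys"]) auto
  qed
qed

lemma realise_tie_pattern:
  assumes "\<And>v. \<exists>i xs. v \<preceq> i \<and> length xs = Suc m \<and> sorted_wrt (l2_less M) xs \<and> set xs \<subseteq> H \<and>
      (\<forall>x\<in>set xs. idx x = i)"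
    and "q < 2 ^ m"
  shows "\<exists>xs. length xs = Suc m \<and> sorted_wrt (l2_less M) xs \<and> set xs \<subseteq> H \<and> tie_pattern idx xs = q"
proof -
  obtain zs y ys where zs: "length ys = m" "length zs = Suc m - Suc m"
    "sorted_wrt (l2_less M) (zs @ y # ys)" "set (zs @ y # ys) \<subseteq> H" "tie_pattern idx (y # ys) = q"
    using realise_tie_pattern_aux[OF assms(1) _ assms(2)] by blast
  then have "zs = []" by simp
  then show ?thesis using zs by (intro exI[of _ "y # ys"]) simp
qed

end

section \<open>From the packed Ramsey theorem to Ramsey's theorem\<close>

context block_partition
begin

text \<open>In the value on interval i + 1, the summand \<open>a i\<close> allows for everything
  before interval i. On interval 0 the value \<open>\<zero>\<close> makes the partition relation
  hold through the empty set.\<close>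

definition packing :: "'a \<Rightarrow> 'a \<Rightarrow> 'a" where
  "packing N w = (if idx w = \<zero> then \<zero> else a (idx w \<ominus> \<one>) \<oplus> N)"

lemma packing_succ: "idx w = i \<oplus> \<one> \<Longrightarrow> packing N w = a i \<oplus> N"
  using ax_succ_nz[of i] by (simp add: packing_def)

lemma F_packing: "F (\<lambda>e. packing N (e 0))"
  unfolding packing_def by (intro F_if D_eq F_idx F_rules F_app1[OF F_a])

lemma packing_arrow:
  assumes R: "ramsey_bound (Suc m) (j \<oplus> \<one>) R" and big: "\<And>i. R (a i \<oplus> N) \<preceq> a (i \<oplus> \<one>)"
  shows "arrow M w (packing N w) (Suc m) j"
proof (cases "idx w" rule: zero_cases)
  case 1
  have "{} \<in> l2_sets M" using comprehension[of "\<lambda>_. False"] D_bool by simp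
  moreover have "has_card M {} \<zero>"
    using cnt_has_card[OF \<open>{} \<in> l2_sets M\<close>, of \<zero>] cnt_0[of "\<lambda>_. False"] D_bool by simp
  moreover have "homogeneous M (Suc m) f {}" for f
    by (auto simp: homogeneous_def subsets_of_def)
  ultimately show ?thesis using 1 unfolding arrow_def packing_def by auto
next
  case (2 i)
  then have "packing N w = a i \<oplus> N" by (rule packing_succ)
  moreover have "a (i \<oplus> \<one>) \<preceq> w" using a_idx_le[of w] 2 by simp
  ultimately show ?thesis using big[of i] A.order_trans by (intro ramsey_arrow[OF R]) metis
qed

lemma packed_block:
  assumes H: "H \<in> l2_sets M"
    and packed: "packed M (fgraph UNIV (packing (numeral_of M n \<oplus> numeral_of M n))) H"
  shows "\<exists>i xs. v \<preceq> i \<and> length xs = n \<and> sorted_wrt (l2_less M) xs \<and> set xs \<subseteq> H \<and> (\<forall>x\<in>set xs. idx x = i)"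
proof -
  let ?N = "numeral_of M n"
  \<comment> \<open>Taking \<open>w\<close> beyond \<open>a (v \<oplus> \<one>)\<close> ensures that
    even the interval preceding that of \<open>w\<close> has index at least
    \<open>v\<close>.\<close>
  obtain w m where w: "a (v \<oplus> \<one>) \<prec> w" "packing (?N \<oplus> ?N) w \<preceq> m" "has_card M (H \<inter> one_to M w) m"
  proof -
    have "\<forall>v. \<exists>w m. v \<prec> w \<and> packing (?N \<oplus> ?N) w \<preceq> m \<and> has_card M (H \<inter> one_to M w) m"
      using packed unfolding packed_def infinite_in_def pair_mem_fgraph by blast
    then show ?thesis using that by blast
  qed
  have vw: "v \<oplus> \<one> \<preceq> idx w" using w(1) le_idx_iff A.less_imp_le by blast
  obtain i where i: "idx w = i \<oplus> \<one>" using vw ax_less_0 by (cases "idx w" rule: zero_cases) (auto simp: succ_le_iff)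
  have vi: "v \<preceq> i" using vw i by simp
  let ?c = "cnt (\<lambda>x. x \<in> H)"
  have DH: "D (\<lambda>e. e 0 \<in> H)" by (intro D_mem H F_var)
  have HwI: "H \<inter> one_to M w = {x. x \<in> H \<and> \<one> \<preceq> x \<and> x \<preceq> w}" by (auto simp: one_to_def)
  have DHw: "D (\<lambda>e. e 0 \<in> H \<and> \<one> \<preceq> e 0 \<and> e 0 \<preceq> w)" by (intro D_rules DH F_rules)
  then have Hw: "H \<inter> one_to M w \<in> l2_sets M" unfolding HwI by (rule comprehension)
  have "a i \<oplus> (?N \<oplus> ?N) \<preceq> m" using w(2) packing_succ[OF i] by simp
  also have "m \<preceq> cnt (\<lambda>x. x \<in> H \<inter> one_to M w) (w \<oplus> \<one>)"
    by (rule has_card_le_cnt[OF w(3) Hw]) (auto simp: one_to_def less_succ_iff)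
  also have "\<dots> \<preceq> ?c (w \<oplus> \<one>)"
    by (rule cnt_mono[OF D_mem[OF Hw F_var] DH]) simp
  also have "\<dots> \<preceq> ?c (a (i \<oplus> \<one> \<oplus> \<one>))"
    using less_a_idx[of w] i by (intro cnt_mono_arg[OF DH]) (simp add: succ_le_iff)
  finally have "a i \<oplus> (?N \<oplus> ?N) \<preceq> ?c (a (i \<oplus> \<one> \<oplus> \<one>))" .
  moreover have "?c (a i) \<oplus> (?N \<oplus> ?N) \<preceq> a i \<oplus> (?N \<oplus> ?N)" using cnt_le[OF DH, of "a i"] by simp
  ultimately have tot: "?c (a i) \<oplus> (?N \<oplus> ?N) \<preceq> ?c (a (i \<oplus> \<one> \<oplus> \<one>))" using A.order_trans by blast
  have "\<exists>l. i \<preceq> l \<and> ?c (a l) \<oplus> ?N \<preceq> ?c (a (l \<oplus> \<one>))"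
  proof (rule ccontr)
    assume "\<not> ?thesis"
    then have "\<not> ?c (a i) \<oplus> ?N \<preceq> ?c (a (i \<oplus> \<one>))"
      "\<not> ?c (a (i \<oplus> \<one>)) \<oplus> ?N \<preceq> ?c (a (i \<oplus> \<one> \<oplus> \<one>))"
      using A.order_refl[of i] add_self_le(1)[of i \<one>] by blast+
    then have "?c (a (i \<oplus> \<one>)) \<oplus> ?N \<prec> ?c (a i) \<oplus> ?N \<oplus> ?N"
      "?c (a (i \<oplus> \<one> \<oplus> \<one>)) \<prec> ?c (a (i \<oplus> \<one>)) \<oplus> ?N"
      by (simp_all add: A.not_le)
    then have "?c (a (i \<oplus> \<one> \<oplus> \<one>)) \<prec> ?c (a i) \<oplus> ?N \<oplus> ?N" using p_trans by blast
    then show False using tot by (simp add: A.add.assoc A.not_le[symmetric])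
  qed
  then obtain l where l: "i \<preceq> l" "?c (a l) \<oplus> ?N \<preceq> ?c (a (l \<oplus> \<one>))" by blast
  obtain xs where xs: "length xs = n" "sorted_wrt (l2_less M) xs"
    "\<forall>z\<in>set xs. z \<in> H \<and> a l \<preceq> z \<and> z \<prec> a (l \<oplus> \<one>)"
    using cnt_gap_list[OF DH l(2)] by blast
  then have "v \<preceq> l \<and> length xs = n \<and> sorted_wrt (l2_less M) xs \<and> set xs \<subseteq> H \<and> (\<forall>x\<in>set xs. idx x = l)"
    using A.order_trans[OF vi l(1)] idx_eqI by blast
  then show ?thesis by blast
qed

text \<open>\<open>P\<close> will be the numeral of 2^(n-1) - 1. The numerals from 1 to
  \<open>P\<close> then serve for the nonzero tie patterns, and the colours of \<open>G\<close>,
  shifted by \<open>P\<close>, follow them, so the two kinds never coincide.\<close>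

definition block_col :: "nat \<Rightarrow> 'a \<Rightarrow> ('a \<Rightarrow> 'a) \<Rightarrow> 'a \<Rightarrow> 'a" where
  "block_col n P G z = (if numeral_of M (tie_pattern idx (untuple n z)) = \<zero>
     then P \<oplus> G (tuple M (map (\<lambda>x. idx x) (untuple n z)))
     else numeral_of M (tie_pattern idx (untuple n z)))"

lemma F_block_col:
  assumes G: "F (\<lambda>e. G (e 0))" shows "F (\<lambda>e. block_col n P G (e 0))"
proof -
  have "F (\<lambda>e. idx (e 0))" by (rule F_idx[OF F_var])
  from FL_map[of "\<lambda>x e. idx x", OF this FL_untuple[OF F_var[of 0], of n]]
  have "F (\<lambda>e. G (tuple M (map (\<lambda>x. idx x) (untuple n (e 0)))))"
    by (intro F_app1[OF G] F_tuple)
  then show ?thesis unfolding block_col_def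
    by (intro F_if D_eq F_add F_const F_tie_pattern[OF FL_untuple] F_var)
qed

lemma numeral_of_eq_zero_iff: "numeral_of M q = \<zero> \<longleftrightarrow> q = 0"
  using numeral_of_eq_iff[of q 0] by simp

lemma block_col_tie:
  assumes "length xs = n" "tie_pattern idx xs \<noteq> 0"
  shows "block_col n P G (tuple M xs) = numeral_of M (tie_pattern idx xs)"
  using assms untuple_tuple'[OF assms(1)] by (simp add: block_col_def numeral_of_eq_zero_iff)

lemma block_col_no_tie:
  assumes "length xs = n" "tie_pattern idx xs = 0"
  shows "block_col n P G (tuple M xs) = P \<oplus> G (tuple M (map idx xs))"
  using assms untuple_tuple'[OF assms(1)] by (simp add: block_col_def)

lemma block_col_range:
  assumes G: "\<And>z. z \<in> subsets_of M (Suc m) UNIV \<Longrightarrow> G z \<in> one_to M k"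
    and z: "z \<in> subsets_of M (Suc m) UNIV"
  shows "block_col (Suc m) (numeral_of M (2 ^ m - 1)) G z \<in> one_to M (numeral_of M (2 ^ m - 1) \<oplus> k)"
proof -
  let ?P = "numeral_of M (2 ^ m - 1)"
  obtain xs where xs: "z = tuple M xs" "length xs = Suc m" "sorted_wrt (l2_less M) xs"
    using z by (auto simp: subsets_of_def)
  show ?thesis
  proof (cases "tie_pattern idx xs = 0")
    case True
    have "tuple M (map idx xs) \<in> subsets_of M (Suc m) UNIV"
      using sorted_idx_if_no_tie[OF xs(3) True] xs(2) by (auto simp: subsets_of_def)
    then have "G (tuple M (map idx xs)) \<in> one_to M k" by (rule G)
    then show ?thesis
      unfolding xs(1) block_col_no_tie[OF xs(2) True] one_to_def
      using add_self_le(2) A.order_trans by auto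
  next
    case False
    have "tie_pattern idx xs \<le> 2 ^ m - 1" using tie_pattern_less[of idx xs] xs(2) by simp
    then have "numeral_of M (tie_pattern idx xs) \<preceq> ?P" by (rule numeral_of_mono)
    moreover have "numeral_of M 1 \<preceq> numeral_of M (tie_pattern idx xs)"
      using False by (intro numeral_of_mono) simp
    ultimately show ?thesis
      unfolding xs(1) block_col_tie[OF xs(2) False] one_to_def
      using A.order_trans[OF _ add_self_le(1)] by simp
  qed
qed

text \<open>
  All \<open>2 ^ m - 1\<close> nonzero tie patterns occur in a packed set, so semi-homogeneity leaves room for
  only one colour on the tuples meeting each block at most once.
\<close>

lemma no_tie_col_unique:
  assumes blk: "\<And>v. \<exists>i xs. v \<preceq> i \<and> length xs = Suc m \<and> sorted_wrt (l2_less M) xs \<and> set xs \<subseteq> H \<and>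
      (\<forall>x\<in>set xs. idx x = i)"
    and G: "\<And>z. z \<in> subsets_of M (Suc m) UNIV \<Longrightarrow> G z \<in> one_to M k"
    and semi: "semi_homogeneous M (Suc m)
      (fgraph (subsets_of M (Suc m) UNIV) (block_col (Suc m) (numeral_of M (2 ^ m - 1)) G)) H"
    and xs: "length xs = Suc m" "sorted_wrt (l2_less M) xs" "set xs \<subseteq> H" "tie_pattern idx xs = 0"
    and ys: "length ys = Suc m" "sorted_wrt (l2_less M) ys" "set ys \<subseteq> H" "tie_pattern idx ys = 0"
  shows "G (tuple M (map idx xs)) = G (tuple M (map idx ys))"
proof (rule ccontr)
  assume neq: "G (tuple M (map idx xs)) \<noteq> G (tuple M (map idx ys))"
  let ?P = "numeral_of M (2 ^ m - 1)"
  let ?col = "block_col (Suc m) ?P G"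
  let ?V = "{c. \<exists>s \<in> subsets_of M (Suc m) H. pair M s c \<in> fgraph (subsets_of M (Suc m) UNIV) ?col}"
  have V: "finite ?V" "card ?V \<le> 2 ^ m" using semi by (simp_all add: semi_homogeneous_def)
  have memV: "?col (tuple M zs) \<in> ?V"
    if "length zs = Suc m" "sorted_wrt (l2_less M) zs" "set zs \<subseteq> H" for zs
  proof -
    have "tuple M zs \<in> subsets_of M (Suc m) H" "tuple M zs \<in> subsets_of M (Suc m) UNIV"
      using that by (auto simp: subsets_of_def)
    then show ?thesis by auto
  qed
  let ?Q = "numeral_of M ` {1..<2 ^ m}"
  have QV: "?Q \<subseteq> ?V"
  proof
    fix c assume "c \<in> ?Q"
    then obtain q where q: "q \<noteq> 0" "q < 2 ^ m" "c = numeral_of M q" by auto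
    obtain zs where zs: "length zs = Suc m" "sorted_wrt (l2_less M) zs" "set zs \<subseteq> H" "tie_pattern idx zs = q"
      using realise_tie_pattern[OF blk q(2)] by blast
    then show "c \<in> ?V" using memV[OF zs(1-3)] block_col_tie[OF zs(1), of ?P G] q by simp
  qed
  \<comment> \<open>The colours of \<open>G\<close> start at 1, so the shifted ones lie above all
    numerals of tie patterns.\<close>
  have large: "?P \<oplus> G (tuple M (map idx zs)) \<notin> ?Q"
    if "length zs = Suc m" "sorted_wrt (l2_less M) zs" "tie_pattern idx zs = 0" for zs
  proof
    assume "?P \<oplus> G (tuple M (map idx zs)) \<in> ?Q"
    then obtain q where q: "q < 2 ^ m" "?P \<oplus> G (tuple M (map idx zs)) = numeral_of M q" by auto
    have "tuple M (map idx zs) \<in> subsets_of M (Suc m) UNIV"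
      using sorted_idx_if_no_tie[OF that(2,3)] that(1) by (auto simp: subsets_of_def)
    then have "\<one> \<preceq> G (tuple M (map idx zs))" using G by (auto simp: one_to_def)
    then have "?P \<oplus> \<one> \<preceq> numeral_of M q" unfolding q(2)[symmetric] by simp
    moreover have "numeral_of M q \<preceq> ?P" using q(1) by (intro numeral_of_mono) simp
    ultimately show False using succ_le_iff A.not_le by blast
  qed
  let ?c1 = "?P \<oplus> G (tuple M (map idx xs))" and ?c2 = "?P \<oplus> G (tuple M (map idx ys))"
  have "?c1 \<in> ?V" "?c2 \<in> ?V"
    using memV[OF xs(1-3)] memV[OF ys(1-3)] block_col_no_tie[OF xs(1,4)] block_col_no_tie[OF ys(1,4)] by simp_all
  then have "insert ?c1 (insert ?c2 ?Q) \<subseteq> ?V" using QV by blast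
  then have "card (insert ?c1 (insert ?c2 ?Q)) \<le> 2 ^ m" using card_mono[OF V(1)] V(2) le_trans by blast
  moreover have "card ?Q = 2 ^ m - 1" by (subst card_image) (auto intro: inj_onI)
  moreover have "?c1 \<noteq> ?c2" using neq by simp
  ultimately have "Suc (Suc (2 ^ m - 1)) \<le> (2 :: nat) ^ m"
    using large[OF xs(1,2,4)] large[OF ys(1,2,4)] by simp
  then show False by simp
qed

text \<open>The two units added to the number of colours have different origins: one is the extra
  colour in the hypothesis of \<open>PRT\<close>, the other arises because
  \<open>ramsey_bound\<close> counts colours from \<open>\<zero>\<close>.\<close>

lemma RT_if_blocks:
  assumes R: "ramsey_bound (Suc m) (numeral_of M (2 ^ m - 1) \<oplus> k \<oplus> \<one> \<oplus> \<one>) R"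
    and big: "\<And>i. R (a i \<oplus> (numeral_of M (Suc m) \<oplus> numeral_of M (Suc m))) \<preceq> a (i \<oplus> \<one>)"
    and PRT: "PRT M (Suc m) (numeral_of M (2 ^ m - 1) \<oplus> k)"
  shows "RT M (Suc m) k"
  unfolding RT_def
proof (intro allI impI)
  fix f assume f: "is_fun M (subsets_of M (Suc m) UNIV) (one_to M k) f"
  let ?S = "subsets_of M (Suc m) UNIV" and ?P = "numeral_of M (2 ^ m - 1)"
  let ?N = "numeral_of M (Suc m) \<oplus> numeral_of M (Suc m)"
  have DS: "D (\<lambda>e. e 0 \<in> ?S)" by (rule D_subsets_of[OF UNIV_mem_sets F_var])
  obtain G where G: "F (\<lambda>e. G (e 0))" "\<And>z. z \<in> ?S \<Longrightarrow> G z \<in> one_to M k"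
    "\<And>z y. pair M z y \<in> f \<longleftrightarrow> z \<in> ?S \<and> y = G z"
    using is_fun_obtain[OF f DS] by blast
  let ?col = "block_col (Suc m) ?P G"
  have "is_fun M UNIV UNIV (fgraph UNIV (packing ?N))"
    by (rule fgraph_is_fun[OF F_packing]) (simp_all add: D_bool)
  moreover have "\<forall>w u. pair M w u \<in> fgraph UNIV (packing ?N) \<longrightarrow> arrow M w u (Suc m) (?P \<oplus> k \<oplus> \<one>)"
    using packing_arrow[OF R big] by simp
  moreover have "is_fun M ?S (one_to M (?P \<oplus> k)) (fgraph ?S ?col)"
    by (rule fgraph_is_fun[OF F_block_col[OF G(1)] DS block_col_range[OF G(2)]])
  ultimately obtain H where H: "H \<in> l2_sets M" "packed M (fgraph UNIV (packing ?N)) H"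
    "semi_homogeneous M (Suc m) (fgraph ?S ?col) H"
    using PRT unfolding PRT_def by blast
  note blk = packed_block[OF H(1,2)]
  \<comment> \<open>The elements of interval i are below \<open>a (i \<oplus> \<one>)\<close>, which
    bounds the search and makes this set of indices \<open>\<Delta>\<^sub>1\<close>.\<close>
  let ?K = "{i. \<exists>x. x \<prec> a (i \<oplus> \<one>) \<and> (x \<in> H \<and> idx x = i)}"
  have "?K \<in> l2_sets M"
    by (rule comprehension) (intro D_rules D_mem[OF H(1)] F_idx F_app1[OF F_a] F_rules)
  moreover have K: "i \<in> ?K \<longleftrightarrow> (\<exists>x\<in>H. idx x = i)" for i using less_a_idx by blast
  have "infinite_in M ?K" unfolding infinite_in_def
  proof
    fix v
    obtain i xs where xs: "v \<oplus> \<one> \<preceq> i" "length xs = Suc m" "set xs \<subseteq> H" "\<forall>x\<in>set xs. idx x = i"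
      using blk by blast
    then have "hd xs \<in> set xs" by (cases xs) auto
    then have "i \<in> ?K" unfolding K using xs by blast
    then show "\<exists>x\<in>?K. v \<prec> x" using xs(1) succ_le_iff by blast
  qed
  moreover have "homogeneous M (Suc m) f ?K"
  proof -
    \<comment> \<open>Any choice of one element of \<open>H\<close> from each of the given intervals
      is increasing and free of ties, because the intervals are ordered like their indices.\<close>
    have lift: "\<exists>xs. length xs = Suc m \<and> sorted_wrt (l2_less M) xs \<and> set xs \<subseteq> H \<and>
        tie_pattern idx xs = 0 \<and> map idx xs = is"
      if "length is = Suc m" "set is \<subseteq> ?K" "sorted_wrt (l2_less M) is" for "is"
    proof -
      have "\<forall>i\<in>set is. \<exists>x. x \<in> H \<and> idx x = i" using that(2) K by blast
      then obtain h where h: "\<And>i. i \<in> set is \<Longrightarrow> h i \<in> H \<and> idx (h i) = i" by metis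
      have m: "map idx (map h is) = is" using h by (simp add: map_idI)
      then have "sorted_wrt (\<lambda>x y. idx x \<prec> idx y) (map h is)"
        using that(3) by (metis sorted_wrt_map)
      then have "sorted_wrt (l2_less M) (map h is)"
        by (rule sorted_wrt_mono_rel[rotated]) (rule less_if_idx_less)
      moreover have "tie_pattern idx (map h is) = 0" using no_tie_if_sorted_idx[of "map h is"] that(3) m by simp
      ultimately show ?thesis using h that(1) m by (intro exI[of _ "map h is"]) auto
    qed
    have uniq: "G (tuple M is) = G (tuple M is')"
      if is1: "length is = Suc m" "set is \<subseteq> ?K" "sorted_wrt (l2_less M) is"
        and is2: "length is' = Suc m" "set is' \<subseteq> ?K" "sorted_wrt (l2_less M) is'" for "is" is'
    proof -
      obtain xs where xs: "length xs = Suc m" "sorted_wrt (l2_less M) xs" "set xs \<subseteq> H"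
        "tie_pattern idx xs = 0" "map idx xs = is" using lift[OF is1] by blast
      obtain ys where ys: "length ys = Suc m" "sorted_wrt (l2_less M) ys" "set ys \<subseteq> H"
        "tie_pattern idx ys = 0" "map idx ys = is'" using lift[OF is2] by blast
      show ?thesis
        using no_tie_col_unique[OF blk G(2) H(3) xs(1-4) ys(1-4)] xs(5) ys(5) by simp
    qed
    have mem: "s \<in> ?S" if "s \<in> subsets_of M (Suc m) ?K" for s using that by (auto simp: subsets_of_def)
    have "\<exists>c. \<forall>s \<in> subsets_of M (Suc m) ?K. G s = c"
    proof (cases "subsets_of M (Suc m) ?K = {}")
      case False
      then obtain s0 where s0: "s0 \<in> subsets_of M (Suc m) ?K" by blast
      have "G s = G s0" if "s \<in> subsets_of M (Suc m) ?K" for s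
        using that s0 uniq unfolding subsets_of_def by blast
      then show ?thesis by blast
    qed simp
    then obtain c where "\<And>s. s \<in> subsets_of M (Suc m) ?K \<Longrightarrow> G s = c" by blast
    then have "\<forall>s \<in> subsets_of M (Suc m) ?K. pair M s c \<in> f" using G(3) mem by simp
    then show ?thesis unfolding homogeneous_def by (rule exI)
  qed
  ultimately show "\<exists>H\<in>l2_sets M. infinite_in M H \<and> homogeneous M (Suc m) f H"
    by (intro bexI[of _ ?K] conjI)
qed

end

section \<open>Exponent zero and the choice of the intervals\<close>

context rca0_model
begin

text \<open>The empty tuple is the only one, so the whole number domain is homogeneous. This
  exponent stands apart since the interval argument works with tuples of length
  \<open>Suc m\<close>.\<close>

lemma RT_zero: "RT M 0 k"
  unfolding RT_def
proof (intro allI impI)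
  fix f assume "is_fun M (subsets_of M 0 UNIV) (one_to M k) f"
  moreover have S: "subsets_of M 0 A = {\<zero>}" for A by (auto simp: subsets_of_def)
  ultimately obtain y where "pair M \<zero> y \<in> f" unfolding is_fun_def by blast
  then have "homogeneous M 0 f UNIV" unfolding homogeneous_def S by blast
  moreover have "infinite_in M UNIV" unfolding infinite_in_def using ax_less_succ by blast
  ultimately show "\<exists>H\<in>l2_sets M. infinite_in M H \<and> homogeneous M 0 f H" using UNIV_mem_sets by blast
qed

lemma PRT_imp_RT:
  assumes "PRT M (Suc m) (numeral_of M (2 ^ m - 1) \<oplus> k)"
  shows "RT M (Suc m) k"
proof -
  let ?N = "numeral_of M (Suc m) \<oplus> numeral_of M (Suc m)"
  obtain R where R: "ramsey_bound (Suc m) (numeral_of M (2 ^ m - 1) \<oplus> k \<oplus> \<one> \<oplus> \<one>) R"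
    using finite_ramsey[of "numeral_of M (2 ^ m - 1) \<oplus> k \<oplus> \<one> \<oplus> \<one>"] by (auto simp: less_succ_iff)
  have FR: "F (\<lambda>e. R (e 0))" using R by (simp add: ramsey_bound_def)
  \<comment> \<open>The summand \<open>R (y \<oplus> ?N)\<close> secures the partition relation from
    the next left end on; the other summands make the left ends increase strictly.\<close>
  define a where "a = prec \<zero> (\<lambda>i y. y \<oplus> R (y \<oplus> ?N) \<oplus> \<one>)"
  have h: "F (\<lambda>e. e i \<oplus> R (e i \<oplus> ?N) \<oplus> \<one>)" for i by (intro F_rules F_app1[OF FR])
  have a_succ: "a (i \<oplus> \<one>) = a i \<oplus> R (a i \<oplus> ?N) \<oplus> \<one>" for i
    unfolding a_def by (rule prec_succ) (rule h)
  interpret block_partition M a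
  proof
    show "F (\<lambda>e. a (e 0))" unfolding a_def by (intro F_prec F_const F_var h)
    show "a \<zero> = \<zero>" unfolding a_def by (rule prec_0) (rule h)
    show "a i \<prec> a (i \<oplus> \<one>)" for i unfolding a_succ by simp
  qed
  have "R (a i \<oplus> ?N) \<preceq> a (i \<oplus> \<one>)" for i unfolding a_succ using A.less_imp_le less_add_succ(2) by blast
  then show ?thesis by (rule RT_if_blocks[OF R _ assms])
qed

end

theorem theorem6p5:
  fixes M :: "'a l2_struct" and n :: nat and k :: 'a
  assumes "RCA0 M"
    and "PRT M n (numeral_of M (2 ^ (n - 1) - 1) \<oplus>\<^bsub>M\<^esub> k)"
  shows "RT M n k"
proof -
  interpret rca0_model M by unfold_locales (rule assms(1))
  show ?thesis
  proof (cases n)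
    case 0
    then show ?thesis using RT_zero by simp
  next
    case (Suc m)
    then show ?thesis using PRT_imp_RT assms(2) by simp
  qed
qed

end
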